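(* Consider approximation $\mathrm{APP}_d: H_d \to L_2([0,1]^d)$, $\mathrm{APP}_d f = f$, in the worst case setting. \begin{enumerate} \item Let $\alpha \ge 0$. Strong tractability and tractability of approximation in the class $\Lambda^{\mathrm{all}}$ are equivalent, and this holds if and only if $s_\gamma < \infty$ and $\alpha > 0$. In this case the exponent of strong tractability is $p^*(\Lambda^{\mathrm{all}}) = 2\max(s_\gamma, \alpha^{-1})$. \item Let $\alpha > 1$. Strong tractability of approximation in the class $\Lambda^{\mathrm{std}}$ holds if and only if $\sum_{j=1}^\infty \gamma_j < \infty$. When this holds, $p^*(\Lambda^{\mathrm{all}}) \le 2$ and the exponent of strong tractability satisfies $p^*(\Lambda^{\mathrm{std}}) \in [p^*(\Lambda^{\mathrm{all}}), p^*(\Lambda^{\mathrm{all}})+2]$. \item Let $\alpha > 1$. Tractability of approximation in the class $\Lambda^{\mathrm{std}}$ holds if and only if $$a := \limsup_{d\to\infty} \frac{\sum_{j=1}^d \gamma_j}{\ln d} < \infty.$$ When this holds, for every $\delta > 0$ there is $C_\delta > 0$ such that $$\mathrm{comp}^{\mathrm{wor}}(\varepsilon, H_d, \Lambda^{\mathrm{std}}) \le C_\delta\, \varepsilon^{-(2+\delta)}\, d^{\,4\zeta(\alpha) a + \delta}\qquad \forall\, d = 1,2,\dots,\ \forall\, \varepsilon \in (0,1),$$ where $\zeta(\alpha) = \sum_{h=1}^\infty h^{-\alpha}$ is the Riemann zeta function. \end{enumerate}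
   Context: Fix weights $1 \ge \gamma_1 \ge \gamma_2 \ge \cdots > 0$ and a smoothness parameter $\alpha \ge 0$. For $h = (h_1,\dots,h_d) \in \mathbb{Z}^d$ let $r_\alpha(\gamma,h) = \prod_{j=1}^d r_\alpha(\gamma_j,h_j)$, where $r_\alpha(\gamma_j,h_j) = 1$ if $h_j = 0$ and $r_\alpha(\gamma_j,h_j) = \gamma_j^{-s}|h_j|^\alpha$ if $h_j \neq 0$, with $s = 1$ if $\alpha > 0$ and $s = 0$ if $\alpha = 0$. The weighted Korobov space $H_d$ is the Hilbert space of complex-valued functions $f \in L_2([0,1]^d)$, $1$-periodic in each variable, with $\|f\|_d^2 = \sum_{h\in\mathbb{Z}^d} r_\alpha(\gamma,h)|\hat f(h)|^2 < \infty$, where $\hat f(h) = \int_{[0,1]^d} e^{-2\pi i h\cdot x} f(x)\,dx$; the inner product is $\langle f,g\rangle_d = \sum_h r_\alpha(\gamma,h)\hat f(h)\overline{\hat g(h)}$. $\mathrm{APP}_d$ is the embedding $H_d \to L_2([0,1]^d)$; its norm is $1$. The class $\Lambda^{\mathrm{all}}$ consists of all continuous linear functionals on $H_d$; for $\alpha > 1$ the class $\Lambda^{\mathrm{std}}$ consists of the point evaluations $L_x(f) = f(x)$, $x \in [0,1]^d$ (continuous since $H_d$ is then a reproducing kernel Hilbert space). In the worst case setting, algorithms are $A_{n,d}(f) = \sum_{k=1}^n a_k L_k(f)$ with $a_k \in L_2([0,1]^d)$, $L_k \in \Lambda$; the error is $e^{\mathrm{wor}}(A_{n,d}) = \sup\{\|f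 - A_{n,d}(f)\|_{L_2([0,1]^d)} : f\in H_d,\ \|f\|_d \le 1\}$, and $\mathrm{comp}^{\mathrm{wor}}(\varepsilon,H_d,\Lambda)$ is the minimal $n$ for which some such $A_{n,d}$ has $e^{\mathrm{wor}}(A_{n,d}) \le \varepsilon$. Approximation is tractable in $\Lambda$ if there are $C,p,q \ge 0$ with $\mathrm{comp}^{\mathrm{wor}}(\varepsilon,H_d,\Lambda) \le C\varepsilon^{-p}d^q$ for all $\varepsilon\in(0,1)$, $d \in \mathbb{N}$; strongly tractable if this holds with $q = 0$; the exponent of strong tractability $p^*(\Lambda)$ is the infimum of $p$ for which such a bound with $q=0$ holds. The sum-exponent is $s_\gamma = \inf\{s > 0 : \sum_{j=1}^\infty \gamma_j^s < \infty\}$ (with $\inf\emptyset = \infty$). *)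

theory Defs
  imports "HOL-Analysis.Analysis"
begin

(* Points of [0,1]^d: extensional functions on {..<d}; coordinate j (0-based) is x_{j+1}. *)
definition cube :: "nat \<Rightarrow> (nat \<Rightarrow> real) set" where
  "cube d = PiE {..<d} (\<lambda>_. {0..1})"

definition cube_measure :: "nat \<Rightarrow> (nat \<Rightarrow> real) measure" where
  "cube_measure d = PiM {..<d} (\<lambda>_. lebesgue_on {0..1})"

definition freqs :: "nat \<Rightarrow> (nat \<Rightarrow> int) set" where
  "freqs d = PiE {..<d} (\<lambda>_. UNIV)"

(* r_alpha(gamma,h); the weight of coordinate j (0-based) is gamma (Suc j) = gamma_{j+1} *)
definition r_weight :: "real \<Rightarrow> (nat \<Rightarrow> real) \<Rightarrow> nat \<Rightarrow> (nat \<Rightarrow> int) \<Rightarrow> real" where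
  "r_weight \<alpha> \<gamma> d h =
     (\<Prod>j<d. if h j = 0 then 1
             else (\<gamma> (Suc j)) powr (- (if \<alpha> > 0 then 1 else 0)) * \<bar>real_of_int (h j)\<bar> powr \<alpha>)"

definition fourier_coeff :: "nat \<Rightarrow> ((nat \<Rightarrow> real) \<Rightarrow> complex) \<Rightarrow> (nat \<Rightarrow> int) \<Rightarrow> complex" where
  "fourier_coeff d f h =
     (LINT x|cube_measure d. cis (- 2 * pi * (\<Sum>j<d. real_of_int (h j) * x j)) * f x)"

definition L2 :: "nat \<Rightarrow> ((nat \<Rightarrow> real) \<Rightarrow> complex) set" where
  "L2 d = {g. g \<in> borel_measurable (cube_measure d) \<and>
              integrable (cube_measure d) (\<lambda>x. (cmod (g x))\<^sup>2)}"

definition L2_norm :: "nat \<Rightarrow> ((nat \<Rightarrow> real) \<Rightarrow> complex) \<Rightarrow> real" where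
  "L2_norm d g = sqrt (LINT x|cube_measure d. (cmod (g x))\<^sup>2)"

definition korobov_norm_sq :: "real \<Rightarrow> (nat \<Rightarrow> real) \<Rightarrow> nat \<Rightarrow> ((nat \<Rightarrow> real) \<Rightarrow> complex) \<Rightarrow> real" where
  "korobov_norm_sq \<alpha> \<gamma> d f =
     (\<Sum>\<^sub>\<infinity>h\<in>freqs d. r_weight \<alpha> \<gamma> d h * (cmod (fourier_coeff d f h))\<^sup>2)"

(* The weighted Korobov space H_d. For alpha > 1 its elements are taken to be the
   continuous representatives (H_d is then a reproducing kernel Hilbert space),
   so that point evaluation is meaningful. *)
definition korobov :: "real \<Rightarrow> (nat \<Rightarrow> real) \<Rightarrow> nat \<Rightarrow> ((nat \<Rightarrow> real) \<Rightarrow> complex) set" where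
  "korobov \<alpha> \<gamma> d =
     {f \<in> L2 d. (\<lambda>h. r_weight \<alpha> \<gamma> d h * (cmod (fourier_coeff d f h))\<^sup>2) summable_on freqs d
              \<and> (1 < \<alpha> \<longrightarrow> continuous_on (cube d) f)}"

type_synonym functional = "((nat \<Rightarrow> real) \<Rightarrow> complex) \<Rightarrow> complex"

definition info_all :: "real \<Rightarrow> (nat \<Rightarrow> real) \<Rightarrow> nat \<Rightarrow> functional set" where
  "info_all \<alpha> \<gamma> d =
     {L. (\<forall>f\<in>korobov \<alpha> \<gamma> d. \<forall>g\<in>korobov \<alpha> \<gamma> d. L (\<lambda>x. f x + g x) = L f + L g)
       \<and> (\<forall>f\<in>korobov \<alpha> \<gamma> d. \<forall>c. L (\<lambda>x. c * f x) = c * L f)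
       \<and> (\<exists>C. \<forall>f\<in>korobov \<alpha> \<gamma> d. cmod (L f) \<le> C * sqrt (korobov_norm_sq \<alpha> \<gamma> d f))}"

definition info_std :: "nat \<Rightarrow> functional set" where
  "info_std d = {L. \<exists>x\<in>cube d. L = (\<lambda>f. f x)}"

definition alg_apply :: "nat \<Rightarrow> (nat \<Rightarrow> (nat \<Rightarrow> real) \<Rightarrow> complex) \<Rightarrow> (nat \<Rightarrow> functional)
                          \<Rightarrow> ((nat \<Rightarrow> real) \<Rightarrow> complex) \<Rightarrow> (nat \<Rightarrow> real) \<Rightarrow> complex" where
  "alg_apply n a L f = (\<lambda>x. \<Sum>k<n. L k f * a k x)"

definition wor_err :: "real \<Rightarrow> (nat \<Rightarrow> real) \<Rightarrow> nat \<Rightarrow> nat \<Rightarrow> (nat \<Rightarrow> (nat \<Rightarrow> real) \<Rightarrow> complex)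
                        \<Rightarrow> (nat \<Rightarrow> functional) \<Rightarrow> ereal" where
  "wor_err \<alpha> \<gamma> d n a L =
     (SUP f \<in> {f \<in> korobov \<alpha> \<gamma> d. korobov_norm_sq \<alpha> \<gamma> d f \<le> 1}.
        ereal (L2_norm d (\<lambda>x. f x - alg_apply n a L f x)))"

(* comp^wor(eps, H_d, Lambda); infinity if no algorithm achieves error eps *)
definition comp_wor :: "real \<Rightarrow> (nat \<Rightarrow> real) \<Rightarrow> nat \<Rightarrow> functional set \<Rightarrow> real \<Rightarrow> enat" where
  "comp_wor \<alpha> \<gamma> d \<Lambda> \<epsilon> =
     (INF n \<in> {n. \<exists>a L. (\<forall>k<n. a k \<in> L2 d \<and> L k \<in> \<Lambda>) \<and> wor_err \<alpha> \<gamma> d n a L \<le> ereal \<epsilon>}. enat n)"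

definition enat_le_real :: "enat \<Rightarrow> real \<Rightarrow> bool" where
  "enat_le_real x y \<longleftrightarrow> (\<exists>n. x = enat n \<and> real n \<le> y)"

definition tractable :: "real \<Rightarrow> (nat \<Rightarrow> real) \<Rightarrow> (nat \<Rightarrow> functional set) \<Rightarrow> bool" where
  "tractable \<alpha> \<gamma> Lam \<longleftrightarrow>
     (\<exists>C p q. C \<ge> 0 \<and> p \<ge> 0 \<and> q \<ge> 0 \<and>
        (\<forall>\<epsilon>\<in>{0<..<1}. \<forall>d\<ge>1.
           enat_le_real (comp_wor \<alpha> \<gamma> d (Lam d) \<epsilon>) (C * \<epsilon> powr (-p) * real d powr q)))"

definition strong_bound :: "real \<Rightarrow> (nat \<Rightarrow> real) \<Rightarrow> (nat \<Rightarrow> functional set) \<Rightarrow> real \<Rightarrow> bool" where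
  "strong_bound \<alpha> \<gamma> Lam p \<longleftrightarrow>
     (\<exists>C. C \<ge> 0 \<and>
        (\<forall>\<epsilon>\<in>{0<..<1}. \<forall>d\<ge>1.
           enat_le_real (comp_wor \<alpha> \<gamma> d (Lam d) \<epsilon>) (C * \<epsilon> powr (-p))))"

definition strongly_tractable :: "real \<Rightarrow> (nat \<Rightarrow> real) \<Rightarrow> (nat \<Rightarrow> functional set) \<Rightarrow> bool" where
  "strongly_tractable \<alpha> \<gamma> Lam \<longleftrightarrow> (\<exists>p\<ge>0. strong_bound \<alpha> \<gamma> Lam p)"

definition strong_exponent :: "real \<Rightarrow> (nat \<Rightarrow> real) \<Rightarrow> (nat \<Rightarrow> functional set) \<Rightarrow> real" where
  "strong_exponent \<alpha> \<gamma> Lam = Inf {p. p \<ge> 0 \<and> strong_bound \<alpha> \<gamma> Lam p}"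

(* sum-exponent s_gamma = inf {s > 0. sum_{j>=1} gamma_j^s < inf}, inf {} = infinity *)
definition sum_exponent :: "(nat \<Rightarrow> real) \<Rightarrow> ereal" where
  "sum_exponent \<gamma> = Inf (ereal ` {s. s > 0 \<and> summable (\<lambda>j. \<gamma> (Suc j) powr s)})"

definition riemann_zeta :: "real \<Rightarrow> real" where
  "riemann_zeta \<alpha> = (\<Sum>h. 1 / real (Suc h) powr \<alpha>)"

end

theory Submission
  imports Defs
begin

text \<open>
  Fourier coefficients diagonalize the embedding: its singular values are the numbers \<open>r\<^sub>h\<^sup>-\<^sup>1\<^sup>/\<^sup>2\<close>, so the
  complexity for linear information is the number of \<open>h\<close> with \<open>r\<^sub>h < \<epsilon>\<^sup>-\<^sup>2\<close>.  Counting these \<open>h\<close> from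
  above by \<open>\<Sum>h. (\<epsilon>\<^sup>-\<^sup>2 / r\<^sub>h)\<^sup>s\<close>, which is a product over the coordinates, and from below by 0-1 vectors with
  \<open>k\<close> ones, or by multiples of a unit vector, settles the first part.

  For function values the upper bounds rest on an existence result: \<open>O(T\<^sub>d / \<epsilon>\<^sup>2)\<close> nodes suffice, where
  \<open>T\<^sub>d = \<Sum>h. 1 / r\<^sub>h = \<Prod>j. (1 + 2 \<zeta>(\<alpha>) \<gamma>\<^sub>j)\<close> is the trace.  The nodes are chosen one by one by the
  lower barrier argument of Batson, Spielman and Srivastava, started at the penalty matrix
  \<open>T\<^sub>d * diag r\<close> instead of \<open>0\<close>; this makes the number of nodes independent of the number of
  frequencies, and ridge regression turns the resulting inequality into an algorithm.  This bound
  is stronger than both upper bounds claimed for function values.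

  The lower bound \<open>(1 - \<epsilon>\<^sup>2) * \<Prod>j. (1 + \<gamma>\<^sub>j)\<close> for function values already holds for integration of
  trigonometric polynomials with frequencies in \<open>{-1, 0, 1}\<close>.
\<close>

section \<open>Finite Hermitian matrices\<close>

text \<open>The frequencies kept by a truncation are chosen after \<epsilon> and \<open>d\<close>,
  numerous enough to make the tail negligible, so the number of nodes may depend on them only
  through the trace. The start \<open>T * diag r\<close> achieves this: its inverse has trace at
  most 1 on every finite index set, so the potential can be held at 1 and each node raises the
  barrier by the fixed amount 1/3. No eigenvalues occur; the entry bound
  \<open>|M p q|^2 <= M p p * M q q\<close>, Cauchy-Schwarz and the resolvent identity replace them.

  Counting frequencies cannot prove the conditions for function values necessary, because it only
  detects the sum-exponent and 1/\<alpha>. The product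
  \<open>\<Prod>j. (1 + \<gamma>\<^sub>j)\<close> detects more: at \<epsilon> = 1/2 the complexity
  bounds it up to the factor 4/3, it dominates \<open>\<Sum>j. \<gamma>\<^sub>j\<close>, and its
  logarithm is at least half that sum because every weight is at most 1. The first comparison gives
  summability, the second the condition on the limsup.\<close>

lemma homogeneous_system_nontrivial:
  fixes A :: "nat \<Rightarrow> 'a \<Rightarrow> complex"
  assumes "finite S" "n < card S"
  shows "\<exists>c. (\<exists>i\<in>S. c i \<noteq> 0) \<and> (\<forall>k<n. (\<Sum>i\<in>S. A k i * c i) = 0)"
  using assms
proof (induction n arbitrary: S A)
  case 0
  then have "S \<noteq> {}" by auto
  then show ?case by (intro exI[of _ "\<lambda>_. 1"]) auto
next
  case (Suc n)
  show ?case
  proof (cases "\<forall>i\<in>S. A n i = 0")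
    case True
    obtain c where "\<exists>i\<in>S. c i \<noteq> 0" "\<forall>k<n. (\<Sum>i\<in>S. A k i * c i) = 0"
      using Suc.IH[of S A] Suc.prems by auto
    with True show ?thesis by (intro exI[of _ c]) (auto simp: less_Suc_eq)
  next
    case False
    then obtain p where p: "p \<in> S" "A n p \<noteq> 0" by auto
    \<comment> \<open>Gaussian elimination: equation \<open>n\<close> is solved for the unknown
      \<open>p\<close>, and substituting the result leaves \<open>n\<close> equations in the other
      unknowns.\<close>
    define B where "B k i = A k i - A k p * A n i / A n p" for k i
    have "finite (S - {p})" "n < card (S - {p})" using Suc.prems p by auto
    from Suc.IH[OF this, of B] obtain c where c: "\<exists>i\<in>S-{p}. c i \<noteq> 0"
      "\<forall>k<n. (\<Sum>i\<in>S-{p}. B k i * c i) = 0" by auto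
    define t where "t = - (\<Sum>i\<in>S-{p}. A n i * c i) / A n p"
    define c' where "c' = c(p := t)"
    have split: "(\<Sum>i\<in>S. A k i * c' i) = A k p * t + (\<Sum>i\<in>S-{p}. A k i * c i)" for k
      using p Suc.prems(1) by (subst sum.remove[of _ p]) (auto simp: c'_def intro!: sum.cong)
    have "(\<Sum>i\<in>S. A k i * c' i) = 0" if "k < Suc n" for k
    proof (cases "k = n")
      case True
      then show ?thesis using p by (simp only: split) (simp add: t_def)
    next
      case False
      then have "(\<Sum>i\<in>S-{p}. B k i * c i) = 0" using c(2) that by auto
      moreover have "(\<Sum>i\<in>S-{p}. B k i * c i) = (\<Sum>i\<in>S-{p}. A k i * c i) + A k p * t"
        by (simp add: B_def t_def algebra_simps sum_subtractf sum_distrib_left sum_divide_distrib)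
      ultimately show ?thesis by (simp only: split) (simp add: algebra_simps)
    qed
    moreover have "\<exists>i\<in>S. c' i \<noteq> 0" using c(1) by (auto simp: c'_def)
    ultimately show ?thesis by blast
  qed
qed

text \<open>The index sets are finite sets of frequency vectors that depend on \<open>d\<close> and
  \<epsilon>, so the dimension cannot live in a type. Requiring zero entries off \<open>I\<close>
  turns matrix identities into equations between functions.\<close>

definition mat_on :: "'i set \<Rightarrow> ('i \<Rightarrow> 'i \<Rightarrow> complex) \<Rightarrow> bool" where
  "mat_on I A \<longleftrightarrow> (\<forall>i j. i \<notin> I \<or> j \<notin> I \<longrightarrow> A i j = 0)"

definition mat_mult :: "'i set \<Rightarrow> ('i \<Rightarrow> 'i \<Rightarrow> complex) \<Rightarrow> ('i \<Rightarrow> 'i \<Rightarrow> complex) \<Rightarrow> 'i \<Rightarrow> 'i \<Rightarrow> complex" where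
  "mat_mult I A B = (\<lambda>i j. \<Sum>k\<in>I. A i k * B k j)"

definition mat_id :: "'i set \<Rightarrow> 'i \<Rightarrow> 'i \<Rightarrow> complex" where
  "mat_id I = (\<lambda>i j. if i \<in> I \<and> i = j then 1 else 0)"

definition mat_adj :: "('i \<Rightarrow> 'i \<Rightarrow> complex) \<Rightarrow> 'i \<Rightarrow> 'i \<Rightarrow> complex" where
  "mat_adj A = (\<lambda>i j. cnj (A j i))"

definition mat_trace :: "'i set \<Rightarrow> ('i \<Rightarrow> 'i \<Rightarrow> complex) \<Rightarrow> complex" where
  "mat_trace I A = (\<Sum>i\<in>I. A i i)"

definition qform :: "'i set \<Rightarrow> ('i \<Rightarrow> 'i \<Rightarrow> complex) \<Rightarrow> ('i \<Rightarrow> complex) \<Rightarrow> complex" where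
  "qform I A c = (\<Sum>i\<in>I. \<Sum>j\<in>I. cnj (c i) * A i j * c j)"

definition mat_vec :: "'i set \<Rightarrow> ('i \<Rightarrow> 'i \<Rightarrow> complex) \<Rightarrow> ('i \<Rightarrow> complex) \<Rightarrow> 'i \<Rightarrow> complex" where
  "mat_vec I A c = (\<lambda>i. \<Sum>j\<in>I. A i j * c j)"

definition sq_norm_on :: "'i set \<Rightarrow> ('i \<Rightarrow> complex) \<Rightarrow> real" where
  "sq_norm_on I c = (\<Sum>i\<in>I. (cmod (c i))\<^sup>2)"

definition pos_def :: "'i set \<Rightarrow> ('i \<Rightarrow> 'i \<Rightarrow> complex) \<Rightarrow> bool" where
  "pos_def I N \<longleftrightarrow> mat_on I N \<and> mat_adj N = N \<and> (\<forall>c. (\<exists>i\<in>I. c i \<noteq> 0) \<longrightarrow> Re (qform I N c) > 0)"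

lemma mat_mult_assoc: "mat_mult I (mat_mult I A B) C = mat_mult I A (mat_mult I B C)"
  unfolding mat_mult_def
  by (intro ext, simp add: sum_distrib_left sum_distrib_right mult.assoc, rule sum.swap)

lemma mat_mult_id_right: "finite I \<Longrightarrow> mat_on I A \<Longrightarrow> mat_mult I A (mat_id I) = A"
  by (intro ext, auto simp: mat_mult_def mat_id_def mat_on_def if_distrib cong: if_cong)

lemma mat_mult_id_left: "finite I \<Longrightarrow> mat_on I A \<Longrightarrow> mat_mult I (mat_id I) A = A"
  unfolding mat_on_def
proof (intro ext)
  fix i j assume "finite I" "\<forall>i j. i \<notin> I \<or> j \<notin> I \<longrightarrow> A i j = 0"
  then show "mat_mult I (mat_id I) A i j = A i j"
    by (cases "i \<in> I") (auto simp: mat_mult_def mat_id_def mult_delta_left)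
qed

lemma mat_adj_mult: "mat_adj (mat_mult I A B) = mat_mult I (mat_adj B) (mat_adj A)"
  by (simp add: mat_adj_def mat_mult_def mult.commute)

lemma mat_adj_id [simp]: "mat_adj (mat_id I) = mat_id I"
  by (auto simp: mat_adj_def mat_id_def fun_eq_iff)

lemma mat_trace_commute: "mat_trace I (mat_mult I A B) = mat_trace I (mat_mult I B A)"
  unfolding mat_trace_def mat_mult_def by (subst sum.swap) (simp add: mult.commute)

lemma mat_vec_mult: "mat_vec I (mat_mult I A B) c = mat_vec I A (mat_vec I B c)"
  unfolding mat_vec_def mat_mult_def
  by (intro ext, simp add: sum_distrib_left sum_distrib_right mult.assoc, rule sum.swap)

lemma mat_vec_id: "finite I \<Longrightarrow> i \<in> I \<Longrightarrow> mat_vec I (mat_id I) c i = c i"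
  by (simp add: mat_vec_def mat_id_def mult_delta_left)

lemma qform_alt: "qform I A c = (\<Sum>i\<in>I. cnj (c i) * mat_vec I A c i)"
  by (simp add: qform_def mat_vec_def sum_distrib_left mult.assoc)

text \<open>Transfers positivity from \<open>N\<close> to \<open>M N M\<close> for Hermitian
  \<open>M\<close>. It makes an inverse positive, because then \<open>M = M N M\<close>, and makes
  traces of such products nonnegative.\<close>

lemma qform_congruence:
  assumes "mat_adj M = M"
  shows "qform I (mat_mult I M (mat_mult I N M)) c = qform I N (mat_vec I M c)"
proof -
  have M: "cnj (M k i) = M i k" for i k
    using fun_cong[OF fun_cong[OF assms, of i], of k] by (simp add: mat_adj_def)
  have "qform I (mat_mult I M (mat_mult I N M)) c
      = (\<Sum>i\<in>I. cnj (c i) * mat_vec I M (mat_vec I N (mat_vec I M c)) i)"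
    by (simp add: qform_alt mat_vec_mult)
  also have "\<dots> = (\<Sum>i\<in>I. \<Sum>k\<in>I. cnj (c i) * M i k * mat_vec I N (mat_vec I M c) k)"
    by (simp add: mat_vec_def[of I M "mat_vec I N (mat_vec I M c)"] sum_distrib_left mult.assoc)
  also have "\<dots> = (\<Sum>k\<in>I. cnj (mat_vec I M c k) * mat_vec I N (mat_vec I M c) k)"
    by (subst sum.swap) (simp add: mat_vec_def[of I M c] sum_distrib_right M mult.commute mult.left_commute)
  finally show ?thesis by (simp add: qform_alt)
qed

text \<open>Each column solves \<open>N v = e_j\<close>; positivity excludes a kernel, so counting
  unknowns gives existence. The adjoint of the right inverse \<open>M\<close> is a left inverse,
  hence \<open>M\<close> is Hermitian and two-sided.\<close>

lemma pos_def_inverse: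
  fixes N :: "'i \<Rightarrow> 'i \<Rightarrow> complex"
  assumes fin: "finite I" and pd: "pos_def I N"
  shows "\<exists>M. mat_mult I N M = mat_id I \<and> mat_mult I M N = mat_id I \<and> pos_def I M"
proof -
  have N: "mat_on I N" "mat_adj N = N" and pos: "\<And>c. \<exists>i\<in>I. c i \<noteq> 0 \<Longrightarrow> Re (qform I N c) > 0"
    using pd by (auto simp: pos_def_def)
  have "\<exists>v. \<forall>i\<in>I. (\<Sum>k\<in>I. N i k * v k) = (if i = j then 1 else 0)" if j: "j \<in> I" for j
  proof -
    define n where "n = card I"
    obtain f where f: "bij_betw f {..<n} I" unfolding n_def lessThan_atLeast0
      using ex_bij_betw_nat_finite[OF fin] by blast
    \<comment> \<open>The unknown \<open>None\<close> multiplies the right-hand side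
      \<open>e_j\<close>, so there is one unknown more than equations. A solution with
      \<open>c None = 0\<close> would be a kernel vector of \<open>N\<close>; otherwise division by
      \<open>- c None\<close> solves the system.\<close>
    define S where "S = insert None (Some ` I)"
    define A where "A k z = (case z of None \<Rightarrow> (if f k = j then 1 else 0) | Some i \<Rightarrow> N (f k) i)" for k z
    have "card (Some ` I) = n" using card_image[of Some I] by (simp add: n_def)
    then have S: "finite S" "n < card S" using fin by (auto simp: S_def card_insert_if)
    obtain c where c: "\<exists>z\<in>S. c z \<noteq> 0" "\<And>k. k < n \<Longrightarrow> (\<Sum>z\<in>S. A k z * c z) = 0"
      using homogeneous_system_nontrivial[OF S, of A] by auto
    have eq: "(\<Sum>k\<in>I. N i k * c (Some k)) + (if i = j then c None else 0) = 0" if "i \<in> I" for i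
    proof -
      have "i \<in> f ` {..<n}" using f that by (simp add: bij_betw_def)
      then obtain k where k: "k < n" "f k = i" by blast
      have "(\<Sum>z\<in>S. A k z * c z) = (\<Sum>z\<in>Some ` I. A k z * c z) + A k None * c None"
        unfolding S_def using fin by (subst sum.insert) auto
      also have "(\<Sum>z\<in>Some ` I. A k z * c z) = (\<Sum>i'\<in>I. N i i' * c (Some i'))"
        by (subst sum.reindex) (auto simp: A_def k)
      finally show ?thesis using c(2)[OF k(1)] by (auto simp: A_def k split: if_splits)
    qed
    have t: "c None \<noteq> 0"
    proof
      assume 0: "c None = 0"
      then have "\<exists>i\<in>I. c (Some i) \<noteq> 0" using c(1) by (auto simp: S_def)
      from pos[OF this] have "Re (qform I N (\<lambda>i. c (Some i))) > 0" .
      moreover have "mat_vec I N (\<lambda>i. c (Some i)) i = 0" if "i \<in> I" for i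
        using eq[OF that] 0 by (cases "i = j") (simp_all add: mat_vec_def)
      ultimately show False by (simp add: qform_alt)
    qed
    show ?thesis
    proof (intro exI[of _ "\<lambda>k. - c (Some k) / c None"] ballI)
      fix i assume "i \<in> I"
      have "(\<Sum>k\<in>I. N i k * (- c (Some k) / c None)) = - (\<Sum>k\<in>I. N i k * c (Some k)) / c None"
        by (simp add: sum_negf sum_divide_distrib)
      also have "(\<Sum>k\<in>I. N i k * c (Some k)) = - (if i = j then c None else 0)"
        using eq[OF \<open>i \<in> I\<close>] by (simp add: add_eq_0_iff)
      finally show "(\<Sum>k\<in>I. N i k * (- c (Some k) / c None)) = (if i = j then 1 else 0)"
        using t by auto
    qed
  qed
  then obtain v where v: "\<And>i j. i \<in> I \<Longrightarrow> j \<in> I \<Longrightarrow> (\<Sum>k\<in>I. N i k * v j k) = (if i = j then 1 else 0)"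
    by metis
  define M where "M k j = (if k \<in> I \<and> j \<in> I then v j k else 0)" for k j
  have M: "mat_on I M" by (auto simp: mat_on_def M_def)
  have NM: "mat_mult I N M = mat_id I"
  proof (intro ext)
    fix i j
    consider "i \<in> I" "j \<in> I" | "i \<notin> I" | "j \<notin> I" "i \<in> I" by blast
    then show "mat_mult I N M i j = mat_id I i j"
    proof cases
      case 1
      then show ?thesis using v[OF 1] by (simp add: mat_mult_def M_def mat_id_def cong: sum.cong)
    next
      case 2
      then show ?thesis using N by (simp add: mat_mult_def mat_on_def mat_id_def)
    next
      case 3
      then show ?thesis by (auto simp: mat_mult_def M_def mat_id_def)
    qed
  qed
  have aM: "mat_on I (mat_adj M)" using M by (auto simp: mat_on_def mat_adj_def)
  have adjMN: "mat_mult I (mat_adj M) N = mat_id I"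
    using arg_cong[OF NM, of mat_adj] N by (simp add: mat_adj_mult)
  have "mat_adj M = mat_mult I (mat_adj M) (mat_mult I N M)"
    by (simp add: NM mat_mult_id_right fin aM)
  also have "\<dots> = M" by (simp add: mat_mult_assoc[symmetric] adjMN mat_mult_id_left fin M)
  finally have adj: "mat_adj M = M" .
  with adjMN have MN: "mat_mult I M N = mat_id I" by simp
  have "Re (qform I M c) > 0" if "\<exists>i\<in>I. c i \<noteq> 0" for c
  proof -
    have "qform I M c = qform I N (mat_vec I M c)"
      by (simp add: qform_congruence[OF adj, symmetric] NM mat_mult_id_right fin M)
    moreover have "\<exists>i\<in>I. mat_vec I M c i \<noteq> 0"
    proof (rule ccontr)
      assume "\<not> ?thesis"
      then have "mat_vec I N (mat_vec I M c) i = 0" for i by (simp add: mat_vec_def[of I N])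
      then have "mat_vec I (mat_id I) c i = 0" for i by (simp add: mat_vec_mult[symmetric] NM)
      then show False using that mat_vec_id[OF fin] by metis
    qed
    ultimately show ?thesis using pos by simp
  qed
  then show ?thesis using NM MN M adj by (auto simp: pos_def_def)
qed

lemma mat_mult_add_left: "mat_mult I (\<lambda>i j. B i j + C i j) A = (\<lambda>i j. mat_mult I B A i j + mat_mult I C A i j)"
  by (simp add: mat_mult_def algebra_simps sum.distrib)

lemma mat_mult_diff_right: "mat_mult I A (\<lambda>i j. B i j - C i j) = (\<lambda>i j. mat_mult I A B i j - mat_mult I A C i j)"
  by (simp add: mat_mult_def algebra_simps sum_subtractf)

lemma mat_mult_diff_left: "mat_mult I (\<lambda>i j. B i j - C i j) A = (\<lambda>i j. mat_mult I B A i j - mat_mult I C A i j)"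
  by (simp add: mat_mult_def algebra_simps sum_subtractf)

lemma mat_mult_scale_right: "mat_mult I A (\<lambda>i j. a * B i j) = (\<lambda>i j. a * mat_mult I A B i j)"
  by (simp add: mat_mult_def sum_distrib_left mult.left_commute)

lemma mat_mult_scale_left: "mat_mult I (\<lambda>i j. a * B i j) A = (\<lambda>i j. a * mat_mult I B A i j)"
  by (simp add: mat_mult_def sum_distrib_left mult.assoc)

lemma pos_def_hermitian: "pos_def I M \<Longrightarrow> cnj (M i j) = M j i"
  unfolding pos_def_def mat_adj_def by (metis complex_cnj_cnj)

lemma pos_def_Re_nonneg: "pos_def I M \<Longrightarrow> 0 \<le> Re (qform I M c)"
  unfolding pos_def_def
  by (cases "\<exists>i\<in>I. c i \<noteq> 0") (auto simp: qform_def intro: less_imp_le)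

lemma pos_def_Re_pos: "pos_def I M \<Longrightarrow> i \<in> I \<Longrightarrow> c i \<noteq> 0 \<Longrightarrow> 0 < Re (qform I M c)"
  by (auto simp: pos_def_def)

lemma qform_delta:
  "finite I \<Longrightarrow> p \<in> I \<Longrightarrow> qform I M (\<lambda>i. if i = p then 1 else 0) = M p p"
  by (simp add: qform_def mult_delta_left mult_delta_right if_distrib[of cnj] sum.delta cong: if_cong)

lemma pos_def_diag:
  assumes "finite I" "pos_def I M" "p \<in> I"
  shows "M p p = of_real (Re (M p p))" "Re (M p p) > 0"
proof -
  show "M p p = of_real (Re (M p p))"
    using pos_def_hermitian[OF assms(2), of p p] by (simp add: complex_eq_iff)
  have "Re (qform I M (\<lambda>i. if i = p then 1 else 0)) > 0"
    by (rule pos_def_Re_pos[OF assms(2,3)]) simp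
  then show "Re (M p p) > 0" using qform_delta[OF assms(1,3), of M] by simp
qed

text \<open>A test vector supported on \<open>p\<close> and \<open>q\<close> exhibits the 2x2
  principal minor. This bound stands in for eigenvalues in the trace estimates that follow.\<close>

lemma pos_def_entry_bound:
  assumes fin: "finite I" and pd: "pos_def I M" and p: "p \<in> I" and q: "q \<in> I"
  shows "(cmod (M p q))\<^sup>2 \<le> Re (M p p) * Re (M q q)"
proof (cases "p = q")
  case True
  then show ?thesis using pos_def_diag[OF fin pd p]
    by (metis abs_of_pos norm_of_real order_refl power2_eq_square)
next
  case False
  let ?m = "M p q"
  define b where "b = Re (M p p)"
  have b: "M p p = of_real b" "b > 0" using pos_def_diag[OF fin pd p] by (simp_all add: b_def)
  have d: "M q q = of_real (Re (M q q))" using pos_def_diag[OF fin pd q] by simp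
  have qp: "M q p = cnj ?m" using pos_def_hermitian[OF pd, of p q] by simp
  \<comment> \<open>Row \<open>p\<close> of \<open>M\<close> annihilates this vector, so only row
    \<open>q\<close> contributes and the form equals \<open>b\<close> times the minor.\<close>
  define c where "c i = (if i = p then - ?m else if i = q then of_real b else 0)" for i
  have outer: "(\<Sum>i\<in>I. g i * c i) = - g p * ?m + g q * of_real b" for g :: "_ \<Rightarrow> complex"
  proof -
    have "(\<Sum>i\<in>I. g i * c i) = (\<Sum>i\<in>{p,q}. g i * c i)"
      by (rule sum.mono_neutral_right) (use fin p q in \<open>auto simp: c_def\<close>)
    then show ?thesis using False by (simp add: c_def)
  qed
  have outer': "(\<Sum>i\<in>I. cnj (c i) * g i) = - cnj ?m * g p + of_real b * g q" for g :: "_ \<Rightarrow> complex"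
  proof -
    have "(\<Sum>i\<in>I. cnj (c i) * g i) = (\<Sum>i\<in>{p,q}. cnj (c i) * g i)"
      by (rule sum.mono_neutral_right) (use fin p q in \<open>auto simp: c_def\<close>)
    then show ?thesis using False by (simp add: c_def)
  qed
  have sq: "?m * cnj ?m = of_real ((cmod ?m)\<^sup>2)" by (rule complex_norm_square[symmetric])
  have "qform I M c = - cnj ?m * (- M p p * ?m + ?m * of_real b) + of_real b * (- M q p * ?m + M q q * of_real b)"
    unfolding qform_alt outer' mat_vec_def outer by simp
  also have "\<dots> = of_real b * (- (?m * cnj ?m) + of_real (Re (M q q)) * of_real b)"
    unfolding b qp by (subst d) (simp add: algebra_simps)
  also have "\<dots> = of_real (b * (Re (M q q) * b - (cmod ?m)\<^sup>2))" unfolding sq by simp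
  finally have "Re (qform I M c) = b * (Re (M q q) * b - (cmod ?m)\<^sup>2)" by simp
  with pos_def_Re_nonneg[OF pd, of c] b(2) show ?thesis
    by (simp add: zero_le_mult_iff b_def mult.commute)
qed

lemma pos_def_norm_entry_bound:
  assumes "finite I" "pos_def I M" "p \<in> I" "q \<in> I"
  shows "cmod (M p q) \<le> sqrt (Re (M p p)) * sqrt (Re (M q q))"
  using pos_def_entry_bound[OF assms] real_le_rsqrt by (simp add: real_sqrt_mult[symmetric])

lemma pos_def_trace_nonneg: "finite I \<Longrightarrow> pos_def I M \<Longrightarrow> 0 \<le> Re (mat_trace I M)"
  unfolding mat_trace_def Re_sum by (intro sum_nonneg less_imp_le) (rule pos_def_diag(2))

text \<open>Spectrally, the top eigenvalue is below the trace. Here the entry bound reduces the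
  double sum to the square of \<open>sum sqrt (M i i) |c i|\<close>, and Cauchy-Schwarz does the
  rest.\<close>

lemma qform_le_trace:
  assumes "finite I" "pos_def I M"
  shows "Re (qform I M c) \<le> Re (mat_trace I M) * sq_norm_on I c"
proof -
  have "Re (qform I M c) \<le> cmod (qform I M c)" by (rule complex_Re_le_cmod)
  also have "\<dots> \<le> (\<Sum>i\<in>I. \<Sum>j\<in>I. cmod (cnj (c i) * M i j * c j))"
    unfolding qform_def by (intro order.trans[OF norm_sum] sum_mono norm_sum)
  also have "\<dots> \<le> (\<Sum>i\<in>I. \<Sum>j\<in>I. (sqrt (Re (M i i)) * cmod (c i)) * (sqrt (Re (M j j)) * cmod (c j)))"
  proof (intro sum_mono)
    fix i j assume "i \<in> I" "j \<in> I"
    from pos_def_norm_entry_bound[OF assms this]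
    have "cmod (c i) * cmod (c j) * cmod (M i j) \<le> cmod (c i) * cmod (c j) * (sqrt (Re (M i i)) * sqrt (Re (M j j)))"
      by (intro mult_left_mono) auto
    then show "cmod (cnj (c i) * M i j * c j) \<le> (sqrt (Re (M i i)) * cmod (c i)) * (sqrt (Re (M j j)) * cmod (c j))"
      by (simp add: norm_mult mult_ac)
  qed
  also have "\<dots> = (\<Sum>i\<in>I. sqrt (Re (M i i)) * cmod (c i))\<^sup>2"
    by (simp add: power2_eq_square sum_product)
  also have "\<dots> \<le> (\<Sum>i\<in>I. (sqrt (Re (M i i)))\<^sup>2) * (\<Sum>i\<in>I. (cmod (c i))\<^sup>2)"
    by (rule Cauchy_Schwarz_ineq_sum)
  also have "(\<Sum>i\<in>I. (sqrt (Re (M i i)))\<^sup>2) = Re (mat_trace I M)"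
    using pos_def_diag(2)[OF assms] by (simp add: mat_trace_def less_imp_le)
  finally show ?thesis by (simp add: sq_norm_on_def)
qed

lemma sq_norm_on_complex: "of_real (sq_norm_on I c) = (\<Sum>i\<in>I. cnj (c i) * c i)"
  unfolding sq_norm_on_def of_real_sum complex_norm_square by (simp add: mult.commute)

lemma sq_norm_on_pos: "finite I \<Longrightarrow> i \<in> I \<Longrightarrow> c i \<noteq> 0 \<Longrightarrow> 0 < sq_norm_on I c"
  unfolding sq_norm_on_def by (rule sum_pos2[of _ i]) auto

lemma mat_vec_hermitian_swap:
  assumes "pos_def I N"
  shows "(\<Sum>i\<in>I. cnj (d i) * mat_vec I N c i) = (\<Sum>i\<in>I. cnj (mat_vec I N d i) * c i)"
  unfolding mat_vec_def
  apply (simp add: sum_distrib_left sum_distrib_right pos_def_hermitian[OF assms])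
  apply (subst sum.swap)
  apply (simp add: mult_ac)
  done

text \<open>The potential, the trace of the inverse, keeps the smallest eigenvalue of
  \<open>N\<close> away from 0. The proof expands the nonnegative form at \<open>c - t d\<close>
  with \<open>d = M c\<close> and bounds the form of \<open>M\<close> by its trace.\<close>

lemma qform_ge_of_inverse_trace:
  assumes fin: "finite I" and N: "pos_def I N" and M: "pos_def I M" and NM: "mat_mult I N M = mat_id I"
    and tr: "Re (mat_trace I M) \<le> \<phi>" and phi: "\<phi> > 0"
  shows "sq_norm_on I c / \<phi> \<le> Re (qform I N c)"
proof -
  define d where "d = mat_vec I M c"
  \<comment> \<open>The expansion gives the lower bound \<open>(2 t - t^2 \<phi>) |c|^2\<close>,
    which \<open>t = 1 / \<phi>\<close> maximizes.\<close>
  define t where "t = 1 / \<phi>"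
  have Nd: "mat_vec I N d i = c i" if "i \<in> I" for i
    unfolding d_def mat_vec_mult[symmetric] NM by (rule mat_vec_id[OF fin that])
  have lin: "mat_vec I N (\<lambda>i. c i - of_real t * d i) i = mat_vec I N c i - of_real t * mat_vec I N d i" for i
    by (simp add: mat_vec_def algebra_simps sum_subtractf sum_distrib_left)
  have "qform I N (\<lambda>i. c i - of_real t * d i) =
     (\<Sum>i\<in>I. cnj (c i) * mat_vec I N c i - of_real t * (cnj (c i) * mat_vec I N d i)
        - of_real t * (cnj (d i) * mat_vec I N c i) + of_real t ^ 2 * (cnj (d i) * mat_vec I N d i))"
    unfolding qform_alt lin by (intro sum.cong) (simp_all add: algebra_simps power2_eq_square)
  also have "\<dots> = qform I N c - of_real t * (\<Sum>i\<in>I. cnj (c i) * mat_vec I N d i)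
      - of_real t * (\<Sum>i\<in>I. cnj (mat_vec I N d i) * c i) + of_real t ^ 2 * (\<Sum>i\<in>I. cnj (d i) * mat_vec I N d i)"
    unfolding qform_alt mat_vec_hermitian_swap[OF N, symmetric] sum.distrib sum_subtractf sum_distrib_left by simp
  also have "(\<Sum>i\<in>I. cnj (c i) * mat_vec I N d i) = of_real (sq_norm_on I c)"
    unfolding sq_norm_on_complex by (intro sum.cong) (simp_all add: Nd)
  also have "(\<Sum>i\<in>I. cnj (mat_vec I N d i) * c i) = of_real (sq_norm_on I c)"
    unfolding sq_norm_on_complex by (intro sum.cong) (simp_all add: Nd)
  also have "(\<Sum>i\<in>I. cnj (d i) * mat_vec I N d i) = cnj (qform I M c)"
    unfolding qform_alt d_def[symmetric] cnj_sum by (intro sum.cong) (simp_all add: Nd)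
  finally have "Re (qform I N (\<lambda>i. c i - of_real t * d i))
      = Re (qform I N c) - 2 * t * sq_norm_on I c + t\<^sup>2 * Re (qform I M c)"
    by (simp flip: of_real_power)
  moreover have "0 \<le> Re (qform I N (\<lambda>i. c i - of_real t * d i))"
    by (rule pos_def_Re_nonneg[OF N])
  moreover have "t\<^sup>2 * Re (qform I M c) \<le> t\<^sup>2 * (\<phi> * sq_norm_on I c)"
  proof (intro mult_left_mono)
    show "Re (qform I M c) \<le> \<phi> * sq_norm_on I c"
      using qform_le_trace[OF fin M, of c] mult_right_mono[OF tr, of "sq_norm_on I c"]
      by (simp add: sq_norm_on_def sum_nonneg)
  qed simp
  moreover have "t\<^sup>2 * (\<phi> * sq_norm_on I c) = t * sq_norm_on I c"
    using phi by (simp add: t_def power2_eq_square)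
  ultimately show ?thesis by (simp add: t_def)
qed

text \<open>The entry bounds on \<open>A\<close> and \<open>B\<close> make the double sum a perfect
  square, which takes the place of a diagonalization. In the barrier step this limits the growth of
  the potential under the shift.\<close>

lemma mat_trace_mult_bound:
  assumes "finite I" "pos_def I A" "pos_def I B"
  shows "Re (mat_trace I (mat_mult I A B)) \<le> Re (mat_trace I A) * Re (mat_trace I B)"
proof -
  have "Re (mat_trace I (mat_mult I A B)) \<le> cmod (mat_trace I (mat_mult I A B))" by (rule complex_Re_le_cmod)
  also have "\<dots> \<le> (\<Sum>i\<in>I. \<Sum>k\<in>I. cmod (A i k) * cmod (B k i))"
    unfolding mat_trace_def mat_mult_def
    by (intro order.trans[OF norm_sum] sum_mono) (simp add: norm_mult order.trans[OF norm_sum])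
  also have "\<dots> \<le> (\<Sum>i\<in>I. \<Sum>k\<in>I. (sqrt (Re (A i i)) * sqrt (Re (B i i))) * (sqrt (Re (A k k)) * sqrt (Re (B k k))))"
  proof (intro sum_mono)
    fix i k assume ik: "i \<in> I" "k \<in> I"
    have "cmod (A i k) * cmod (B k i) \<le> (sqrt (Re (A i i)) * sqrt (Re (A k k))) * (sqrt (Re (B k k)) * sqrt (Re (B i i)))"
      by (intro mult_mono pos_def_norm_entry_bound[OF assms(1,2)] pos_def_norm_entry_bound[OF assms(1,3)] ik)
         (use pos_def_diag(2)[OF assms(1,2)] ik in \<open>auto simp: less_imp_le\<close>)
    then show "cmod (A i k) * cmod (B k i) \<le> (sqrt (Re (A i i)) * sqrt (Re (B i i))) * (sqrt (Re (A k k)) * sqrt (Re (B k k)))"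
      by (simp add: mult_ac)
  qed
  also have "\<dots> = (\<Sum>i\<in>I. sqrt (Re (A i i)) * sqrt (Re (B i i)))\<^sup>2"
    by (simp add: power2_eq_square sum_product)
  also have "\<dots> \<le> (\<Sum>i\<in>I. (sqrt (Re (A i i)))\<^sup>2) * (\<Sum>i\<in>I. (sqrt (Re (B i i)))\<^sup>2)"
    by (rule Cauchy_Schwarz_ineq_sum)
  also have "\<dots> = Re (mat_trace I A) * Re (mat_trace I B)"
    using pos_def_diag(2)[OF assms(1,2)] pos_def_diag(2)[OF assms(1,3)] by (simp add: mat_trace_def less_imp_le)
  finally show ?thesis .
qed

text \<open>Each diagonal entry of \<open>A B A\<close> is the form of \<open>B\<close> at a column
  of \<open>A\<close>.\<close>

lemma mat_trace_congruence_nonneg: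
  assumes "finite I" "pos_def I A" "pos_def I B"
  shows "0 \<le> Re (mat_trace I (mat_mult I A (mat_mult I B A)))"
proof -
  have "0 \<le> Re (mat_mult I A (mat_mult I B A) p p)" if "p \<in> I" for p
    using qform_delta[OF assms(1) that, of "mat_mult I A (mat_mult I B A)"]
      qform_congruence[of A I B] pos_def_Re_nonneg[OF assms(3)] assms(2)
    by (metis pos_def_def)
  then show ?thesis by (simp add: mat_trace_def sum_nonneg)
qed

section \<open>Lower barrier point selection\<close>

definition outer_prod :: "'i set \<Rightarrow> ('i \<Rightarrow> complex) \<Rightarrow> 'i \<Rightarrow> 'i \<Rightarrow> complex" where
  "outer_prod I u = (\<lambda>i j. if i \<in> I \<and> j \<in> I then u i * cnj (u j) else 0)"

text \<open>The position of the barrier is absorbed into \<open>N\<close>, so moving it means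
  subtracting a multiple of the identity. The inverse is carried as a witness together with its own
  positivity; its trace is the potential.\<close>

definition barrier_inv :: "'i set \<Rightarrow> real \<Rightarrow> ('i \<Rightarrow> 'i \<Rightarrow> complex) \<Rightarrow> bool" where
  "barrier_inv I \<phi> N \<longleftrightarrow> pos_def I N \<and>
     (\<exists>M. mat_mult I N M = mat_id I \<and> mat_mult I M N = mat_id I \<and> pos_def I M \<and> Re (mat_trace I M) \<le> \<phi>)"

lemma qform_diff: "qform I (\<lambda>i j. A i j - B i j) c = qform I A c - qform I B c"
  by (simp add: qform_def algebra_simps sum_subtractf)

lemma qform_add: "qform I (\<lambda>i j. A i j + B i j) c = qform I A c + qform I B c"
  by (simp add: qform_def algebra_simps sum.distrib)

lemma qform_scale: "qform I (\<lambda>i j. a * B i j) c = a * qform I B c"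
  by (simp add: qform_def sum_distrib_left mult_ac)

lemma qform_sum: "qform I (\<lambda>i j. \<Sum>k\<in>K. A k i j) c = (\<Sum>k\<in>K. qform I (A k) c)"
  by (induction K rule: infinite_finite_induct) (simp_all add: qform_add, simp_all add: qform_def)

lemma qform_id: "finite I \<Longrightarrow> qform I (mat_id I) c = of_real (sq_norm_on I c)"
  by (simp add: qform_alt mat_vec_id sq_norm_on_complex)

lemma qform_outer_prod: "qform I (outer_prod I u) c = of_real ((cmod (\<Sum>i\<in>I. cnj (u i) * c i))\<^sup>2)"
proof -
  have "qform I (outer_prod I u) c = (\<Sum>i\<in>I. \<Sum>j\<in>I. (u i * cnj (c i)) * (cnj (u j) * c j))"
    unfolding qform_def outer_prod_def by (intro sum.cong refl) (simp add: mult_ac)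
  also have "\<dots> = cnj (\<Sum>i\<in>I. cnj (u i) * c i) * (\<Sum>i\<in>I. cnj (u i) * c i)"
    by (simp add: sum_product)
  finally show ?thesis unfolding complex_norm_square by (simp only: mult.commute)
qed

text \<open>One step of the lower barrier method of Batson, Spielman and Srivastava: if the rank-one
  matrices \<open>u x (u x)\<^sup>*\<close> average to the identity, some \<open>x\<close> compensates the increase of the potential
  \<open>trace (N\<^sup>-\<^sup>1)\<close> caused by lowering \<open>N\<close> by \<open>\<eta>\<close> times the identity.\<close>
lemma barrier_step:
  fixes N :: "'i \<Rightarrow> 'i \<Rightarrow> complex"
  assumes fin: "finite I" and phi: "\<phi> > 0" and inv: "barrier_inv I \<phi> N"
    and avg: "\<And>K. \<exists>x\<in>X. Re (mat_trace I K) \<le> Re (qform I K (u x))"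
  defines "\<eta> \<equiv> 1 / (1 + 2 * \<phi>)"
  shows "\<exists>x\<in>X. barrier_inv I \<phi> (\<lambda>i j. N i j - of_real \<eta> * mat_id I i j + outer_prod I (u x) i j)"
proof -
  \<comment> \<open>The relation \<open>\<eta> (1 + 2 \<phi>) = 1\<close> balances the step: after
    the shift the potential is at most \<open>2 \<phi>\<close>, and the averaging argument then has
    to pay for a factor of at most \<open>1 + 2 \<phi>\<close>.\<close>
  have eta: "\<eta> > 0" "\<eta> * \<phi> \<le> 1/2" "\<eta> < 1 / \<phi>" "\<eta> * (1 + 2 * \<phi>) = 1"
    using phi by (auto simp: \<eta>_def field_simps)
  obtain M where N: "pos_def I N" and NM: "mat_mult I N M = mat_id I" and MN: "mat_mult I M N = mat_id I"
    and M: "pos_def I M" and tr: "Re (mat_trace I M) \<le> \<phi>"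
    using inv by (auto simp: barrier_inv_def)
  have matM: "mat_on I M" and matN: "mat_on I N" using M N by (auto simp: pos_def_def)
  have id: "mat_on I (mat_id I)" by (auto simp: mat_on_def mat_id_def)
  define N' where "N' = (\<lambda>i j. N i j - of_real \<eta> * mat_id I i j)"
  have N': "pos_def I N'"
    unfolding pos_def_def
  proof (intro conjI allI impI)
    show "mat_on I N'" using matN id by (auto simp: mat_on_def N'_def)
    show "mat_adj N' = N'"
      by (auto simp: fun_eq_iff mat_adj_def N'_def mat_id_def pos_def_hermitian[OF N])
    fix c :: "'i \<Rightarrow> complex" assume "\<exists>i\<in>I. c i \<noteq> 0"
    then have "sq_norm_on I c > 0" using sq_norm_on_pos[OF fin] by auto
    then have "\<eta> * sq_norm_on I c < sq_norm_on I c / \<phi>"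
      using mult_strict_right_mono[OF eta(3)] by simp
    also have "\<dots> \<le> Re (qform I N c)"
      by (rule qform_ge_of_inverse_trace[OF fin N M NM tr phi])
    finally show "0 < Re (qform I N' c)"
      by (simp add: N'_def qform_diff qform_scale qform_id[OF fin])
  qed
  obtain M' where NM': "mat_mult I N' M' = mat_id I" and MN': "mat_mult I M' N' = mat_id I" and M': "pos_def I M'"
    using pos_def_inverse[OF fin N'] by blast
  have matM': "mat_on I M'" using M' by (auto simp: pos_def_def)
  let ?P = "mat_mult I M' M"
  \<comment> \<open>Resolvent identity, from inserting \<open>N' = N - \<eta>\<close> between the
    two inverses. The trace comparisons below all come from it.\<close>
  have resolvent: "M' i j - M i j = of_real \<eta> * ?P i j" for i j
  proof -
    have "mat_mult I M' (mat_mult I N' M) = M"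
      by (simp add: mat_mult_assoc[symmetric] MN' mat_mult_id_left fin matM)
    moreover have "mat_mult I N' M = (\<lambda>i j. mat_id I i j - of_real \<eta> * M i j)"
      unfolding N'_def mat_mult_diff_left mat_mult_scale_left by (simp add: NM mat_mult_id_left fin matM)
    ultimately have "M = (\<lambda>i j. M' i j - of_real \<eta> * ?P i j)"
      by (simp add: mat_mult_diff_right mat_mult_scale_right mat_mult_id_right fin matM')
    then show ?thesis by (metis diff_diff_eq2 add_diff_cancel_left')
  qed
  \<comment> \<open>\<open>\<eta> * T1\<close> is exactly the rise of the potential caused by the
    shift; the new vector has to win it back.\<close>
  define T1 where "T1 = Re (mat_trace I ?P)"
  define T2 where "T2 = Re (mat_trace I (mat_mult I M' M'))"
  define t' where "t' = Re (mat_trace I M')"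
  have trdiff: "t' - Re (mat_trace I M) = \<eta> * T1"
  proof -
    have "mat_trace I M' - mat_trace I M = of_real \<eta> * mat_trace I ?P"
      by (simp add: mat_trace_def sum_subtractf[symmetric] resolvent sum_distrib_left)
    from arg_cong[OF this, of Re] show ?thesis by (simp add: t'_def T1_def)
  qed
  have t'0: "0 \<le> t'" unfolding t'_def by (rule pos_def_trace_nonneg[OF fin M'])
  \<comment> \<open>The rise is at most half of the new potential \<open>t'\<close>, whence
    \<open>t' <= 2 \<phi>\<close>.\<close>
  have "T1 \<le> t' * Re (mat_trace I M)"
    unfolding T1_def t'_def by (rule mat_trace_mult_bound[OF fin M' M])
  also have "\<dots> \<le> t' * \<phi>" using tr t'0 by (intro mult_left_mono)
  finally have "\<eta> * T1 \<le> \<eta> * \<phi> * t'" using eta by (simp add: mult_left_mono mult_ac)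
  also have "\<dots> \<le> 1/2 * t'" using eta(2) t'0 by (intro mult_right_mono)
  finally have t'2: "t' \<le> 2 * \<phi>" using trdiff tr by linarith
  have T12: "T1 \<le> T2"
  proof -
    let ?Q = "mat_mult I M' (mat_mult I M' M)"
    have "mat_trace I (mat_mult I M' M') - mat_trace I ?P = of_real \<eta> * mat_trace I ?Q"
    proof -
      have "mat_mult I M' M' i j - ?P i j = of_real \<eta> * ?Q i j" for i j
      proof -
        have "mat_mult I M' M' i j - ?P i j = mat_mult I M' (\<lambda>i j. M' i j - M i j) i j"
          by (simp add: mat_mult_diff_right)
        also have "(\<lambda>i j. M' i j - M i j) = (\<lambda>i j. of_real \<eta> * ?P i j)" by (simp add: resolvent)
        finally show ?thesis by (simp add: mat_mult_scale_right)
      qed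
      then show ?thesis by (simp add: mat_trace_def sum_subtractf[symmetric] sum_distrib_left)
    qed
    moreover have "mat_trace I ?Q = mat_trace I (mat_mult I M' (mat_mult I M M'))"
      using mat_trace_commute[of I M' "mat_mult I M' M"] by (simp add: mat_mult_assoc)
    ultimately have "T2 - T1 = \<eta> * Re (mat_trace I (mat_mult I M' (mat_mult I M M')))"
      unfolding T1_def T2_def by (metis minus_complex.simps(1) times_complex.simps(1) Re_complex_of_real Im_complex_of_real mult_zero_left diff_0_right)
    then show ?thesis using mat_trace_congruence_nonneg[OF fin M' M] eta(1)
      by (smt (verit) mult_nonneg_nonneg)
  qed
  \<comment> \<open>The resolvent identity writes \<open>T1\<close> as the squared Frobenius norm of
    \<open>M\<close> plus \<eta> times the trace of the congruence \<open>M M' M\<close>.\<close>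
  have T1_0: "0 \<le> T1"
  proof -
    have "?P = mat_mult I (\<lambda>i j. M i j + of_real \<eta> * ?P i j) M"
      by (simp add: resolvent[symmetric])
    also have "\<dots> = (\<lambda>i j. mat_mult I M M i j + of_real \<eta> * mat_mult I ?P M i j)"
      by (simp only: mat_mult_add_left mat_mult_scale_left)
    finally have "mat_trace I ?P = mat_trace I (\<lambda>i j. mat_mult I M M i j + of_real \<eta> * mat_mult I ?P M i j)"
      by (rule arg_cong)
    also have "\<dots> = mat_trace I (mat_mult I M M) + of_real \<eta> * mat_trace I (mat_mult I ?P M)"
      by (simp add: mat_trace_def sum.distrib sum_distrib_left)
    also have "mat_trace I (mat_mult I ?P M) = mat_trace I (mat_mult I M (mat_mult I M' M))"
      by (rule mat_trace_commute)
    finally have "T1 = Re (mat_trace I (mat_mult I M M)) + \<eta> * Re (mat_trace I (mat_mult I M (mat_mult I M' M)))"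
      by (simp add: T1_def)
    moreover have "mat_trace I (mat_mult I M M) = of_real (\<Sum>i\<in>I. \<Sum>k\<in>I. (cmod (M i k))\<^sup>2)"
      unfolding mat_trace_def mat_mult_def of_real_sum complex_norm_square pos_def_hermitian[OF M] ..
    ultimately show ?thesis
      using mat_trace_congruence_nonneg[OF fin M M'] eta(1) by (simp add: sum_nonneg)
  qed
  \<comment> \<open>The goal is \<open>\<eta> T1 (1 + s) <= |w|^2\<close>. Both \<open>s\<close> and
    \<open>|w|^2\<close> are quadratic forms in \<open>u x\<close>, so they are merged into one
    matrix and averaged once.\<close>
  define K where "K = (\<lambda>i j. mat_mult I M' M' i j - of_real (\<eta> * T1) * M' i j)"
  obtain x where x: "x \<in> X" and Kx: "Re (mat_trace I K) \<le> Re (qform I K (u x))"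
    using avg by blast
  have trK: "Re (mat_trace I K) = T2 - \<eta> * T1 * t'"
    by (simp add: K_def mat_trace_def T2_def t'_def sum_subtractf sum_distrib_left[symmetric])
  define w where "w = mat_vec I M' (u x)"
  define s where "s = Re (qform I M' (u x))"
  have s0: "0 \<le> s" unfolding s_def by (rule pos_def_Re_nonneg[OF M'])
  have cs: "qform I M' (u x) = of_real s"
  proof -
    have "cnj (qform I M' (u x)) = qform I M' (u x)"
      unfolding qform_alt using mat_vec_hermitian_swap[OF M', of "u x" "u x"]
      by (simp add: cnj_sum mult.commute)
    then show ?thesis unfolding s_def by (metis Reals_cnj_iff of_real_Re)
  qed
  have qMM: "qform I (mat_mult I M' M') (u x) = of_real (sq_norm_on I w)"
    unfolding sq_norm_on_complex qform_alt mat_vec_mult w_def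
    by (rule mat_vec_hermitian_swap[OF M'])
  have "Re (qform I K (u x)) = sq_norm_on I w - \<eta> * T1 * s"
    unfolding K_def qform_diff qform_scale qMM cs by simp
  with Kx trK have "T2 - \<eta> * T1 * t' \<le> sq_norm_on I w - \<eta> * T1 * s" by simp
  \<comment> \<open>This says that the trace of \<open>K\<close> is at least
    \<open>\<eta> T1\<close>; it combines \<open>t' <= 2 \<phi>\<close>, the choice of \<eta> and
    \<open>T1 <= T2\<close>.\<close>
  moreover have "\<eta> * T1 * (1 + t') \<le> T2"
  proof -
    have "\<eta> * T1 * (1 + t') \<le> \<eta> * T1 * (1 + 2 * \<phi>)"
      using t'2 eta T1_0 by (intro mult_left_mono) auto
    also have "\<dots> = T1" using eta(4) by (metis mult.commute mult.left_commute mult.right_neutral)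
    finally show ?thesis using T12 by simp
  qed
  ultimately have w_ge: "\<eta> * T1 * (1 + s) \<le> sq_norm_on I w"
    by (simp add: algebra_simps)
  define N2 where "N2 = (\<lambda>i j. N' i j + outer_prod I (u x) i j)"
  have N2: "pos_def I N2"
    unfolding pos_def_def
  proof (intro conjI allI impI)
    show "mat_on I N2" using N' by (auto simp: mat_on_def N2_def outer_prod_def pos_def_def)
    show "mat_adj N2 = N2"
      by (auto simp: fun_eq_iff mat_adj_def N2_def outer_prod_def pos_def_hermitian[OF N'])
    fix c :: "'i \<Rightarrow> complex" assume "\<exists>i\<in>I. c i \<noteq> 0"
    then have "0 < Re (qform I N' c)" using pos_def_Re_pos[OF N'] by auto
    then show "0 < Re (qform I N2 c)"
      by (simp add: N2_def qform_add qform_outer_prod add_pos_nonneg)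
  qed
  obtain M2 where NM2: "mat_mult I N2 M2 = mat_id I" and MN2: "mat_mult I M2 N2 = mat_id I" and M2: "pos_def I M2"
    using pos_def_inverse[OF fin N2] by blast
  have matM2: "mat_on I M2" using M2 by (auto simp: pos_def_def)
  \<comment> \<open>Sherman-Morrison formula for the inverse of \<open>N2\<close>. Its trace falls
    below that of \<open>M'\<close> by \<open>|w|^2 / (1 + s)\<close>, which covers the rise
    \<open>\<eta> T1\<close>.\<close>
  define R where "R = (\<lambda>i j. M' i j - of_real (1 / (1 + s)) * outer_prod I w i j)"
  have matR: "mat_on I R" using matM' by (auto simp: R_def mat_on_def outer_prod_def)
  have uM': "(\<Sum>k\<in>I. cnj (u x k) * M' k j) = cnj (w j)" for j
    by (simp add: w_def mat_vec_def pos_def_hermitian[OF M'] mult.commute)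
  have uw: "(\<Sum>k\<in>I. cnj (u x k) * w k) = of_real s"
    using cs by (simp add: qform_alt w_def)
  have N'w: "(\<Sum>k\<in>I. N' i k * w k) = u x i" if "i \<in> I" for i
    using mat_vec_id[OF fin that, of "u x"]
    by (simp add: NM'[symmetric] mat_vec_mult w_def[symmetric]) (simp add: mat_vec_def)
  have "mat_mult I N2 R = mat_id I"
  proof (intro ext)
    fix i j
    show "mat_mult I N2 R i j = mat_id I i j"
    proof (cases "i \<in> I \<and> j \<in> I")
      case True
      define a where "a = complex_of_real (1 / (1 + s))"
      have "a * (1 + of_real s) = of_real (1 / (1 + s) * (1 + s))"
        by (simp only: a_def of_real_mult of_real_add of_real_1)
      also have "1 / (1 + s) * (1 + s) = 1" using s0 by simp
      finally have a: "a * (1 + of_real s) = 1" by simp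
      have "mat_mult I N2 R i j = mat_mult I N' M' i j + u x i * (\<Sum>k\<in>I. cnj (u x k) * M' k j)
          - a * ((\<Sum>k\<in>I. N' i k * w k) * cnj (w j) + u x i * (\<Sum>k\<in>I. cnj (u x k) * w k) * cnj (w j))"
        using True unfolding mat_mult_def N2_def R_def outer_prod_def a_def[symmetric]
        by (simp add: algebra_simps sum.distrib sum_subtractf sum_distrib_left sum_distrib_right cong: sum.cong)
      also have "\<dots> = mat_id I i j + u x i * cnj (w j) - (a * (1 + of_real s)) * (u x i * cnj (w j))"
        unfolding uM' uw NM' N'w[OF conjunct1[OF True]] by (simp add: algebra_simps)
      also note a
      finally show ?thesis by simp
    next
      case False
      then show ?thesis using matR N2
        by (auto simp: mat_mult_def mat_on_def mat_id_def pos_def_def)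
    qed
  qed
  then have "M2 = R"
    by (metis MN2 mat_mult_assoc mat_mult_id_left mat_mult_id_right fin matM2 matR)
  then have "mat_trace I M2 = mat_trace I M' - of_real (1 / (1 + s)) * of_real (sq_norm_on I w)"
    unfolding sq_norm_on_complex
    by (simp add: R_def mat_trace_def outer_prod_def sum_subtractf sum_distrib_left mult.commute)
  then have "Re (mat_trace I M2) = t' - sq_norm_on I w / (1 + s)"
    unfolding t'_def by (simp flip: of_real_mult)
  also have "\<dots> \<le> t' - \<eta> * T1"
    using w_ge s0 by (simp add: pos_le_divide_eq)
  also have "\<dots> \<le> \<phi>" using trdiff tr by simp
  finally have "barrier_inv I \<phi> N2"
    unfolding barrier_inv_def using N2 NM2 MN2 M2 by blast
  then show ?thesis using x unfolding N2_def N'_def by blast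
qed

lemma barrier_iterate:
  fixes N :: "'i \<Rightarrow> 'i \<Rightarrow> complex"
  assumes fin: "finite I" and phi: "\<phi> > 0" and inv: "barrier_inv I \<phi> N"
    and avg: "\<And>K. \<exists>x\<in>X. Re (mat_trace I K) \<le> Re (qform I K (u x))"
  shows "\<exists>x. (\<forall>k<n. x k \<in> X) \<and>
    barrier_inv I \<phi> (\<lambda>i j. N i j - of_real (real n / (1 + 2 * \<phi>)) * mat_id I i j + (\<Sum>k<n. outer_prod I (u (x k)) i j))"
proof (induction n)
  case 0
  then show ?case using inv by simp
next
  case (Suc n)
  then obtain x where x: "\<And>k. k < n \<Longrightarrow> x k \<in> X" and
    "barrier_inv I \<phi> (\<lambda>i j. N i j - of_real (real n / (1 + 2 * \<phi>)) * mat_id I i j + (\<Sum>k<n. outer_prod I (u (x k)) i j))"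
    (is "barrier_inv I \<phi> ?N") by blast
  from barrier_step[OF fin phi this(2) avg] obtain z where z: "z \<in> X" and
    *: "barrier_inv I \<phi> (\<lambda>i j. ?N i j - of_real (1 / (1 + 2 * \<phi>)) * mat_id I i j + outer_prod I (u z) i j)"
    by blast
  define y where "y = x(n := z)"
  have "(\<lambda>i j. ?N i j - of_real (1 / (1 + 2 * \<phi>)) * mat_id I i j + outer_prod I (u z) i j)
    = (\<lambda>i j. N i j - of_real (real (Suc n) / (1 + 2 * \<phi>)) * mat_id I i j + (\<Sum>k<Suc n. outer_prod I (u (y k)) i j))"
    by (auto simp: fun_eq_iff y_def add_divide_distrib algebra_simps intro!: sum.cong)
  then show ?case using * x z by (intro exI[of _ y]) (auto simp: y_def less_Suc_eq)
qed

section \<open>Sampling points and reconstruction from the barrier\<close>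

definition mat_diag :: "'i set \<Rightarrow> ('i \<Rightarrow> real) \<Rightarrow> 'i \<Rightarrow> 'i \<Rightarrow> complex" where
  "mat_diag I r = (\<lambda>i j. if i \<in> I \<and> i = j then of_real (r i) else 0)"

lemma mat_vec_diag: "finite I \<Longrightarrow> i \<in> I \<Longrightarrow> mat_vec I (mat_diag I r) c i = of_real (r i) * c i"
  by (simp add: mat_vec_def mat_diag_def mult_delta_left)

lemma qform_diag:
  "finite I \<Longrightarrow> qform I (mat_diag I r) c = of_real (\<Sum>i\<in>I. r i * (cmod (c i))\<^sup>2)"
  unfolding qform_alt of_real_sum of_real_mult complex_norm_square
  by (intro sum.cong) (simp_all add: mat_vec_diag mult_ac)

lemma mat_mult_diag:
  assumes "finite I"
  shows "mat_mult I (mat_diag I r) (mat_diag I s) = mat_diag I (\<lambda>i. r i * s i)"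
proof (intro ext)
  fix i j
  show "mat_mult I (mat_diag I r) (mat_diag I s) i j = mat_diag I (\<lambda>i. r i * s i) i j"
    using assms by (cases "i \<in> I") (auto simp: mat_mult_def mat_diag_def mult_delta_left)
qed

lemma pos_def_mat_diag:
  assumes "finite I" "\<And>i. i \<in> I \<Longrightarrow> r i > 0"
  shows "pos_def I (mat_diag I r)"
  unfolding pos_def_def
proof (intro conjI allI impI)
  show "mat_on I (mat_diag I r)" by (auto simp: mat_on_def mat_diag_def)
  show "mat_adj (mat_diag I r) = mat_diag I r" by (auto simp: mat_adj_def mat_diag_def fun_eq_iff)
  fix c :: "'a \<Rightarrow> complex" assume "\<exists>i\<in>I. c i \<noteq> 0"
  then obtain i where "i \<in> I" "c i \<noteq> 0" by blast
  then have "0 < (\<Sum>i\<in>I. r i * (cmod (c i))\<^sup>2)"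
    using assms by (intro sum_pos2[of I i]) (auto simp: less_imp_le)
  then show "0 < Re (qform I (mat_diag I r) c)" by (simp add: qform_diag[OF assms(1)])
qed

text \<open>The start \<open>T * diag r\<close> has inverse trace
  \<open>(sum 1 / r) / T <= 1\<close>, so \<open>\<phi> = 1\<close> and every step moves the barrier
  by \<open>1 / (1 + 2)\<close>. Positivity of the final matrix is the inequality. The premise
  \<open>avg\<close> holds as soon as the rank-one matrices of the \<open>u x\<close> have the
  identity as their mean.\<close>

lemma exists_sampling_points:
  fixes r :: "'i \<Rightarrow> real"
  assumes fin: "finite I" and r: "\<And>i. i \<in> I \<Longrightarrow> r i > 0" and T: "T > 0" "(\<Sum>i\<in>I. 1 / r i) \<le> T"
    and avg: "\<And>K. \<exists>x\<in>X. Re (mat_trace I K) \<le> Re (qform I K (u x))"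
  shows "\<exists>x. (\<forall>k<n. x k \<in> X) \<and> (\<forall>c. real n / 3 * sq_norm_on I c
    \<le> T * (\<Sum>i\<in>I. r i * (cmod (c i))\<^sup>2) + (\<Sum>k<n. (cmod (\<Sum>i\<in>I. cnj (u (x k) i) * c i))\<^sup>2))"
proof -
  let ?N = "mat_diag I (\<lambda>i. T * r i)" and ?M = "mat_diag I (\<lambda>i. 1 / (T * r i))"
  have eq: "mat_diag I (\<lambda>i. T * r i * (1 / (T * r i))) = mat_id I"
    "mat_diag I (\<lambda>i. (1 / (T * r i)) * (T * r i)) = mat_id I"
    using r T by (auto simp: mat_diag_def mat_id_def fun_eq_iff) (metis less_irrefl)+
  have "Re (mat_trace I ?M) = (\<Sum>i\<in>I. 1 / r i) / T"
    by (simp add: mat_trace_def mat_diag_def sum_divide_distrib mult.commute)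
  also have "\<dots> \<le> 1" using T by simp
  finally have tr: "Re (mat_trace I ?M) \<le> 1" .
  have "barrier_inv I 1 ?N"
    unfolding barrier_inv_def
  proof (intro conjI exI[of _ ?M])
    show "pos_def I ?N" "pos_def I ?M" using r T by (auto intro!: pos_def_mat_diag fin)
    show "mat_mult I ?N ?M = mat_id I" "mat_mult I ?M ?N = mat_id I"
      using eq by (simp_all only: mat_mult_diag[OF fin])
    show "Re (mat_trace I ?M) \<le> 1" by (rule tr)
  qed
  from barrier_iterate[OF fin _ this avg, of n] obtain x where x: "\<forall>k<n. x k \<in> X" and
    inv: "barrier_inv I 1 (\<lambda>i j. ?N i j - of_real (real n / 3) * mat_id I i j + (\<Sum>k<n. outer_prod I (u (x k)) i j))"
    by auto
  show ?thesis
  proof (intro exI[of _ x] conjI x allI)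
    fix c
    have "0 \<le> Re (qform I (\<lambda>i j. ?N i j - of_real (real n / 3) * mat_id I i j + (\<Sum>k<n. outer_prod I (u (x k)) i j)) c)"
      using inv by (intro pos_def_Re_nonneg) (simp add: barrier_inv_def)
    also have "qform I (\<lambda>i j. ?N i j - of_real (real n / 3) * mat_id I i j + (\<Sum>k<n. outer_prod I (u (x k)) i j)) c
      = of_real (\<Sum>i\<in>I. T * r i * (cmod (c i))\<^sup>2) - of_real (real n / 3) * of_real (sq_norm_on I c)
        + (\<Sum>k<n. of_real ((cmod (\<Sum>i\<in>I. cnj (u (x k) i) * c i))\<^sup>2))"
      by (simp only: qform_add qform_diff qform_scale qform_sum qform_id[OF fin] qform_diag[OF fin] qform_outer_prod)
    also have "\<dots> = of_real ((\<Sum>i\<in>I. T * r i * (cmod (c i))\<^sup>2) - real n / 3 * sq_norm_on I c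
        + (\<Sum>k<n. (cmod (\<Sum>i\<in>I. cnj (u (x k) i) * c i))\<^sup>2))"
      by (simp only: of_real_add of_real_diff of_real_mult of_real_sum)
    finally show "real n / 3 * sq_norm_on I c
      \<le> T * (\<Sum>i\<in>I. r i * (cmod (c i))\<^sup>2) + (\<Sum>k<n. (cmod (\<Sum>i\<in>I. cnj (u (x k) i) * c i))\<^sup>2)"
      by (simp add: sum_distrib_left mult.assoc)
  qed
qed

text \<open>The reconstruction is ridge regression: it minimizes
  \<open>T * (\<Sum>i\<in>I. r i * |c i|\<^sup>2) + (\<Sum>k<n. |y k - (\<Sum>i\<in>I. cnj (u (x k) i) * c i)|\<^sup>2)\<close>.\<close>
lemma exists_stable_reconstruction:
  fixes r :: "'i \<Rightarrow> real"
  assumes fin: "finite I" and r: "\<And>i. i \<in> I \<Longrightarrow> r i > 0" and T: "T > 0" "(\<Sum>i\<in>I. 1 / r i) \<le> T"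
    and avg: "\<And>K. \<exists>x\<in>X. Re (mat_trace I K) \<le> Re (qform I K (u x))"
  shows "\<exists>x A. (\<forall>k<n. x k \<in> X) \<and> (\<forall>b y. real n / 3 * sq_norm_on I (\<lambda>i. b i - (\<Sum>k<n. A i k * y k))
    \<le> T * (\<Sum>i\<in>I. r i * (cmod (b i))\<^sup>2) + (\<Sum>k<n. (cmod (y k - (\<Sum>i\<in>I. cnj (u (x k) i) * b i)))\<^sup>2))"
proof -
  obtain x where x: "\<forall>k<n. x k \<in> X" and ineq: "\<And>c. real n / 3 * sq_norm_on I c
    \<le> T * (\<Sum>i\<in>I. r i * (cmod (c i))\<^sup>2) + (\<Sum>k<n. (cmod (\<Sum>i\<in>I. cnj (u (x k) i) * c i))\<^sup>2)"
    using exists_sampling_points[where X = X and u = u and n = n, OF fin r T avg] by blast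
  define S where "S k c = (\<Sum>i\<in>I. cnj (u (x k) i) * c i)" for k c
  define N where "N = (\<lambda>i j. mat_diag I (\<lambda>i. T * r i) i j + (\<Sum>k<n. outer_prod I (u (x k)) i j))"
  have qN: "Re (qform I N c) = T * (\<Sum>i\<in>I. r i * (cmod (c i))\<^sup>2) + (\<Sum>k<n. (cmod (S k c))\<^sup>2)" for c
  proof -
    have "qform I N c = of_real ((\<Sum>i\<in>I. T * r i * (cmod (c i))\<^sup>2) + (\<Sum>k<n. (cmod (S k c))\<^sup>2))"
      unfolding N_def S_def of_real_add of_real_sum[of _ "{..<n}"]
      by (simp only: qform_add qform_sum qform_diag[OF fin] qform_outer_prod)
    then show ?thesis by (simp add: sum_distrib_left mult.assoc)
  qed
  have pd0: "pos_def I (mat_diag I (\<lambda>i. T * r i))" using r T by (auto intro!: pos_def_mat_diag fin)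
  have "pos_def I N"
    unfolding pos_def_def
  proof (intro conjI allI impI)
    show "mat_on I N" using pd0 by (auto simp: N_def mat_on_def pos_def_def outer_prod_def)
    show "mat_adj N = N" using pos_def_hermitian[OF pd0]
      by (auto simp: N_def mat_adj_def fun_eq_iff outer_prod_def intro!: sum.cong)
    fix c :: "'i \<Rightarrow> complex" assume "\<exists>i\<in>I. c i \<noteq> 0"
    then have "0 < Re (qform I (mat_diag I (\<lambda>i. T * r i)) c)" using pos_def_Re_pos[OF pd0] by auto
    then show "0 < Re (qform I N c)"
      by (simp add: qN qform_diag[OF fin] sum_distrib_left mult.assoc add_pos_nonneg sum_nonneg)
  qed
  then obtain M where NM: "mat_mult I N M = mat_id I" using pos_def_inverse[OF fin] by blast
  \<comment> \<open>The solution operator of the normal equations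
    \<open>N c = sum y k u (x k)\<close>, column by column.\<close>
  define A where "A i k = mat_vec I M (u (x k)) i" for i k
  have Nvec: "mat_vec I N c i = of_real (T * r i) * c i + (\<Sum>k<n. S k c * u (x k) i)" if i: "i \<in> I" for c i
  proof -
    have "mat_vec I N c i = mat_vec I (mat_diag I (\<lambda>i. T * r i)) c i + (\<Sum>k<n. mat_vec I (outer_prod I (u (x k))) c i)"
      unfolding N_def mat_vec_def by (simp add: distrib_right sum.distrib sum_distrib_right) (rule sum.swap)
    moreover have "mat_vec I (outer_prod I (u (x k))) c i = S k c * u (x k) i" for k
      using i unfolding mat_vec_def outer_prod_def S_def sum_distrib_right
      by (intro sum.cong) (simp_all add: mult_ac)
    ultimately show ?thesis using mat_vec_diag[OF fin i] by simp
  qed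
  have main: "real n / 3 * sq_norm_on I (\<lambda>i. b i - (\<Sum>k<n. A i k * y k))
    \<le> T * (\<Sum>i\<in>I. r i * (cmod (b i))\<^sup>2) + (\<Sum>k<n. (cmod (y k - S k b))\<^sup>2)" for b y
  proof -
    define c where "c i = (\<Sum>k<n. A i k * y k)" for i
    define g where "g i = b i - c i" for i
    have Nc: "mat_vec I N c i = (\<Sum>k<n. y k * u (x k) i)" if i: "i \<in> I" for i
    proof -
      have "mat_vec I N c i = (\<Sum>k<n. y k * mat_vec I N (\<lambda>j. A j k) i)"
        unfolding c_def mat_vec_def by (simp add: sum_distrib_left mult_ac sum.swap[of _ I])
      moreover have "mat_vec I N (\<lambda>j. A j k) i = u (x k) i" for k
        unfolding A_def mat_vec_mult[symmetric] NM by (rule mat_vec_id[OF fin i])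
      ultimately show ?thesis by simp
    qed
    \<comment> \<open>The error \<open>g\<close> solves the same equations with the penalty term
      \<open>T r b\<close> and the residuals \<open>y k - S k b\<close> as data; testing with
      \<open>g\<close> gives an energy identity.\<close>
    have Ng: "mat_vec I N g i = of_real (T * r i) * b i - (\<Sum>k<n. (y k - S k b) * u (x k) i)" if i: "i \<in> I" for i
    proof -
      have "mat_vec I N g i = mat_vec I N b i - mat_vec I N c i"
        by (simp add: g_def mat_vec_def algebra_simps sum_subtractf)
      also have "\<dots> = of_real (T * r i) * b i - (\<Sum>k<n. (y k - S k b) * u (x k) i)"
        unfolding Nvec[OF i, of b] Nc[OF i] by (simp add: left_diff_distrib sum_subtractf)
      finally show ?thesis .
    qed
    have "qform I N g = (\<Sum>i\<in>I. of_real (T * r i) * (cnj (g i) * b i) - cnj (g i) * (\<Sum>k<n. (y k - S k b) * u (x k) i))"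
      unfolding qform_alt by (intro sum.cong refl) (simp add: Ng algebra_simps)
    also have "\<dots> = (\<Sum>i\<in>I. of_real (T * r i) * (cnj (g i) * b i)) - (\<Sum>k<n. (y k - S k b) * cnj (S k g))"
      unfolding sum_subtractf S_def[of _ g] cnj_sum sum_distrib_left
      by (subst sum.swap[of _ I]) (simp add: mult_ac)
    finally have eq: "qform I N g = (\<Sum>i\<in>I. of_real (T * r i) * (cnj (g i) * b i)) - (\<Sum>k<n. (y k - S k b) * cnj (S k g))" .
    have re: "Re (of_real a * z) = a * Re z" for a z by simp
    have "Re (qform I N g) = (\<Sum>i\<in>I. T * r i * Re (cnj (g i) * b i)) + (\<Sum>k<n. - Re ((y k - S k b) * cnj (S k g)))"
      unfolding eq minus_complex.simps Re_sum re sum_negf by simp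
    \<comment> \<open>Each product is split by the arithmetic-geometric mean inequality. The terms
      in \<open>g\<close> add up to half the energy of \<open>g\<close> and are absorbed on the
      left.\<close>
    also have "\<dots> \<le> (\<Sum>i\<in>I. T * r i * (((cmod (g i))\<^sup>2 + (cmod (b i))\<^sup>2) / 2)) + (\<Sum>k<n. ((cmod (y k - S k b))\<^sup>2 + (cmod (S k g))\<^sup>2) / 2)"
    proof -
      have amgm: "\<bar>Re (v * w)\<bar> \<le> ((cmod v)\<^sup>2 + (cmod w)\<^sup>2) / 2" for v w
      proof -
        have "\<bar>Re (v * w)\<bar> \<le> cmod v * cmod w" using abs_Re_le_cmod[of "v * w"] by (simp add: norm_mult)
        also have "\<dots> \<le> ((cmod v)\<^sup>2 + (cmod w)\<^sup>2) / 2"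
          using sum_squares_bound[of "cmod v" "cmod w"] by simp
        finally show ?thesis .
      qed
      show ?thesis
      proof (intro add_mono sum_mono mult_left_mono)
        fix i assume "i \<in> I"
        show "Re (cnj (g i) * b i) \<le> ((cmod (g i))\<^sup>2 + (cmod (b i))\<^sup>2) / 2"
          using amgm[of "cnj (g i)" "b i"] by (simp del: times_complex.simps)
        show "0 \<le> T * r i" using r[OF \<open>i \<in> I\<close>] T by simp
      next
        fix k
        show "- Re ((y k - S k b) * cnj (S k g)) \<le> ((cmod (y k - S k b))\<^sup>2 + (cmod (S k g))\<^sup>2) / 2"
          using amgm[of "y k - S k b" "cnj (S k g)"] by (simp del: times_complex.simps)
      qed
    qed
    also have "\<dots> = Re (qform I N g) / 2 + (T * (\<Sum>i\<in>I. r i * (cmod (b i))\<^sup>2) + (\<Sum>k<n. (cmod (y k - S k b))\<^sup>2)) / 2"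
      unfolding qN by (simp add: sum.distrib sum_distrib_left sum_divide_distrib[symmetric] algebra_simps add_divide_distrib)
    finally have "Re (qform I N g) \<le> T * (\<Sum>i\<in>I. r i * (cmod (b i))\<^sup>2) + (\<Sum>k<n. (cmod (y k - S k b))\<^sup>2)"
      (is "?q \<le> ?p")
    proof -
      assume "?q \<le> ?q / 2 + ?p / 2"
      then show "?q \<le> ?p" by (simp only: field_simps)
    qed
    moreover have "real n / 3 * sq_norm_on I g \<le> Re (qform I N g)"
      using ineq[of g] by (simp add: qN S_def)
    ultimately show ?thesis by (simp add: g_def[abs_def] c_def)
  qed
  show ?thesis using x main unfolding S_def by blast
qed

section \<open>Rank and trace\<close>

text \<open>Dependent vectors are skipped, so fewer than \<open>n\<close> vectors may result;
  \<open>m <= n\<close> is the rank bound needed for the projection onto the span. The expansions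
  hold on \<open>G\<close> only, which is all that the inner product sees.\<close>

lemma gram_schmidt:
  fixes v :: "nat \<Rightarrow> 'i \<Rightarrow> complex" and G :: "'i set"
  defines "ip \<equiv> \<lambda>a b. \<Sum>g\<in>G. cnj (a g) * b g"
  assumes fin: "finite G"
  shows "\<exists>m\<le>n. \<exists>u. (\<forall>i<m. \<forall>j<m. ip (u i) (u j) = (if i = j then 1 else 0)) \<and>
     (\<forall>k<n. \<forall>g\<in>G. v k g = (\<Sum>i<m. ip (u i) (v k) * u i g))"
proof (induction n)
  case 0
  show ?case by simp
next
  case (Suc n)
  then obtain m u where m: "m \<le> n" and orth: "\<And>i j. i < m \<Longrightarrow> j < m \<Longrightarrow> ip (u i) (u j) = (if i = j then 1 else 0)"
    and span: "\<And>k g. k < n \<Longrightarrow> g \<in> G \<Longrightarrow> v k g = (\<Sum>i<m. ip (u i) (v k) * u i g)" by blast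
  define w where "w g = v n g - (\<Sum>i<m. ip (u i) (v n) * u i g)" for g
  show ?case
  proof (cases "\<forall>g\<in>G. w g = 0")
    case True
    then have "v n g = (\<Sum>i<m. ip (u i) (v n) * u i g)" if "g \<in> G" for g
      using that by (simp add: w_def)
    then show ?thesis using m orth span by (intro exI[of _ m] conjI exI[of _ u]) (auto simp: less_Suc_eq)
  next
    case False
    have ip_lin: "ip a (\<lambda>g. \<Sum>i<m. c i * u i g) = (\<Sum>i<m. c i * ip a (u i))" for a c
      unfolding ip_def sum_distrib_left by (subst sum.swap) (simp add: mult_ac)
    have ip_cong: "ip a b = ip a b'" if "\<And>g. g \<in> G \<Longrightarrow> b g = b' g" for a b b'
      unfolding ip_def using that by (intro sum.cong) auto
    have ip_swap: "ip b a = cnj (ip a b)" for a b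
      by (simp add: ip_def mult.commute)
    have ip_diff: "ip a (\<lambda>g. b g - c g) = ip a b - ip a c" for a b c
      by (simp add: ip_def algebra_simps sum_subtractf)
    have uw: "ip (u i) w = 0" if "i < m" for i
      using that by (simp add: w_def[abs_def] ip_diff ip_lin orth if_distrib[of "\<lambda>x. _ * x"] cong: if_cong)
    define s where "s = (\<Sum>g\<in>G. (cmod (w g))\<^sup>2)"
    have ww: "ip w w = of_real s"
      unfolding ip_def s_def of_real_sum complex_norm_square by (simp add: mult.commute)
    have s: "s > 0" using False unfolding s_def by (auto intro!: sum_pos2[OF fin])
    define e where "e g = w g / of_real (sqrt s)" for g
    have ipe: "ip a e = ip a w / of_real (sqrt s)" for a
      by (simp add: ip_def e_def sum_divide_distrib)
    have sq: "complex_of_real (sqrt s) * of_real (sqrt s) = of_real s"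
      using s by (simp flip: of_real_mult)
    have ew: "ip e w = of_real s / of_real (sqrt s)" by (subst ip_swap) (simp add: ipe ww)
    have ee: "ip e e = 1"
      using s by (simp add: ipe[of e] ew sq)
    have ue: "ip (u i) e = 0" if "i < m" for i using uw[OF that] by (simp add: ipe)
    have eu: "ip e (u i) = 0" if "i < m" for i using ue[OF that] ip_swap[of e "u i"] by simp
    define u' where "u' = u(m := e)"
    have orth': "ip (u' i) (u' j) = (if i = j then 1 else 0)" if "i < Suc m" "j < Suc m" for i j
      using that orth ee ue eu by (auto simp: u'_def less_Suc_eq)
    have exp: "(\<Sum>i<Suc m. ip (u' i) a * u' i g) = (\<Sum>i<m. ip (u i) a * u i g) + ip e a * e g" for a g
      by (simp add: u'_def)
    have sp: "v k g = (\<Sum>i<Suc m. ip (u' i) (v k) * u' i g)" if k: "k < Suc n" and g: "g \<in> G" for k g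
    proof (cases "k = n")
      case True
      have vn: "v n g = (\<Sum>i<m. ip (u i) (v n) * u i g) + w g" for g by (simp add: w_def)
      have "ip e (v n) = ip e (\<lambda>g. \<Sum>i<m. ip (u i) (v n) * u i g) + ip e w"
        by (subst ip_cong[of _ "\<lambda>g. (\<Sum>i<m. ip (u i) (v n) * u i g) + w g"])
           (simp_all add: w_def ip_def algebra_simps sum.distrib sum_subtractf)
      also have "\<dots> = ip e w" by (simp add: ip_lin eu)
      also note ew
      finally have "ip e (v n) * e g = (of_real s / (of_real (sqrt s) * of_real (sqrt s))) * w g" by (simp add: e_def)
      also have "\<dots> = w g" using sq s by simp
      finally show ?thesis using True by (simp only: exp) (simp add: vn[of g])
    next
      case False
      with k have k: "k < n" by simp
      have "ip e (v k) = ip e (\<lambda>g. \<Sum>i<m. ip (u i) (v k) * u i g)"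
        by (rule ip_cong) (rule span[OF k])
      also have "\<dots> = 0" by (simp add: ip_lin eu)
      finally show ?thesis using span[OF k g] by (simp only: exp) simp
    qed
    show ?thesis using m orth' sp by (intro exI[of _ "Suc m"] conjI exI[of _ u']) auto
  qed
qed

lemma norm_sum_mult_le:
  fixes a b :: "'i \<Rightarrow> complex"
  shows "(cmod (\<Sum>i\<in>I. a i * b i))\<^sup>2 \<le> (\<Sum>i\<in>I. (cmod (a i))\<^sup>2) * (\<Sum>i\<in>I. (cmod (b i))\<^sup>2)"
proof -
  have "(cmod (\<Sum>i\<in>I. a i * b i))\<^sup>2 \<le> (\<Sum>i\<in>I. cmod (a i) * cmod (b i))\<^sup>2"
    by (intro power_mono order.trans[OF norm_sum]) (simp_all add: norm_mult)
  also have "\<dots> \<le> (\<Sum>i\<in>I. (cmod (a i))\<^sup>2) * (\<Sum>i\<in>I. (cmod (b i))\<^sup>2)"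
    by (rule Cauchy_Schwarz_ineq_sum)
  finally show ?thesis .
qed

text \<open>Rank controls trace: the trace of the combination of the rank-one matrices of the
  \<open>v k\<close> with coefficients \<open>b k\<close> is its inner product with the orthogonal
  projection onto their span. The squared Frobenius norm of that projection is the dimension of the
  span, at most \<open>n\<close>.\<close>

lemma rank_trace_bound:
  fixes v :: "nat \<Rightarrow> 'i \<Rightarrow> complex" and b :: "nat \<Rightarrow> complex"
  assumes fin: "finite G"
  shows "(cmod (\<Sum>k<n. b k * of_real (\<Sum>g\<in>G. (cmod (v k g))\<^sup>2)))\<^sup>2
    \<le> real n * (\<Sum>g\<in>G. \<Sum>h\<in>G. (cmod (\<Sum>k<n. b k * (v k g * cnj (v k h))))\<^sup>2)"
proof -
  define ip where "ip = (\<lambda>a b. \<Sum>g\<in>G. cnj (a g) * b g :: complex)"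
  obtain m u where m: "m \<le> n" and orth: "\<And>i j. i < m \<Longrightarrow> j < m \<Longrightarrow> ip (u i) (u j) = (if i = j then 1 else 0)"
    and span: "\<And>k g. k < n \<Longrightarrow> g \<in> G \<Longrightarrow> v k g = (\<Sum>i<m. ip (u i) (v k) * u i g)"
    using gram_schmidt[OF fin, of n v] unfolding ip_def by blast
  define T where "T g h = (\<Sum>k<n. b k * (v k g * cnj (v k h)))" for g h
  \<comment> \<open>The conjugate of the projection matrix, so that pairing with \<open>T\<close> is
    the plain entrywise sum.\<close>
  define P where "P g h = (\<Sum>i<m. cnj (u i g) * u i h)" for g h
  have nv: "of_real (\<Sum>g\<in>G. (cmod (v k g))\<^sup>2) = (\<Sum>g\<in>G. \<Sum>h\<in>G. v k g * cnj (v k h) * P g h)" if "k < n" for k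
  proof -
    have "of_real (\<Sum>g\<in>G. (cmod (v k g))\<^sup>2) = (\<Sum>g\<in>G. v k g * cnj (v k g))"
      unfolding of_real_sum complex_norm_square ..
    also have "\<dots> = (\<Sum>h\<in>G. (\<Sum>i<m. ip (u i) (v k) * u i h) * cnj (v k h))"
      using span[OF that] by (intro sum.cong refl) metis
    also have "\<dots> = (\<Sum>h\<in>G. \<Sum>i<m. \<Sum>g\<in>G. cnj (u i g) * v k g * u i h * cnj (v k h))"
      by (simp add: ip_def sum_distrib_right)
    also have "\<dots> = (\<Sum>h\<in>G. \<Sum>g\<in>G. \<Sum>i<m. cnj (u i g) * v k g * u i h * cnj (v k h))"
      by (intro sum.cong refl) (rule sum.swap)
    also have "\<dots> = (\<Sum>g\<in>G. \<Sum>h\<in>G. \<Sum>i<m. cnj (u i g) * v k g * u i h * cnj (v k h))"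
      by (rule sum.swap)
    finally show ?thesis by (simp add: P_def sum_distrib_left mult_ac)
  qed
  have "(\<Sum>k<n. b k * of_real (\<Sum>g\<in>G. (cmod (v k g))\<^sup>2)) = (\<Sum>k<n. \<Sum>g\<in>G. \<Sum>h\<in>G. b k * (v k g * cnj (v k h)) * P g h)"
    by (intro sum.cong refl) (simp add: nv sum_distrib_left mult_ac del: of_real_sum)
  also have "\<dots> = (\<Sum>g\<in>G. \<Sum>k<n. \<Sum>h\<in>G. b k * (v k g * cnj (v k h)) * P g h)" by (rule sum.swap)
  also have "\<dots> = (\<Sum>g\<in>G. \<Sum>h\<in>G. T g h * P g h)"
    unfolding T_def sum_distrib_right by (intro sum.cong refl sum.swap)
  finally have eq: "(\<Sum>k<n. b k * of_real (\<Sum>g\<in>G. (cmod (v k g))\<^sup>2)) = (\<Sum>z\<in>G\<times>G. T (fst z) (snd z) * P (fst z) (snd z))"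
    by (simp add: sum.cartesian_product case_prod_unfold)
  have "of_real (\<Sum>g\<in>G. \<Sum>h\<in>G. (cmod (P g h))\<^sup>2) = (\<Sum>g\<in>G. \<Sum>h\<in>G. \<Sum>i<m. \<Sum>j<m. (cnj (u i g) * u j g) * (cnj (u j h) * u i h))"
    unfolding of_real_sum complex_norm_square P_def cnj_sum sum_product
    by (intro sum.cong refl) (simp add: mult_ac)
  also have "\<dots> = (\<Sum>g\<in>G. \<Sum>i<m. \<Sum>h\<in>G. \<Sum>j<m. (cnj (u i g) * u j g) * (cnj (u j h) * u i h))"
    by (intro sum.cong refl sum.swap)
  also have "\<dots> = (\<Sum>i<m. \<Sum>g\<in>G. \<Sum>h\<in>G. \<Sum>j<m. (cnj (u i g) * u j g) * (cnj (u j h) * u i h))"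
    by (rule sum.swap)
  also have "\<dots> = (\<Sum>i<m. \<Sum>g\<in>G. \<Sum>j<m. \<Sum>h\<in>G. (cnj (u i g) * u j g) * (cnj (u j h) * u i h))"
    by (intro sum.cong refl sum.swap)
  also have "\<dots> = (\<Sum>i<m. \<Sum>j<m. \<Sum>g\<in>G. \<Sum>h\<in>G. (cnj (u i g) * u j g) * (cnj (u j h) * u i h))"
    by (intro sum.cong refl sum.swap)
  also have "\<dots> = (\<Sum>i<m. \<Sum>j<m. ip (u i) (u j) * ip (u j) (u i))"
    by (simp add: ip_def sum_product)
  also have "\<dots> = (\<Sum>i<m. \<Sum>j<m. if j = i then 1 else 0)"
    by (intro sum.cong refl) (auto simp: orth)
  also have "\<dots> = of_real (real m)" by simp
  finally have P: "(\<Sum>g\<in>G. \<Sum>h\<in>G. (cmod (P g h))\<^sup>2) = real m" by (simp only: of_real_eq_iff)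
  have "(cmod (\<Sum>k<n. b k * of_real (\<Sum>g\<in>G. (cmod (v k g))\<^sup>2)))\<^sup>2
      \<le> (\<Sum>z\<in>G\<times>G. (cmod (T (fst z) (snd z)))\<^sup>2) * (\<Sum>z\<in>G\<times>G. (cmod (P (fst z) (snd z)))\<^sup>2)"
    unfolding eq by (rule norm_sum_mult_le)
  also have "\<dots> = (\<Sum>g\<in>G. \<Sum>h\<in>G. (cmod (T g h))\<^sup>2) * real m"
    unfolding P[symmetric] by (simp add: sum.cartesian_product case_prod_unfold)
  also have "\<dots> \<le> (\<Sum>g\<in>G. \<Sum>h\<in>G. (cmod (T g h))\<^sup>2) * real n"
    using m by (intro mult_left_mono sum_nonneg) auto
  finally show ?thesis by (simp add: T_def mult.commute)
qed

section \<open>Orthonormal families\<close>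

definition sq_integrable :: "'a measure \<Rightarrow> ('a \<Rightarrow> complex) \<Rightarrow> bool" where
  "sq_integrable M f \<longleftrightarrow> f \<in> borel_measurable M \<and> integrable M (\<lambda>x. (cmod (f x))\<^sup>2)"

lemma sq_integrableD:
  assumes "sq_integrable M f"
  shows "f \<in> borel_measurable M" "integrable M (\<lambda>x. (cmod (f x))\<^sup>2)"
  using assms by (auto simp: sq_integrable_def)

lemma sq_integrable_mult:
  assumes f: "sq_integrable M f" and g: "sq_integrable M g"
  shows "integrable M (\<lambda>x. cnj (f x) * g x)"
proof (rule Bochner_Integration.integrable_bound)
  note sq_integrableD(1)[OF f, measurable] sq_integrableD(1)[OF g, measurable]
  have [measurable]: "cnj \<in> borel_measurable borel"
    by (intro borel_measurable_continuous_onI continuous_intros)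
  show "integrable M (\<lambda>x. (cmod (f x))\<^sup>2 + (cmod (g x))\<^sup>2)"
    by (intro Bochner_Integration.integrable_add sq_integrableD[OF f] sq_integrableD[OF g])
  show "(\<lambda>x. cnj (f x) * g x) \<in> borel_measurable M" by measurable
  show "AE x in M. cmod (cnj (f x) * g x) \<le> norm ((cmod (f x))\<^sup>2 + (cmod (g x))\<^sup>2)"
  proof (intro AE_I2)
    fix x
    have "2 * (cmod (f x) * cmod (g x)) \<le> (cmod (f x))\<^sup>2 + (cmod (g x))\<^sup>2"
      using sum_squares_bound[of "cmod (f x)" "cmod (g x)"] by simp
    moreover have "0 \<le> cmod (f x) * cmod (g x)" by simp
    ultimately have "cmod (f x) * cmod (g x) \<le> (cmod (f x))\<^sup>2 + (cmod (g x))\<^sup>2" by linarith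
    then show "cmod (cnj (f x) * g x) \<le> norm ((cmod (f x))\<^sup>2 + (cmod (g x))\<^sup>2)"
      unfolding norm_mult complex_mod_cnj real_norm_def by (rule order.trans) simp
  qed
qed

lemma sq_integrable_bounded:
  assumes "finite_measure M" "f \<in> borel_measurable M" "\<And>x. x \<in> space M \<Longrightarrow> cmod (f x) \<le> B"
  shows "sq_integrable M f"
proof -
  interpret finite_measure M by fact
  note assms(2)[measurable]
  have "integrable M (\<lambda>x. (cmod (f x))\<^sup>2)"
  proof (rule integrable_const_bound[of _ "B\<^sup>2"])
    show "AE x in M. norm ((cmod (f x))\<^sup>2) \<le> B\<^sup>2"
      using assms(3) by (intro AE_I2) (auto intro!: power_mono)
  qed measurable
  then show ?thesis using assms(2) by (simp add: sq_integrable_def)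
qed

lemma norm_add_power2_le: "(cmod (a + b))\<^sup>2 \<le> 2 * (cmod a)\<^sup>2 + 2 * (cmod b)\<^sup>2"
proof -
  have "(cmod (a + b))\<^sup>2 \<le> (cmod a + cmod b)\<^sup>2"
    by (intro power_mono norm_triangle_ineq) simp
  also have "\<dots> \<le> 2 * (cmod a)\<^sup>2 + 2 * (cmod b)\<^sup>2"
    using sum_squares_bound[of "cmod a" "cmod b"] by (simp add: power2_sum)
  finally show ?thesis .
qed

lemma sq_integrable_add:
  assumes f: "sq_integrable M f" and g: "sq_integrable M g"
  shows "sq_integrable M (\<lambda>x. f x + g x)"
  unfolding sq_integrable_def
proof
  note [measurable] = sq_integrableD(1)[OF f] sq_integrableD(1)[OF g]
  show "(\<lambda>x. f x + g x) \<in> borel_measurable M" by measurable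
  show "integrable M (\<lambda>x. (cmod (f x + g x))\<^sup>2)"
  proof (rule Bochner_Integration.integrable_bound)
    show "integrable M (\<lambda>x. 2 * (cmod (f x))\<^sup>2 + 2 * (cmod (g x))\<^sup>2)"
      using sq_integrableD(2)[OF f] sq_integrableD(2)[OF g] by simp
    show "AE x in M. norm ((cmod (f x + g x))\<^sup>2) \<le> norm (2 * (cmod (f x))\<^sup>2 + 2 * (cmod (g x))\<^sup>2)"
      using norm_add_power2_le by (intro AE_I2) simp
  qed measurable
qed

lemma sq_integrable_cmult:
  "sq_integrable M f \<Longrightarrow> sq_integrable M (\<lambda>x. c * f x)"
  by (auto simp: sq_integrable_def norm_mult power_mult_distrib)

lemma sq_integrable_diff:
  assumes "sq_integrable M f" "sq_integrable M g"
  shows "sq_integrable M (\<lambda>x. f x - g x)"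
  using sq_integrable_add[OF assms(1) sq_integrable_cmult[OF assms(2), of "-1"]] by simp

lemma sq_integrable_zero [simp]: "sq_integrable M (\<lambda>x. 0)"
  by (simp add: sq_integrable_def)

lemma sq_integrable_sum:
  "(\<And>i. i \<in> I \<Longrightarrow> sq_integrable M (f i)) \<Longrightarrow> sq_integrable M (\<lambda>x. \<Sum>i\<in>I. f i x)"
  by (induction I rule: infinite_finite_induct) (simp_all add: sq_integrable_add)

lemma integral_norm_add_le:
  assumes f: "sq_integrable M f" and g: "sq_integrable M g"
  shows "(LINT x|M. (cmod (f x + g x))\<^sup>2) \<le> 2 * (LINT x|M. (cmod (f x))\<^sup>2) + 2 * (LINT x|M. (cmod (g x))\<^sup>2)"
proof -
  have "(LINT x|M. (cmod (f x + g x))\<^sup>2) \<le> (LINT x|M. 2 * (cmod (f x))\<^sup>2 + 2 * (cmod (g x))\<^sup>2)"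
  proof (rule integral_mono)
    show "integrable M (\<lambda>x. (cmod (f x + g x))\<^sup>2)" by (rule sq_integrableD(2)[OF sq_integrable_add[OF f g]])
    show "integrable M (\<lambda>x. 2 * (cmod (f x))\<^sup>2 + 2 * (cmod (g x))\<^sup>2)"
      using sq_integrableD(2)[OF f] sq_integrableD(2)[OF g] by simp
  qed (rule norm_add_power2_le)
  also have "\<dots> = 2 * (LINT x|M. (cmod (f x))\<^sup>2) + 2 * (LINT x|M. (cmod (g x))\<^sup>2)"
    using sq_integrableD(2)[OF f] sq_integrableD(2)[OF g] by (subst Bochner_Integration.integral_add) auto
  finally show ?thesis .
qed

text \<open>As integrals over counting measure, nonnegative series can be exchanged with integrals
  before summability is known. This carries the Parseval identity from the interval to the
  cube.\<close>

lemma has_sum_iff_nn_integral_count_space: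
  fixes f :: "'a \<Rightarrow> real"
  assumes nonneg: "\<And>x. x \<in> A \<Longrightarrow> 0 \<le> f x" and L: "0 \<le> L"
  shows "(f has_sum L) A \<longleftrightarrow> (\<integral>\<^sup>+x. ennreal (f x) \<partial>count_space A) = ennreal L"
proof
  assume hs: "(f has_sum L) A"
  then have "f summable_on A" by (auto simp: summable_on_def)
  then have "(\<lambda>x. norm (f x)) summable_on A"
    using nonneg by (subst summable_on_cong[of _ _ f]) auto
  then have abs: "Infinite_Set_Sum.abs_summable_on f A" using abs_summable_equivalent by blast
  have "nn_integral (count_space A) f = ennreal (infsetsum f A)"
    by (rule nn_integral_conv_infsetsum[OF abs nonneg])
  also have "infsetsum f A = L" using infsetsum_infsum[OF abs] infsumI[OF hs] by simp
  finally show "(\<integral>\<^sup>+x. ennreal (f x) \<partial>count_space A) = ennreal L" .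
next
  assume eq: "(\<integral>\<^sup>+x. ennreal (f x) \<partial>count_space A) = ennreal L"
  have "integrable (count_space A) f"
    by (rule integrableI_nonneg) (auto simp: eq nonneg AE_count_space)
  then have abs: "Infinite_Set_Sum.abs_summable_on f A" by (simp add: Infinite_Set_Sum.abs_summable_on_def)
  then have "(\<lambda>x. norm (f x)) summable_on A" using abs_summable_equivalent by blast
  then have "f summable_on A" using nonneg by (subst summable_on_cong[of _ _ "\<lambda>x. norm (f x)"]) auto
  moreover have "infsum f A = L"
    using infsetsum_infsum[OF abs] infsetsum_conv_nn_integral[of A f] nonneg L by (simp add: eq)
  ultimately show "(f has_sum L) A" using has_sum_infsum by blast
qed

text \<open>Serves the interval and the cube at once. Orthogonality is restricted to
  \<open>K\<close> because frequency functions that differ only beyond the first \<open>d\<close>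
  arguments give the same exponential.\<close>

locale orthonormal_family = finite_measure M for M :: "'a measure" +
  fixes \<phi> :: "'k \<Rightarrow> 'a \<Rightarrow> complex" and K :: "'k set"
  assumes phi_measurable [measurable]: "\<And>k. \<phi> k \<in> borel_measurable M"
    and phi_bounded: "\<And>k x. cmod (\<phi> k x) \<le> 1"
    and phi_orth: "\<And>k l. k \<in> K \<Longrightarrow> l \<in> K \<Longrightarrow> (LINT x|M. cnj (\<phi> k x) * \<phi> l x) = (if k = l then 1 else 0)"
begin

definition coeff :: "('a \<Rightarrow> complex) \<Rightarrow> 'k \<Rightarrow> complex" where
  "coeff f k = (LINT x|M. cnj (\<phi> k x) * f x)"

lemma sq_integrable_phi: "sq_integrable M (\<phi> k)"
  by (rule sq_integrable_bounded[OF finite_measure_axioms phi_measurable phi_bounded])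

lemma sq_integrable_poly: "sq_integrable M (\<lambda>x. \<Sum>k\<in>F. c k * \<phi> k x)"
  by (intro sq_integrable_sum sq_integrable_cmult sq_integrable_phi)

lemma coeff_add: "sq_integrable M f \<Longrightarrow> sq_integrable M g \<Longrightarrow> coeff (\<lambda>x. f x + g x) k = coeff f k + coeff g k"
  by (simp add: coeff_def ring_distribs sq_integrable_mult[OF sq_integrable_phi])

lemma coeff_diff: "sq_integrable M f \<Longrightarrow> sq_integrable M g \<Longrightarrow> coeff (\<lambda>x. f x - g x) k = coeff f k - coeff g k"
  by (simp add: coeff_def ring_distribs sq_integrable_mult[OF sq_integrable_phi])

lemma coeff_cmult: "coeff (\<lambda>x. c * f x) k = c * coeff f k"
  by (simp add: coeff_def mult.left_commute)

lemma coeff_poly: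
  assumes "finite F" "F \<subseteq> K" "k \<in> K"
  shows "coeff (\<lambda>x. \<Sum>l\<in>F. c l * \<phi> l x) k = (if k \<in> F then c k else 0)"
  using assms
proof (induction F rule: finite_induct)
  case empty
  then show ?case by (simp add: coeff_def)
next
  case (insert l F)
  have "coeff (\<lambda>x. \<Sum>l\<in>insert l F. c l * \<phi> l x) k = coeff (\<lambda>x. c l * \<phi> l x) k + coeff (\<lambda>x. \<Sum>l\<in>F. c l * \<phi> l x) k"
    using insert by (subst coeff_add[symmetric]) (simp_all add: sq_integrable_poly sq_integrable_cmult sq_integrable_phi)
  also have "coeff (\<lambda>x. c l * \<phi> l x) k = (if k = l then c l else 0)"
    using insert.prems by (simp add: coeff_cmult) (simp add: coeff_def phi_orth)
  finally show ?case using insert by auto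
qed

text \<open>Pythagoras for arbitrary coefficients, one basis function at a time. Bessel's
  inequality, the truncation error and the cost of wrong coefficients in a reconstruction are all
  instances.\<close>

lemma dist_to_span:
  assumes f: "sq_integrable M f" and F: "finite F" "F \<subseteq> K"
  shows "(LINT x|M. (cmod (f x - (\<Sum>k\<in>F. c k * \<phi> k x)))\<^sup>2)
    = (LINT x|M. (cmod (f x))\<^sup>2) - (\<Sum>k\<in>F. (cmod (coeff f k))\<^sup>2) + (\<Sum>k\<in>F. (cmod (c k - coeff f k))\<^sup>2)"
  using F
proof (induction F rule: finite_induct)
  case empty
  then show ?case by simp
next
  case (insert l F)
  define g where "g x = f x - (\<Sum>k\<in>F. c k * \<phi> k x)" for x
  have g: "sq_integrable M g" unfolding g_def by (intro sq_integrable_diff f sq_integrable_poly)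
  have cg: "coeff g l = coeff f l"
    unfolding g_def using insert by (subst coeff_diff[OF f sq_integrable_poly]) (auto simp: coeff_poly)
  let ?a = "c l"
  have expand: "(cmod (g x - ?a * \<phi> l x))\<^sup>2 = (cmod (g x))\<^sup>2 - 2 * Re (cnj ?a * (cnj (\<phi> l x) * g x)) + (cmod ?a)\<^sup>2 * Re (cnj (\<phi> l x) * \<phi> l x)" for x
    unfolding cmod_power2 by (simp add: algebra_simps power2_eq_square)
  have i1: "integrable M (\<lambda>x. cnj (\<phi> l x) * g x)" by (rule sq_integrable_mult[OF sq_integrable_phi g])
  have i2: "integrable M (\<lambda>x. cnj (\<phi> l x) * \<phi> l x)" by (rule sq_integrable_mult[OF sq_integrable_phi sq_integrable_phi])
  have "(LINT x|M. (cmod (g x - ?a * \<phi> l x))\<^sup>2)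
      = (LINT x|M. (cmod (g x))\<^sup>2) - (LINT x|M. 2 * Re (cnj ?a * (cnj (\<phi> l x) * g x))) + (LINT x|M. (cmod ?a)\<^sup>2 * Re (cnj (\<phi> l x) * \<phi> l x))"
    unfolding expand
    by (subst Bochner_Integration.integral_add, intro Bochner_Integration.integrable_diff sq_integrableD(2)[OF g] integrable_mult_right integrable_Re i1,
        intro integrable_mult_right integrable_Re i2,
        subst Bochner_Integration.integral_diff, intro sq_integrableD(2)[OF g], intro integrable_mult_right integrable_Re i1, rule refl)
  also have "(LINT x|M. 2 * Re (cnj ?a * (cnj (\<phi> l x) * g x))) = 2 * Re (cnj ?a * coeff g l)"
  proof -
    have "(LINT x|M. Re (cnj ?a * (cnj (\<phi> l x) * g x))) = Re (LINT x|M. cnj ?a * (cnj (\<phi> l x) * g x))"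
      by (rule integral_Re) (intro integrable_mult_right i1)
    also have "(LINT x|M. cnj ?a * (cnj (\<phi> l x) * g x)) = cnj ?a * coeff g l"
      by (simp add: coeff_def del: times_complex.simps)
    finally show ?thesis by (simp del: times_complex.simps)
  qed
  also have "(LINT x|M. (cmod ?a)\<^sup>2 * Re (cnj (\<phi> l x) * \<phi> l x)) = (cmod ?a)\<^sup>2"
    using insert.prems integral_Re[OF i2] phi_orth[of l l] by (simp del: times_complex.simps)
  also have "(LINT x|M. (cmod (g x))\<^sup>2) - 2 * Re (cnj ?a * coeff g l) + (cmod ?a)\<^sup>2
      = (LINT x|M. (cmod (g x))\<^sup>2) - (cmod (coeff f l))\<^sup>2 + (cmod (?a - coeff f l))\<^sup>2"
    unfolding cg cmod_power2 by (simp add: algebra_simps power2_eq_square)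
  also have "(LINT x|M. (cmod (g x))\<^sup>2) = (LINT x|M. (cmod (f x))\<^sup>2) - (\<Sum>k\<in>F. (cmod (coeff f k))\<^sup>2) + (\<Sum>k\<in>F. (cmod (c k - coeff f k))\<^sup>2)"
    using insert by (simp add: g_def)
  finally have "(LINT x|M. (cmod (g x - ?a * \<phi> l x))\<^sup>2) = (LINT x|M. (cmod (f x))\<^sup>2)
     - (\<Sum>k\<in>insert l F. (cmod (coeff f k))\<^sup>2) + (\<Sum>k\<in>insert l F. (cmod (c k - coeff f k))\<^sup>2)"
    using insert by simp
  moreover have "g x - ?a * \<phi> l x = f x - (\<Sum>k\<in>insert l F. c k * \<phi> k x)" for x
    using insert by (simp add: g_def)
  ultimately show ?case by simp
qed

lemma bessel:
  assumes "sq_integrable M f" "finite F" "F \<subseteq> K"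
  shows "(\<Sum>k\<in>F. (cmod (coeff f k))\<^sup>2) \<le> (LINT x|M. (cmod (f x))\<^sup>2)"
proof -
  have "0 \<le> (LINT x|M. (cmod (f x - (\<Sum>k\<in>F. coeff f k * \<phi> k x)))\<^sup>2)" by simp
  then show ?thesis by (simp add: dist_to_span[OF assms])
qed

text \<open>The Fourier partial sum over \<open>F\<close> is at least as close to \<open>f\<close>
  as any other combination over \<open>F\<close>, so approximability makes the gap in Bessel's
  inequality arbitrarily small.\<close>

lemma parseval_of_approximable:
  assumes f: "sq_integrable M f"
    and dense: "\<And>e. e > 0 \<Longrightarrow> \<exists>F c. finite F \<and> F \<subseteq> K \<and> (LINT x|M. (cmod (f x - (\<Sum>k\<in>F. c k * \<phi> k x)))\<^sup>2) < e"
  shows "((\<lambda>k. (cmod (coeff f k))\<^sup>2) has_sum (LINT x|M. (cmod (f x))\<^sup>2)) K"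
  unfolding has_sum_def
proof (rule tendstoI)
  fix e :: real assume "e > 0"
  then obtain F c where F: "finite F" "F \<subseteq> K" and lt: "(LINT x|M. (cmod (f x - (\<Sum>k\<in>F. c k * \<phi> k x)))\<^sup>2) < e"
    using dense by blast
  have "(\<Sum>k\<in>F. (cmod (c k - coeff f k))\<^sup>2) \<ge> 0" by (simp add: sum_nonneg)
  with lt have *: "(LINT x|M. (cmod (f x))\<^sup>2) - e < (\<Sum>k\<in>F. (cmod (coeff f k))\<^sup>2)"
    by (simp add: dist_to_span[OF f F])
  show "\<forall>\<^sub>F G in finite_subsets_at_top K. dist (\<Sum>k\<in>G. (cmod (coeff f k))\<^sup>2) (LINT x|M. (cmod (f x))\<^sup>2) < e"
    unfolding eventually_finite_subsets_at_top
  proof (intro exI[of _ F] conjI F allI impI)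
    fix G assume G: "finite G \<and> F \<subseteq> G \<and> G \<subseteq> K"
    then have "(\<Sum>k\<in>F. (cmod (coeff f k))\<^sup>2) \<le> (\<Sum>k\<in>G. (cmod (coeff f k))\<^sup>2)"
      by (intro sum_mono2) auto
    moreover have "(\<Sum>k\<in>G. (cmod (coeff f k))\<^sup>2) \<le> (LINT x|M. (cmod (f x))\<^sup>2)"
      using G by (intro bessel f) auto
    ultimately show "dist (\<Sum>k\<in>G. (cmod (coeff f k))\<^sup>2) (LINT x|M. (cmod (f x))\<^sup>2) < e"
      using * by (simp add: dist_real_def)
  qed
qed

end

section \<open>Fourier series on the unit interval\<close>

definition expi :: "int \<Rightarrow> real \<Rightarrow> complex" where
  "expi k t = cis (2 * pi * (of_int k * t))"

lemma expi_mult: "expi k t * expi l t = expi (k + l) t"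
  by (simp add: expi_def cis_mult algebra_simps)

lemma cnj_expi: "cnj (expi k t) = expi (- k) t"
  by (simp add: expi_def cis_cnj)

lemma expi_0 [simp]: "expi 0 t = 1"
  by (simp add: expi_def)

lemma norm_expi [simp]: "cmod (expi k t) = 1"
  by (simp add: expi_def)

lemma continuous_on_expi: "continuous_on S (expi k)"
  unfolding expi_def cis_conv_exp by (intro continuous_intros)

lemma finite_measure_unit_interval: "finite_measure (lebesgue_on {0..1::real})"
  by (rule finite_measure_lebesgue_on) simp

lemma integral_expi: "(LINT t|lebesgue_on {0..1}. expi m t) = (if m = 0 then 1 else 0)"
proof (cases "m = 0")
  case True
  then show ?thesis by (simp add: measure_restrict_space)
next
  case False
  define w where "w = 2 * of_real pi * \<i> * of_int m"
  have w: "w \<noteq> 0" using False by (simp add: w_def)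
  have e: "expi m t = exp (w * of_real t)" for t
    by (simp add: expi_def cis_conv_exp w_def mult_ac)
  have "((\<lambda>t. exp (w * of_real t) / w) has_vector_derivative exp (w * of_real t)) (at t within {0..1})" for t
    by (rule has_vector_derivative_real_field) (use w in \<open>auto intro!: derivative_eq_intros\<close>)
  then have "((\<lambda>t. exp (w * of_real t)) has_integral (exp (w * of_real 1) / w - exp (w * of_real 0) / w)) {0..1}"
    by (intro fundamental_theorem_of_calculus) auto
  moreover have "exp (w * of_real 1) = 1"
    using exp_integer_2pi[of "of_int m"] by (simp add: w_def mult_ac)
  ultimately have "integral {0..1} (expi m) = 0"
    by (simp add: e[abs_def] integral_unique)
  moreover have "integrable (lebesgue_on {0..1}) (expi m)"
    using finite_measure.integrable_const_bound[OF finite_measure_unit_interval, of "expi m" 1]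
      continuous_imp_measurable_on_sets_lebesgue[OF continuous_on_expi] by auto
  ultimately show ?thesis using False by (subst lebesgue_integral_eq_integral) simp_all
qed

interpretation unit_interval: orthonormal_family "lebesgue_on {0..1}" expi UNIV
proof (intro orthonormal_family.intro finite_measure_unit_interval orthonormal_family_axioms.intro)
  show "expi k \<in> borel_measurable (lebesgue_on {0..1})" for k
    by (rule continuous_imp_measurable_on_sets_lebesgue[OF continuous_on_expi]) simp
  show "(LINT t|lebesgue_on {0..1}. cnj (expi k t) * expi l t) = (if k = l then 1 else 0)" for k l
    by (simp add: cnj_expi expi_mult integral_expi)
qed simp

definition trig_poly :: "(real \<Rightarrow> complex) \<Rightarrow> bool" where
  "trig_poly h \<longleftrightarrow> (\<exists>F c. finite F \<and> (\<forall>t. h t = (\<Sum>k\<in>F. c k * expi k t)))"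

lemma trig_poly_expi: "trig_poly (\<lambda>t. c * expi k t)"
  unfolding trig_poly_def by (intro exI[of _ "{k}"] exI[of _ "\<lambda>_. c"]) simp

lemma trig_poly_add:
  assumes "trig_poly f" "trig_poly g"
  shows "trig_poly (\<lambda>t. f t + g t)"
proof -
  obtain F c where F: "finite F" "\<And>t. f t = (\<Sum>k\<in>F. c k * expi k t)" using assms(1) by (auto simp: trig_poly_def)
  obtain G d where G: "finite G" "\<And>t. g t = (\<Sum>k\<in>G. d k * expi k t)" using assms(2) by (auto simp: trig_poly_def)
  have "f t + g t = (\<Sum>k\<in>F\<union>G. ((if k \<in> F then c k else 0) + (if k \<in> G then d k else 0)) * expi k t)" for t
  proof -
    have "f t = (\<Sum>k\<in>F\<union>G. (if k \<in> F then c k else 0) * expi k t)"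
      unfolding F by (rule sum.mono_neutral_cong_left) (use F G in auto)
    moreover have "g t = (\<Sum>k\<in>F\<union>G. (if k \<in> G then d k else 0) * expi k t)"
      unfolding G by (rule sum.mono_neutral_cong_left) (use F G in auto)
    ultimately show ?thesis by (simp add: sum.distrib distrib_right)
  qed
  then show ?thesis unfolding trig_poly_def using F(1) G(1)
    by (intro exI[of _ "F \<union> G"] exI[of _ "\<lambda>k. (if k \<in> F then c k else 0) + (if k \<in> G then d k else 0)"]) auto
qed

lemma trig_poly_sum: "(\<And>i. i \<in> I \<Longrightarrow> trig_poly (f i)) \<Longrightarrow> trig_poly (\<lambda>t. \<Sum>i\<in>I. f i t)"
  using trig_poly_expi[of 0 0] by (induction I rule: infinite_finite_induct) (simp_all add: trig_poly_add)

lemma trig_poly_mult: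
  assumes "trig_poly f" "trig_poly g"
  shows "trig_poly (\<lambda>t. f t * g t)"
proof -
  obtain F c where F: "finite F" "\<And>t. f t = (\<Sum>k\<in>F. c k * expi k t)" using assms(1) by (auto simp: trig_poly_def)
  obtain G d where G: "finite G" "\<And>t. g t = (\<Sum>k\<in>G. d k * expi k t)" using assms(2) by (auto simp: trig_poly_def)
  have "f t * g t = (\<Sum>k\<in>F. \<Sum>l\<in>G. (c k * d l) * expi (k + l) t)" for t
    unfolding F G sum_product expi_mult[symmetric] by (intro sum.cong refl) (simp add: mult_ac)
  then show ?thesis by (simp add: trig_poly_sum trig_poly_expi)
qed

lemma trig_poly_cmult: "trig_poly f \<Longrightarrow> trig_poly (\<lambda>t. c * f t)"
  using trig_poly_mult[OF trig_poly_expi[of c 0]] by simp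

text \<open>Connects Stone-Weierstrass on the unit circle with trigonometric polynomials. The
  generators are the real-linear functionals of \<open>cis\<close>, which are combinations of a
  cosine and a sine.\<close>

lemma trig_poly_polynomial_function:
  assumes "real_polynomial_function p"
  shows "trig_poly (\<lambda>t. of_real (p (cis (2 * pi * t))))"
  using assms
proof (induction p rule: real_polynomial_function.induct)
  case (linear f)
  interpret bounded_linear f by fact
  have eq: "complex_of_real (f (cis (2 * pi * t)))
      = ((f 1 - \<i> * f \<i>) / 2) * expi 1 t + ((f 1 + \<i> * f \<i>) / 2) * expi (-1) t" for t
  proof -
    have "cis (2 * pi * t) = cos (2 * pi * t) *\<^sub>R 1 + sin (2 * pi * t) *\<^sub>R \<i>"
      by (simp add: complex_eq_iff)
    then have "f (cis (2 * pi * t)) = cos (2 * pi * t) * f 1 + sin (2 * pi * t) * f \<i>"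
      by (simp only: add scaleR) simp
    then show ?thesis by (simp add: complex_eq_iff expi_def field_simps)
  qed
  show ?case unfolding eq by (intro trig_poly_add trig_poly_expi)
next
  case (const c)
  show ?case using trig_poly_expi[of "of_real c" 0] by simp
qed (simp_all add: trig_poly_add trig_poly_mult)

lemma sq_integrable_trig_poly: "trig_poly h \<Longrightarrow> sq_integrable (lebesgue_on {0..1}) h"
proof -
  assume "trig_poly h"
  then obtain F c where "\<And>t. h t = (\<Sum>k\<in>F. c k * expi k t)" by (auto simp: trig_poly_def)
  then have "h = (\<lambda>t. \<Sum>k\<in>F. c k * expi k t)" by (rule ext)
  then show ?thesis by (simp only: unit_interval.sq_integrable_poly)
qed

definition trig_approximable :: "(real \<Rightarrow> complex) \<Rightarrow> bool" where
  "trig_approximable f \<longleftrightarrow> sq_integrable (lebesgue_on {0..1}) f \<and>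
     (\<forall>e>0. \<exists>h. trig_poly h \<and> (LINT t|lebesgue_on {0..1}. (cmod (f t - h t))\<^sup>2) < e)"

lemma trig_approximable_limit:
  assumes f: "sq_integrable (lebesgue_on {0..1}) f"
    and lim: "\<And>e. e > 0 \<Longrightarrow> \<exists>g. trig_approximable g \<and> (LINT t|lebesgue_on {0..1}. (cmod (f t - g t))\<^sup>2) < e"
  shows "trig_approximable f"
  unfolding trig_approximable_def
proof (intro conjI f allI impI)
  fix e :: real assume "e > 0"
  \<comment> \<open>Quarters, because \<open>integral_norm_add_le\<close> costs a factor 2 on each
    of the two errors.\<close>
  then have e: "e / 4 > 0" by simp
  obtain g where g: "trig_approximable g" "(LINT t|lebesgue_on {0..1}. (cmod (f t - g t))\<^sup>2) < e / 4"
    using lim[OF e] by blast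
  obtain h where h: "trig_poly h" "(LINT t|lebesgue_on {0..1}. (cmod (g t - h t))\<^sup>2) < e / 4"
    using g(1) e unfolding trig_approximable_def by blast
  have gi: "sq_integrable (lebesgue_on {0..1}) g" using g(1) by (simp add: trig_approximable_def)
  have "(LINT t|lebesgue_on {0..1}. (cmod ((f t - g t) + (g t - h t)))\<^sup>2) < e"
    using integral_norm_add_le[OF sq_integrable_diff[OF f gi] sq_integrable_diff[OF gi sq_integrable_trig_poly[OF h(1)]]] g(2) h(2)
    by linarith
  then show "\<exists>h. trig_poly h \<and> (LINT t|lebesgue_on {0..1}. (cmod (f t - h t))\<^sup>2) < e"
    using h(1) by auto
qed

lemma trig_approximable_add:
  assumes f: "trig_approximable f" and g: "trig_approximable g"
  shows "trig_approximable (\<lambda>t. f t + g t)"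
  unfolding trig_approximable_def
proof (intro conjI allI impI)
  have fi: "sq_integrable (lebesgue_on {0..1}) f" and gi: "sq_integrable (lebesgue_on {0..1}) g"
    using f g by (auto simp: trig_approximable_def)
  then show "sq_integrable (lebesgue_on {0..1}) (\<lambda>t. f t + g t)" by (rule sq_integrable_add)
  fix e :: real assume "e > 0"
  then have e: "e / 4 > 0" by simp
  obtain p where p: "trig_poly p" "(LINT t|lebesgue_on {0..1}. (cmod (f t - p t))\<^sup>2) < e / 4"
    using f e unfolding trig_approximable_def by blast
  obtain q where q: "trig_poly q" "(LINT t|lebesgue_on {0..1}. (cmod (g t - q t))\<^sup>2) < e / 4"
    using g e unfolding trig_approximable_def by blast
  have "(LINT t|lebesgue_on {0..1}. (cmod ((f t - p t) + (g t - q t)))\<^sup>2) < e"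
    using integral_norm_add_le[OF sq_integrable_diff[OF fi sq_integrable_trig_poly[OF p(1)]]
        sq_integrable_diff[OF gi sq_integrable_trig_poly[OF q(1)]]] p(2) q(2)
    by linarith
  then show "\<exists>h. trig_poly h \<and> (LINT t|lebesgue_on {0..1}. (cmod (f t + g t - h t))\<^sup>2) < e"
    using trig_poly_add[OF p(1) q(1)] by (intro exI[of _ "\<lambda>t. p t + q t"]) (simp add: algebra_simps)
qed

lemma trig_approximable_cmult:
  assumes f: "trig_approximable f"
  shows "trig_approximable (\<lambda>t. c * f t)"
  unfolding trig_approximable_def
proof (intro conjI allI impI)
  show "sq_integrable (lebesgue_on {0..1}) (\<lambda>t. c * f t)"
    using f by (auto simp: trig_approximable_def intro: sq_integrable_cmult)
  fix e :: real assume "e > 0"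
  then have "e / ((cmod c)\<^sup>2 + 1) > 0" by (simp add: add_nonneg_pos)
  then obtain p where p: "trig_poly p" "(LINT t|lebesgue_on {0..1}. (cmod (f t - p t))\<^sup>2) < e / ((cmod c)\<^sup>2 + 1)" (is "?I < _")
    using f unfolding trig_approximable_def by blast
  have "(LINT t|lebesgue_on {0..1}. (cmod (c * f t - c * p t))\<^sup>2) = (cmod c)\<^sup>2 * ?I"
    by (simp add: right_diff_distrib[symmetric] norm_mult power_mult_distrib)
  also have "\<dots> \<le> ((cmod c)\<^sup>2 + 1) * ?I" by (intro mult_right_mono) auto
  also have "\<dots> < e" using p(2) by (simp add: add_nonneg_pos pos_less_divide_eq mult.commute)
  finally show "\<exists>h. trig_poly h \<and> (LINT t|lebesgue_on {0..1}. (cmod (c * f t - h t))\<^sup>2) < e"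
    using trig_poly_cmult[OF p(1)] by blast
qed

lemma trig_approximable_zero: "trig_approximable (\<lambda>t. 0)"
  unfolding trig_approximable_def using trig_poly_expi[of 0 0]
  by (auto intro!: exI[of _ "\<lambda>t. 0"])

lemma trig_approximable_sum:
  "(\<And>i. i \<in> I \<Longrightarrow> trig_approximable (f i)) \<Longrightarrow> trig_approximable (\<lambda>t. \<Sum>i\<in>I. f i t)"
  by (induction I rule: infinite_finite_induct) (simp_all add: trig_approximable_add trig_approximable_zero)

lemma trig_approximable_circle_function:
  assumes "continuous_on UNIV (g :: complex \<Rightarrow> real)"
  shows "trig_approximable (\<lambda>t. of_real (g (cis (2 * pi * t))))"
  unfolding trig_approximable_def
proof (intro conjI allI impI)
  let ?G = "\<lambda>t. complex_of_real (g (cis (2 * pi * t)))"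
  have cont: "continuous_on {0..1} ?G"
    unfolding cis_conv_exp
    by (intro continuous_on_of_real continuous_on_compose2[OF assms] continuous_intros) auto
  then have "compact (?G ` {0..1})" by (rule compact_continuous_image) simp
  then obtain B where "\<And>t. t \<in> {0..1} \<Longrightarrow> cmod (?G t) \<le> B"
    using compact_imp_bounded[THEN bounded_iff[THEN iffD1]] by (metis imageI)
  then show Gi: "sq_integrable (lebesgue_on {0..1}) ?G"
    by (intro sq_integrable_bounded[of _ _ B] finite_measure_unit_interval
        continuous_imp_measurable_on_sets_lebesgue cont) auto
  fix e :: real assume "e > 0"
  then have e: "sqrt (e / 2) > 0" by simp
  obtain p where p: "real_polynomial_function p" and
    pg: "\<And>z. z \<in> sphere 0 1 \<Longrightarrow> \<bar>g z - p z\<bar> < sqrt (e / 2)"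
    using Stone_Weierstrass_real_polynomial_function[of "sphere 0 1" g, OF _ continuous_on_subset[OF assms] e] by auto
  let ?P = "\<lambda>t. complex_of_real (p (cis (2 * pi * t)))"
  have tp: "trig_poly ?P" by (rule trig_poly_polynomial_function[OF p])
  have "(LINT t|lebesgue_on {0..1}. (cmod (?G t - ?P t))\<^sup>2) \<le> (LINT t|lebesgue_on {0..1::real}. e / 2)"
  proof (rule integral_mono)
    show "integrable (lebesgue_on {0..1}) (\<lambda>t. (cmod (?G t - ?P t))\<^sup>2)"
      by (rule sq_integrableD(2)[OF sq_integrable_diff[OF Gi sq_integrable_trig_poly[OF tp]]])
    show "integrable (lebesgue_on {0..1::real}) (\<lambda>t. e / 2)"
      by (rule finite_measure.integrable_const[OF finite_measure_unit_interval])
    fix t :: real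
    have "cmod (?G t - ?P t) = \<bar>g (cis (2 * pi * t)) - p (cis (2 * pi * t))\<bar>"
      by (simp only: of_real_diff[symmetric] norm_of_real)
    also have "\<dots> \<le> sqrt (e / 2)" by (rule less_imp_le[OF pg]) simp
    finally have "(cmod (?G t - ?P t))\<^sup>2 \<le> (sqrt (e / 2))\<^sup>2" by (intro power_mono) auto
    then show "(cmod (?G t - ?P t))\<^sup>2 \<le> e / 2" using \<open>e > 0\<close> by simp
  qed
  also have "\<dots> = e / 2" by (simp add: measure_restrict_space)
  also have "\<dots> < e" using \<open>e > 0\<close> by simp
  finally show "\<exists>h. trig_poly h \<and> (LINT t|lebesgue_on {0..1}. (cmod (?G t - h t))\<^sup>2) < e"
    using tp by blast
qed

text \<open>On the circle the endpoints 0 and 1 coincide. Keeping \<open>T\<close> inside the open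
  interval lets its image \<open>C\<close> determine \<open>T\<close>, so the indicator is a
  pointwise limit of continuous functions of \<open>cis\<close>.\<close>

lemma trig_approximable_indicator_compact:
  assumes T: "compact T" "T \<subseteq> {0<..<1::real}"
  shows "trig_approximable (indicator T)"
proof (cases "T = {}")
  case True
  then show ?thesis using trig_approximable_zero by (simp add: indicator_def[abs_def])
next
  case False
  define C where "C = (\<lambda>t. cis (2 * pi * t)) ` T"
  have "compact C" unfolding C_def cis_conv_exp
    by (intro compact_continuous_image T continuous_intros)
  then have C: "closed C" "C \<noteq> {}" using False by (auto simp: compact_imp_closed C_def)
  have mem: "cis (2 * pi * t) \<in> C \<longleftrightarrow> t \<in> T" if t: "t \<in> {0..1}" for t
  proof
    assume "cis (2 * pi * t) \<in> C"
    then obtain s where s: "s \<in> T" "cis (2 * pi * t) = cis (2 * pi * s)" by (auto simp: C_def)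
    then have "sin (2 * pi * t) = sin (2 * pi * s) \<and> cos (2 * pi * t) = cos (2 * pi * s)"
      by (simp add: complex_eq_iff)
    then obtain n :: int where n: "2 * pi * t = 2 * pi * s + 2 * pi * n" 
      using sin_cos_eq_iff by blast
    then have "2 * pi * (t - s - n) = 0" by (simp add: algebra_simps)
    then have "t = s + n" by simp
    then have "n = 0" using s(1) T(2) t by auto
    then show "t \<in> T" using \<open>t = s + n\<close> s by simp
  qed (auto simp: C_def)
  \<comment> \<open>Tents around \<open>C\<close>: equal to 1 on \<open>C\<close>, and eventually 0
    at each point off this closed set.\<close>
  define g where "g n z = max 0 (1 - real n * infdist z C)" for n z
  have contg: "continuous_on UNIV (g n)" for n
    unfolding g_def by (intro continuous_intros)
  have lim: "(\<lambda>n. g n z) \<longlonglongrightarrow> indicator C z" for z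
  proof (cases "z \<in> C")
    case True
    then show ?thesis by (simp add: g_def)
  next
    case zC: False
    then have d: "infdist z C > 0" using C infdist_pos_not_in_closed by blast
    obtain N where N: "real N > 1 / infdist z C" using reals_Archimedean2 by blast
    have "g n z = 0" if "n \<ge> N" for n
    proof -
      have "1 / infdist z C < real n" using N that by (meson less_le_trans of_nat_le_iff)
      then have "1 < real n * infdist z C" using d by (simp add: pos_divide_less_eq)
      then show ?thesis by (simp add: g_def)
    qed
    then have "eventually (\<lambda>n. g n z = 0) sequentially" by (auto simp: eventually_sequentially)
    then show ?thesis using zC by (simp add: tendsto_eventually)
  qed
  have g1: "0 \<le> g n z" "g n z \<le> 1" for n z
    using mult_nonneg_nonneg[OF of_nat_0_le_iff infdist_nonneg, of n z C] by (auto simp: g_def)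
  let ?G = "\<lambda>n t. complex_of_real (g n (cis (2 * pi * t)))"
  have Gi: "sq_integrable (lebesgue_on {0..1}) (?G n)" for n
    using trig_approximable_circle_function[OF contg] by (simp add: trig_approximable_def)
  have [measurable]: "T \<in> sets lebesgue" using T(1) by (simp add: compact_imp_closed borel_closed)
  then have T': "T \<in> sets (lebesgue_on {0..1})" using T(2) by (subst sets_restrict_space_iff) auto
  have Ti: "sq_integrable (lebesgue_on {0..1}) (indicator T)"
    by (rule sq_integrable_bounded[of _ _ 1, OF finite_measure_unit_interval])
       (use T' in \<open>auto simp: indicator_def\<close>)
  have "(\<lambda>n. LINT t|lebesgue_on {0..1}. (cmod (indicator T t - ?G n t))\<^sup>2) \<longlonglongrightarrow> (LINT t|lebesgue_on {0..1::real}. 0)"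
  proof (rule integral_dominated_convergence[where w = "\<lambda>_. 1"])
    show "(\<lambda>t. (cmod (indicator T t - ?G n t))\<^sup>2) \<in> borel_measurable (lebesgue_on {0..1})" for n
      by (rule borel_measurable_integrable[OF sq_integrableD(2)[OF sq_integrable_diff[OF Ti Gi]]])
    show "integrable (lebesgue_on {0..1::real}) (\<lambda>_. 1::real)"
      by (rule finite_measure.integrable_const[OF finite_measure_unit_interval])
    show "AE t in lebesgue_on {0..1}. (\<lambda>n. (cmod (indicator T t - ?G n t))\<^sup>2) \<longlonglongrightarrow> 0"
    proof (intro AE_I2)
      fix t assume t: "t \<in> space (lebesgue_on {0..1::real})"
      then have "indicator C (cis (2 * pi * t)) = (indicator T t :: real)"
        using mem[of t] by (simp add: indicator_def)
      then have "(\<lambda>n. g n (cis (2 * pi * t))) \<longlonglongrightarrow> indicator T t"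
        using lim[of "cis (2 * pi * t)"] by simp
      then have "(\<lambda>n. (indicator T t - g n (cis (2 * pi * t)))\<^sup>2) \<longlonglongrightarrow> (indicator T t - indicator T t)\<^sup>2"
        by (intro tendsto_intros)
      moreover have "(cmod (indicator T t - ?G n t))\<^sup>2 = (indicator T t - g n (cis (2 * pi * t)))\<^sup>2" for n
        by (simp add: indicator_def cmod_power2)
      ultimately show "(\<lambda>n. (cmod (indicator T t - ?G n t))\<^sup>2) \<longlonglongrightarrow> 0" by simp
    qed
    show "AE t in lebesgue_on {0..1}. norm ((cmod (indicator T t - ?G n t))\<^sup>2) \<le> 1" for n
      using g1 by (intro AE_I2) (auto simp: indicator_def cmod_power2 abs_square_le_1 power_le_one)
  qed auto
  then have *: "(\<lambda>n. LINT t|lebesgue_on {0..1}. (cmod (indicator T t - ?G n t))\<^sup>2) \<longlonglongrightarrow> 0" by simp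
  show ?thesis
  proof (rule trig_approximable_limit[OF Ti])
    fix e :: real assume "e > 0"
    from order_tendstoD(2)[OF * this] obtain n
      where "(LINT t|lebesgue_on {0..1}. (cmod (indicator T t - ?G n t))\<^sup>2) < e"
      by (auto simp: eventually_sequentially)
    then show "\<exists>g. trig_approximable g \<and> (LINT t|lebesgue_on {0..1}. (cmod (indicator T t - g t))\<^sup>2) < e"
      using trig_approximable_circle_function[OF contg] by blast
  qed
qed

text \<open>Inner regularity, applied to the part of \<open>S\<close> in the open interval so that
  the compact case fits; the endpoints lost in this way form a null set.\<close>

lemma trig_approximable_indicator:
  assumes S: "S \<in> sets (lebesgue_on {0..1::real})"
  shows "trig_approximable (indicator S)"
proof (rule trig_approximable_limit)
  have S': "S \<in> sets lebesgue" "S \<subseteq> {0..1}" using S by (auto simp: sets_restrict_space_iff)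
  show Si: "sq_integrable (lebesgue_on {0..1}) (indicator S)"
    by (rule sq_integrable_bounded[of _ _ 1, OF finite_measure_unit_interval])
       (use S in \<open>auto simp: indicator_def\<close>)
  fix e :: real assume e: "e > 0"
  have "S \<inter> {0<..<1} \<in> sets lebesgue" using S' by auto
  then obtain T where T: "closed T" "T \<subseteq> S \<inter> {0<..<1}" "(S \<inter> {0<..<1}) - T \<in> lmeasurable"
    "emeasure lebesgue ((S \<inter> {0<..<1}) - T) < ennreal e"
    using sets_lebesgue_inner_closed e by metis
  have "bounded T" by (rule bounded_subset[of "{0..1}"]) (use T(2) in auto)
  then have "compact T" using T(1) by (simp add: compact_eq_bounded_closed)
  then have app: "trig_approximable (indicator T)"
    using T(2) by (intro trig_approximable_indicator_compact) auto
  let ?D = "S \<inter> {0<..<1} - T"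
  have D: "?D \<in> sets (lebesgue_on {0..1})" using T(3) by (subst sets_restrict_space_iff) auto
  have "(LINT t|lebesgue_on {0..1}. (cmod (indicator S t - indicator T t))\<^sup>2) = (LINT t|lebesgue_on {0..1}. indicator ?D t)"
  proof (rule integral_cong_AE)
    have "negligible {0, 1::real}" by simp
    then have null: "{0, 1::real} \<in> null_sets lebesgue" by (simp add: negligible_iff_null_sets)
    have "AE t in lebesgue. t \<notin> {0, 1::real}" by (rule AE_not_in[OF null])
    then have "AE t in lebesgue_on {0..1}. t \<notin> {0, 1::real}" by (subst AE_restrict_space_iff) auto
    then show "AE t in lebesgue_on {0..1}. (cmod (indicator S t - indicator T t))\<^sup>2 = indicator ?D t"
    proof eventually_elim
      case (elim t)
      then show ?case using T(2) S'(2) by (auto simp: indicator_def)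
    qed
    show "(\<lambda>t. (cmod (indicator S t - indicator T t))\<^sup>2) \<in> borel_measurable (lebesgue_on {0..1})"
      using app by (intro borel_measurable_integrable[OF sq_integrableD(2)[OF sq_integrable_diff[OF Si]]])
        (simp add: trig_approximable_def)
    show "indicator ?D \<in> borel_measurable (lebesgue_on {0..1})" using D by simp
  qed
  also have "\<dots> = measure (lebesgue_on {0..1}) (?D \<inter> space (lebesgue_on {0..1}))"
    by (rule Bochner_Integration.integral_indicator)
  also have "?D \<inter> space (lebesgue_on {0..1}) = ?D" by auto
  also have "measure (lebesgue_on {0..1}) ?D = measure lebesgue ?D" by (rule measure_restrict_space) auto
  also have "\<dots> < e" using T(3,4) e by (simp add: emeasure_eq_measure2 ennreal_less_iff)
  finally show "\<exists>g. trig_approximable g \<and> (LINT t|lebesgue_on {0..1}. (cmod (indicator S t - g t))\<^sup>2) < e"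
    using app by blast
qed

lemma trig_approximable_sq_integrable:
  assumes f: "sq_integrable (lebesgue_on {0..1}) f"
  shows "trig_approximable f"
proof (rule trig_approximable_limit[OF f])
  let ?M = "lebesgue_on {0..1::real}"
  obtain s where s: "\<And>i. simple_function ?M (s i)" and sl: "\<And>x. x \<in> space ?M \<Longrightarrow> (\<lambda>i. s i x) \<longlonglongrightarrow> f x"
    and sb: "\<And>i x. x \<in> space ?M \<Longrightarrow> dist (s i x) 0 \<le> 2 * dist (f x) 0"
    using borel_measurable_implies_sequence_metric[OF sq_integrableD(1)[OF f], of 0] by metis
  have approx: "trig_approximable (\<lambda>x. \<Sum>y\<in>s i ` space ?M. y * indicator (s i -` {y} \<inter> space ?M) x)" for i
    using s[of i] by (intro trig_approximable_sum trig_approximable_cmult trig_approximable_indicator) (auto simp: simple_function_def)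
  \<comment> \<open>The expansion into indicators is global and vanishes off the space, so it agrees
    with \<open>s i\<close> on the space only.\<close>
  have rep: "s i x = (\<Sum>y\<in>s i ` space ?M. y * indicator (s i -` {y} \<inter> space ?M) x)" if "x \<in> space ?M" for i x
  proof -
    have "s i x = (\<Sum>y\<in>s i ` space ?M. indicator (s i -` {y} \<inter> space ?M) x *\<^sub>R y)"
      by (rule simple_function_indicator_representation_banach[OF s that])
    also have "\<dots> = (\<Sum>y\<in>s i ` space ?M. y * indicator (s i -` {y} \<inter> space ?M) x)"
      by (intro sum.cong refl) (auto simp: indicator_def)
    finally show ?thesis .
  qed
  let ?s = "\<lambda>i x. \<Sum>y\<in>s i ` space ?M. y * indicator (s i -` {y} \<inter> space ?M) x"
  have si: "sq_integrable ?M (?s i)" for i using approx by (simp add: trig_approximable_def)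
  have "(\<lambda>i. LINT x|?M. (cmod (f x - ?s i x))\<^sup>2) \<longlonglongrightarrow> (LINT x|?M. 0)"
  \<comment> \<open>From \<open>|s i| <= 2 |f|\<close> follows \<open>|f - s i| <= 3 |f|\<close>,
    hence the factor 9.\<close>
  proof (rule integral_dominated_convergence[where w = "\<lambda>x. 9 * (cmod (f x))\<^sup>2"])
    show "(\<lambda>x. (cmod (f x - ?s i x))\<^sup>2) \<in> borel_measurable ?M" for i
      by (rule borel_measurable_integrable[OF sq_integrableD(2)[OF sq_integrable_diff[OF f si]]])
    show "integrable ?M (\<lambda>x. 9 * (cmod (f x))\<^sup>2)" using f by (simp add: sq_integrable_def)
    show "AE x in ?M. (\<lambda>i. (cmod (f x - ?s i x))\<^sup>2) \<longlonglongrightarrow> 0"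
    proof (intro AE_I2)
      fix x assume x: "x \<in> space ?M"
      have "(\<lambda>i. (cmod (f x - s i x))\<^sup>2) \<longlonglongrightarrow> (cmod (f x - f x))\<^sup>2"
        by (intro tendsto_intros sl x)
      then show "(\<lambda>i. (cmod (f x - ?s i x))\<^sup>2) \<longlonglongrightarrow> 0"
        unfolding rep[OF x, symmetric] by simp
    qed
    show "AE x in ?M. norm ((cmod (f x - ?s i x))\<^sup>2) \<le> 9 * (cmod (f x))\<^sup>2" for i
    proof (intro AE_I2)
      fix x assume x: "x \<in> space ?M"
      have "cmod (f x - s i x) \<le> cmod (f x) + cmod (s i x)" by (rule norm_triangle_ineq4)
      also have "\<dots> \<le> 3 * cmod (f x)" using sb[OF x, of i] by simp
      finally have "(cmod (f x - s i x))\<^sup>2 \<le> (3 * cmod (f x))\<^sup>2" by (intro power_mono) auto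
      then show "norm ((cmod (f x - ?s i x))\<^sup>2) \<le> 9 * (cmod (f x))\<^sup>2"
        unfolding rep[OF x, symmetric] by (simp add: power_mult_distrib)
    qed
  qed auto
  then have *: "(\<lambda>i. LINT x|?M. (cmod (f x - ?s i x))\<^sup>2) \<longlonglongrightarrow> 0" by simp
  fix e :: real assume "e > 0"
  from order_tendstoD(2)[OF * this] obtain i where "(LINT x|?M. (cmod (f x - ?s i x))\<^sup>2) < e"
    by (auto simp: eventually_sequentially)
  then show "\<exists>g. trig_approximable g \<and> (LINT x|?M. (cmod (f x - g x))\<^sup>2) < e"
    using approx by blast
qed

lemma parseval_unit_interval:
  assumes f: "sq_integrable (lebesgue_on {0..1}) f"
  shows "((\<lambda>k. (cmod (LINT t|lebesgue_on {0..1}. cnj (expi k t) * f t))\<^sup>2) has_sum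
    (LINT t|lebesgue_on {0..1}. (cmod (f t))\<^sup>2)) UNIV"
proof -
  have "\<exists>F c. finite F \<and> F \<subseteq> UNIV \<and> (LINT t|lebesgue_on {0..1}. (cmod (f t - (\<Sum>k\<in>F. c k * expi k t)))\<^sup>2) < e"
    if e: "e > 0" for e
  proof -
    obtain h where "trig_poly h" "(LINT t|lebesgue_on {0..1}. (cmod (f t - h t))\<^sup>2) < e"
      using trig_approximable_sq_integrable[OF f] e unfolding trig_approximable_def by blast
    moreover then obtain F c where "finite F" "h = (\<lambda>t. \<Sum>k\<in>F. c k * expi k t)"
      unfolding trig_poly_def by blast
    ultimately show ?thesis by blast
  qed
  from unit_interval.parseval_of_approximable[OF f this] show ?thesis
    by (simp add: unit_interval.coeff_def)
qed

section \<open>Parseval identity on the cube\<close>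

definition mexpi :: "nat \<Rightarrow> (nat \<Rightarrow> int) \<Rightarrow> (nat \<Rightarrow> real) \<Rightarrow> complex" where
  "mexpi d h x = (\<Prod>j<d. expi (h j) (x j))"

lemma mexpi_conv_cis: "mexpi d h x = cis (2 * pi * (\<Sum>j<d. real_of_int (h j) * x j))"
  by (induction d) (simp_all add: mexpi_def expi_def cis_mult distrib_left)

lemma fourier_coeff_mexpi: "fourier_coeff d f h = (LINT x|cube_measure d. cnj (mexpi d h x) * f x)"
  by (simp add: fourier_coeff_def mexpi_conv_cis cis_cnj)

lemma norm_mexpi [simp]: "cmod (mexpi d h x) = 1"
  by (simp add: mexpi_conv_cis)

lemma cnj_mexpi_mult: "cnj (mexpi d h x) * mexpi d l x = (\<Prod>j<d. expi (l j - h j) (x j))"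
  by (simp add: mexpi_def prod.distrib[symmetric] cnj_expi expi_mult)

interpretation unit_interval_product: product_sigma_finite "\<lambda>_::nat. lebesgue_on {0..1::real}"
  by (intro product_sigma_finite.intro finite_measure.axioms(1)[OF finite_measure_unit_interval])

lemma space_cube_measure: "space (cube_measure d) = cube d"
  by (simp add: cube_measure_def cube_def space_PiM)

lemma emeasure_cube_measure: "emeasure (cube_measure d) (space (cube_measure d)) = 1"
  unfolding cube_measure_def space_PiM
  by (subst unit_interval_product.emeasure_PiM) (auto simp: emeasure_restrict_space)

lemma finite_measure_cube_measure: "finite_measure (cube_measure d)"
  by (rule finite_measureI) (simp add: emeasure_cube_measure)

lemma measure_cube_measure: "measure (cube_measure d) (space (cube_measure d)) = 1"
  by (simp add: measure_def emeasure_cube_measure)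

lemma mexpi_measurable [measurable]: "mexpi d h \<in> borel_measurable (cube_measure d)"
proof -
  have "(\<lambda>x. expi (h j) (x j)) \<in> borel_measurable (cube_measure d)" if "j < d" for j
  proof -
    have "(\<lambda>x. x j) \<in> measurable (cube_measure d) (lebesgue_on {0..1})"
      unfolding cube_measure_def by (rule measurable_component_singleton) (use that in simp)
    then show ?thesis by (rule measurable_compose) (rule unit_interval.phi_measurable)
  qed
  then have "(\<lambda>x. \<Prod>j<d. expi (h j) (x j)) \<in> borel_measurable (cube_measure d)"
    by (intro borel_measurable_prod) auto
  then show ?thesis by (simp add: mexpi_def[abs_def])
qed

interpretation cube: orthonormal_family "cube_measure d" "mexpi d" "freqs d" for d
proof (intro orthonormal_family.intro finite_measure_cube_measure orthonormal_family_axioms.intro)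
  fix h l assume hl: "h \<in> freqs d" "l \<in> freqs d"
  have "(LINT x|cube_measure d. cnj (mexpi d h x) * mexpi d l x) = (\<Prod>j<d. LINT t|lebesgue_on {0..1}. expi (l j - h j) t)"
    unfolding cnj_mexpi_mult cube_measure_def
    by (rule unit_interval_product.product_integral_prod)
       (auto intro: unit_interval.integrable_const_bound[of _ 1])
  also have "\<dots> = (\<Prod>j<d. if l j = h j then 1 else 0)"
    by (intro prod.cong) (auto simp: integral_expi)
  also have "\<dots> = (if h = l then 1 else 0)"
  proof (cases "h = l")
    case False
    then obtain j where "j < d" "l j \<noteq> h j" using hl by (metis PiE_ext freqs_def lessThan_iff)
    then show ?thesis using False by (auto intro!: prod_zero)
  qed simp
  finally show "(LINT x|cube_measure d. cnj (mexpi d h x) * mexpi d l x) = (if h = l then 1 else 0)" .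
qed simp_all

lemma fourier_coeff_eq_coeff: "fourier_coeff d f h = cube.coeff d f h"
  by (simp add: fourier_coeff_mexpi cube.coeff_def)

lemma countable_freqs: "countable (freqs d)"
  unfolding freqs_def by (intro countable_PiE) auto

lemma bij_betw_freqs_Suc: "bij_betw (\<lambda>(k, h). h(d := k)) (UNIV \<times> freqs d) (freqs (Suc d))"
  unfolding bij_betw_def
proof
  show "inj_on (\<lambda>(k, h). h(d := k)) (UNIV \<times> freqs d)"
  proof (rule inj_onI, clarify)
    fix k k' :: int and h h' assume h: "h \<in> freqs d" "h' \<in> freqs d" and eq: "h(d := k) = h'(d := k')"
    have "k = k'" using fun_cong[OF eq, of d] by simp
    moreover have "h = h'"
    proof (rule PiE_ext[OF h[unfolded freqs_def]])
      fix i assume "i \<in> {..<d}"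
      then show "h i = h' i" using fun_cong[OF eq, of i] by simp
    qed
    ultimately show "k = k' \<and> h = h'" by simp
  qed
  show "(\<lambda>(k, h). h(d := k)) ` (UNIV \<times> freqs d) = freqs (Suc d)"
    unfolding freqs_def lessThan_Suc PiE_insert_eq ..
qed

text \<open>Induction by slicing off the last coordinate: Parseval on the interval for almost every
  slice, Tonelli, and the induction hypothesis for each coefficient function \<open>F k\<close>.
  This bypasses a density argument for trigonometric polynomials in several variables.\<close>

lemma parseval_nn_integral:
  assumes "sq_integrable (cube_measure d) f"
  shows "(\<integral>\<^sup>+h. ennreal ((cmod (cube.coeff d f h))\<^sup>2) \<partial>count_space (freqs d))
    = (\<integral>\<^sup>+x. ennreal ((cmod (f x))\<^sup>2) \<partial>cube_measure d)"
  using assms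
proof (induction d arbitrary: f)
  case 0
  have M: "cube_measure 0 = count_space {\<lambda>_. undefined}"
    by (simp add: cube_measure_def PiM_empty)
  have F: "freqs 0 = {\<lambda>_. undefined}" by (simp add: freqs_def)
  have "cube.coeff 0 f h = f (\<lambda>_. undefined)" for h
  proof -
    have "cube.coeff 0 f h = (LINT x|cube_measure 0. cnj (mexpi 0 h x) * f x)" by (rule cube.coeff_def)
    then show ?thesis unfolding M by (simp add: lebesgue_integral_count_space_finite mexpi_def)
  qed
  then show ?case unfolding M F by (simp add: nn_integral_count_space_finite)
next
  case (Suc d)
  let ?U = "lebesgue_on {0..1::real}"
  have ins: "{..<Suc d} = insert d {..<d}" by (rule lessThan_Suc)
  have fm: "f \<in> borel_measurable (PiM (insert d {..<d}) (\<lambda>_. ?U))"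
    using Suc.prems by (simp add: sq_integrable_def cube_measure_def ins)
  define g where "g x t = f (x(d := t))" for x t
  have gm: "case_prod g \<in> borel_measurable (cube_measure d \<Otimes>\<^sub>M ?U)"
    using measurable_compose[OF measurable_add_dim fm]
    unfolding cube_measure_def g_def by (simp add: case_prod_unfold)
  note [measurable] = gm
  have gmx: "g x \<in> borel_measurable ?U" if "x \<in> space (cube_measure d)" for x
    using measurable_Pair2[OF gm that] by simp
  \<comment> \<open>The \<open>k\<close>-th Fourier coefficient of the slice of \<open>f\<close>
    over \<open>x\<close>.\<close>
  define F where "F k x = (LINT t|?U. cnj (expi k t) * g x t)" for k x
  have [measurable]: "(\<lambda>z. cnj (expi k (snd z)) * g (fst z) (snd z)) \<in> borel_measurable (cube_measure d \<Otimes>\<^sub>M ?U)" for k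
  proof -
    have "expi (- k) \<in> borel_measurable ?U" by (rule unit_interval.phi_measurable)
    then have "(\<lambda>z. expi (- k) (snd z)) \<in> borel_measurable (cube_measure d \<Otimes>\<^sub>M ?U)"
      by (rule measurable_compose[OF measurable_snd])
    then show ?thesis using gm unfolding cnj_expi by (intro borel_measurable_times) (simp_all add: case_prod_unfold)
  qed
  have Fm [measurable]: "F k \<in> borel_measurable (cube_measure d)" for k
    unfolding F_def[abs_def]
    by (rule sigma_finite_measure.borel_measurable_lebesgue_integral[OF finite_measure.axioms(1)[OF finite_measure_unit_interval]])
       (simp add: case_prod_unfold)
  have finI: "(\<integral>\<^sup>+x. ennreal ((cmod (f x))\<^sup>2) \<partial>cube_measure (Suc d)) < \<infinity>"
    using sq_integrableD(2)[OF Suc.prems] by (simp add: nn_integral_eq_integral)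
  have split: "(\<integral>\<^sup>+x. ennreal ((cmod (f x))\<^sup>2) \<partial>cube_measure (Suc d))
      = (\<integral>\<^sup>+x. (\<integral>\<^sup>+t. ennreal ((cmod (g x t))\<^sup>2) \<partial>?U) \<partial>cube_measure d)"
    unfolding cube_measure_def ins g_def
    by (rule unit_interval_product.product_nn_integral_insert) (use fm in simp_all)
  \<comment> \<open>Only almost every slice is square integrable, which is enough under the outer
    integral.\<close>
  have "AE x in cube_measure d. (\<integral>\<^sup>+t. ennreal ((cmod (g x t))\<^sup>2) \<partial>?U) \<noteq> \<infinity>"
  proof (rule nn_integral_PInf_AE)
    show "(\<lambda>x. \<integral>\<^sup>+t. ennreal ((cmod (g x t))\<^sup>2) \<partial>?U) \<in> borel_measurable (cube_measure d)"
      by (rule sigma_finite_measure.borel_measurable_nn_integral[OF finite_measure.axioms(1)[OF finite_measure_unit_interval]])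
         (use gm in \<open>simp add: case_prod_unfold\<close>)
    show "(\<integral>\<^sup>+x. (\<integral>\<^sup>+t. ennreal ((cmod (g x t))\<^sup>2) \<partial>?U) \<partial>cube_measure d) \<noteq> \<infinity>"
      using finI unfolding split by simp
  qed
  then have "AE x in cube_measure d. (\<integral>\<^sup>+t. ennreal ((cmod (g x t))\<^sup>2) \<partial>?U)
      = (\<integral>\<^sup>+k. ennreal ((cmod (F k x))\<^sup>2) \<partial>count_space UNIV)"
    using AE_space
  proof eventually_elim
    case (elim x)
    have "sq_integrable ?U (g x)"
      unfolding sq_integrable_def
    proof
      show gx: "g x \<in> borel_measurable ?U" by (rule gmx[OF elim(2)])
      show "integrable ?U (\<lambda>t. (cmod (g x t))\<^sup>2)"
        using elim(1) gx by (intro integrableI_bounded) (auto simp: less_top)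
    qed
    from parseval_unit_interval[OF this]
    have "(\<integral>\<^sup>+k. ennreal ((cmod (F k x))\<^sup>2) \<partial>count_space UNIV) = ennreal (LINT t|?U. (cmod (g x t))\<^sup>2)"
      by (subst (asm) has_sum_iff_nn_integral_count_space) (simp_all add: F_def)
    also have "\<dots> = (\<integral>\<^sup>+t. ennreal ((cmod (g x t))\<^sup>2) \<partial>?U)"
      using \<open>sq_integrable ?U (g x)\<close> by (subst nn_integral_eq_integral) (auto simp: sq_integrable_def)
    finally show ?case by simp
  qed
  then have "(\<integral>\<^sup>+x. ennreal ((cmod (f x))\<^sup>2) \<partial>cube_measure (Suc d))
      = (\<integral>\<^sup>+x. (\<integral>\<^sup>+k. ennreal ((cmod (F k x))\<^sup>2) \<partial>count_space UNIV) \<partial>cube_measure d)"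
    unfolding split by (rule nn_integral_cong_AE)
  also have "\<dots> = (\<integral>\<^sup>+k. (\<integral>\<^sup>+x. ennreal ((cmod (F k x))\<^sup>2) \<partial>cube_measure d) \<partial>count_space UNIV)"
    by (rule nn_integral_count_space_nn_integral) auto
  finally have eq1: "(\<integral>\<^sup>+x. ennreal ((cmod (f x))\<^sup>2) \<partial>cube_measure (Suc d))
      = (\<integral>\<^sup>+k. (\<integral>\<^sup>+x. ennreal ((cmod (F k x))\<^sup>2) \<partial>cube_measure d) \<partial>count_space UNIV)" .
  have Fsq: "sq_integrable (cube_measure d) (F k)" for k
    unfolding sq_integrable_def
  proof
    show "F k \<in> borel_measurable (cube_measure d)" by (rule Fm)
    have "(\<integral>\<^sup>+x. ennreal ((cmod (F k x))\<^sup>2) \<partial>cube_measure d)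
        \<le> (\<integral>\<^sup>+k. (\<integral>\<^sup>+x. ennreal ((cmod (F k x))\<^sup>2) \<partial>cube_measure d) \<partial>count_space UNIV)"
      by (rule nn_integral_ge_point) simp
    also have "\<dots> < \<infinity>" using finI unfolding eq1 .
    finally show "integrable (cube_measure d) (\<lambda>x. (cmod (F k x))\<^sup>2)"
      by (intro integrableI_bounded) auto
  qed
  have coeffF: "cube.coeff d (F k) h = cube.coeff (Suc d) f (h(d := k))" for k h
  proof -
    have "integrable (cube_measure (Suc d)) (\<lambda>x. cnj (mexpi (Suc d) (h(d := k)) x) * f x)"
      by (rule sq_integrable_mult[OF cube.sq_integrable_phi Suc.prems])
    then have "cube.coeff (Suc d) f (h(d := k)) =
      (LINT x|cube_measure d. LINT t|?U. cnj (mexpi (Suc d) (h(d := k)) (x(d := t))) * g x t)"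
      unfolding cube.coeff_def unfolding cube_measure_def ins g_def
      by (intro unit_interval_product.product_integral_insert) auto
    also have "\<dots> = (LINT x|cube_measure d. LINT t|?U. cnj (mexpi d h x) * (cnj (expi k t) * g x t))"
      by (simp add: mexpi_def mult_ac)
    also have "\<dots> = cube.coeff d (F k) h" by (simp add: cube.coeff_def F_def)
    finally show ?thesis by simp
  qed
  have "(\<integral>\<^sup>+h. ennreal ((cmod (cube.coeff (Suc d) f h))\<^sup>2) \<partial>count_space (freqs (Suc d)))
      = (\<integral>\<^sup>+z. ennreal ((cmod (cube.coeff (Suc d) f ((\<lambda>(k, h). h(d := k)) z)))\<^sup>2) \<partial>count_space (UNIV \<times> freqs d))"
    by (rule nn_integral_bij_count_space[OF bij_betw_freqs_Suc, symmetric])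
  also have "\<dots> = (\<integral>\<^sup>+z. ennreal ((cmod (cube.coeff d (F (fst z)) (snd z)))\<^sup>2) \<partial>(count_space UNIV \<Otimes>\<^sub>M count_space (freqs d)))"
    by (subst pair_measure_countable) (auto simp: countable_freqs coeffF case_prod_unfold)
  also have "\<dots> = (\<integral>\<^sup>+k. \<integral>\<^sup>+h. ennreal ((cmod (cube.coeff d (F k) h))\<^sup>2) \<partial>count_space (freqs d) \<partial>count_space UNIV)"
    by (subst sigma_finite_measure.nn_integral_fst[symmetric])
       (auto simp: sigma_finite_measure_count_space_countable countable_freqs pair_measure_countable)
  also have "\<dots> = (\<integral>\<^sup>+k. (\<integral>\<^sup>+x. ennreal ((cmod (F k x))\<^sup>2) \<partial>cube_measure d) \<partial>count_space UNIV)"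
    by (intro nn_integral_cong Suc.IH Fsq)
  finally show ?case unfolding eq1 .
qed

lemma parseval:
  assumes f: "sq_integrable (cube_measure d) f"
  shows "((\<lambda>h. (cmod (fourier_coeff d f h))\<^sup>2) has_sum (LINT x|cube_measure d. (cmod (f x))\<^sup>2)) (freqs d)"
  using parseval_nn_integral[OF f] sq_integrableD(2)[OF f]
  by (subst has_sum_iff_nn_integral_count_space)
     (simp_all add: fourier_coeff_eq_coeff nn_integral_eq_integral)

section \<open>Korobov spaces\<close>

lemma L2_iff: "f \<in> L2 d \<longleftrightarrow> sq_integrable (cube_measure d) f"
  by (simp add: L2_def sq_integrable_def)

lemma L2_norm_sq: "(L2_norm d f)\<^sup>2 = (LINT x|cube_measure d. (cmod (f x))\<^sup>2)"
  by (simp add: L2_norm_def)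

lemma L2_norm_nonneg: "0 \<le> L2_norm d f"
  by (simp add: L2_norm_def)

definition mpoly :: "nat \<Rightarrow> (nat \<Rightarrow> int) set \<Rightarrow> ((nat \<Rightarrow> int) \<Rightarrow> complex) \<Rightarrow> (nat \<Rightarrow> real) \<Rightarrow> complex" where
  "mpoly d F c x = (\<Sum>h\<in>F. c h * mexpi d h x)"

lemma sq_integrable_mpoly: "sq_integrable (cube_measure d) (mpoly d F c)"
  unfolding mpoly_def[abs_def] by (rule cube.sq_integrable_poly)

lemma fourier_coeff_mpoly:
  assumes "finite F" "F \<subseteq> freqs d" "h \<in> freqs d"
  shows "fourier_coeff d (mpoly d F c) h = (if h \<in> F then c h else 0)"
  using cube.coeff_poly[OF assms] by (simp add: fourier_coeff_eq_coeff mpoly_def[abs_def])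

lemma mexpi_continuous: "continuous_on S (mexpi d h)"
  unfolding mexpi_def[abs_def]
  by (intro continuous_on_prod continuous_on_compose2[OF continuous_on_expi]
      continuous_on_subset[OF continuous_on_product_coordinates]) auto

lemma mpoly_continuous: "continuous_on S (mpoly d F c)"
  unfolding mpoly_def[abs_def] by (intro continuous_intros mexpi_continuous)

lemma L2_norm_mpoly:
  assumes F: "finite F" "F \<subseteq> freqs d"
  shows "(L2_norm d (mpoly d F c))\<^sup>2 = (\<Sum>h\<in>F. (cmod (c h))\<^sup>2)"
proof -
  have "((\<lambda>h. (cmod (fourier_coeff d (mpoly d F c) h))\<^sup>2) has_sum (L2_norm d (mpoly d F c))\<^sup>2) (freqs d)"
    using parseval[OF sq_integrable_mpoly] by (simp add: L2_norm_sq)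
  moreover have "((\<lambda>h. (cmod (fourier_coeff d (mpoly d F c) h))\<^sup>2) has_sum (\<Sum>h\<in>F. (cmod (c h))\<^sup>2)) (freqs d)"
  proof -
    have "((\<lambda>h. (cmod (c h))\<^sup>2) has_sum (\<Sum>h\<in>F. (cmod (c h))\<^sup>2)) F" by (rule has_sum_finite[OF F(1)])
    then show ?thesis
      by (rule has_sum_cong_neutral[THEN iffD1, rotated -1]) (use F fourier_coeff_mpoly[OF F] in auto)
  qed
  ultimately show ?thesis by (rule has_sum_unique)
qed

lemma korobov_norm_sq_mpoly:
  assumes F: "finite F" "F \<subseteq> freqs d"
  shows "mpoly d F c \<in> korobov \<alpha> \<gamma> d"
    "korobov_norm_sq \<alpha> \<gamma> d (mpoly d F c) = (\<Sum>h\<in>F. r_weight \<alpha> \<gamma> d h * (cmod (c h))\<^sup>2)"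
proof -
  have "((\<lambda>h. r_weight \<alpha> \<gamma> d h * (cmod (c h))\<^sup>2) has_sum (\<Sum>h\<in>F. r_weight \<alpha> \<gamma> d h * (cmod (c h))\<^sup>2)) F"
    by (rule has_sum_finite[OF F(1)])
  then have hs: "((\<lambda>h. r_weight \<alpha> \<gamma> d h * (cmod (fourier_coeff d (mpoly d F c) h))\<^sup>2) has_sum
      (\<Sum>h\<in>F. r_weight \<alpha> \<gamma> d h * (cmod (c h))\<^sup>2)) (freqs d)"
    by (rule has_sum_cong_neutral[THEN iffD1, rotated -1]) (use F fourier_coeff_mpoly[OF F] in auto)
  then show "mpoly d F c \<in> korobov \<alpha> \<gamma> d"
    by (auto simp: korobov_def L2_iff sq_integrable_mpoly summable_on_def mpoly_continuous)
  show "korobov_norm_sq \<alpha> \<gamma> d (mpoly d F c) = (\<Sum>h\<in>F. r_weight \<alpha> \<gamma> d h * (cmod (c h))\<^sup>2)"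
    unfolding korobov_norm_sq_def by (rule infsumI[OF hs])
qed

lemma L2_norm_truncation:
  assumes f: "f \<in> L2 d" and F: "finite F" "F \<subseteq> freqs d"
  shows "((\<lambda>h. (cmod (fourier_coeff d f h))\<^sup>2) has_sum
    (L2_norm d (\<lambda>x. f x - mpoly d F (fourier_coeff d f) x))\<^sup>2) (freqs d - F)"
proof -
  have fs: "sq_integrable (cube_measure d) f" using f by (simp add: L2_iff)
  let ?c = "fourier_coeff d f"
  have "(L2_norm d (\<lambda>x. f x - mpoly d F ?c x))\<^sup>2 = (LINT x|cube_measure d. (cmod (f x))\<^sup>2) - (\<Sum>h\<in>F. (cmod (?c h))\<^sup>2)"
    unfolding L2_norm_sq mpoly_def cube.dist_to_span[OF fs F] by (simp add: fourier_coeff_eq_coeff)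
  then show ?thesis
    using has_sum_Diff[OF parseval[OF fs] has_sum_finite[OF F(1)] F(2)] by simp
qed

lemma L2_norm_diff_mpoly:
  assumes f: "f \<in> L2 d" and F: "finite F" "F \<subseteq> freqs d"
  shows "(L2_norm d (\<lambda>x. f x - mpoly d F c x))\<^sup>2
    = (L2_norm d (\<lambda>x. f x - mpoly d F (fourier_coeff d f) x))\<^sup>2 + (\<Sum>h\<in>F. (cmod (c h - fourier_coeff d f h))\<^sup>2)"
proof -
  have fs: "sq_integrable (cube_measure d) f" using f by (simp add: L2_iff)
  show ?thesis
    unfolding L2_norm_sq mpoly_def cube.dist_to_span[OF fs F] by (simp add: fourier_coeff_eq_coeff)
qed

section \<open>Zeta sums and reciprocal weights\<close>

lemma summable_zeta:
  assumes "\<beta> > 1"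
  shows "summable (\<lambda>i. 1 / real (Suc i) powr \<beta>)"
proof -
  have "summable (\<lambda>n. 1 / real n powr \<beta>)"
    using summable_real_powr_iff[of "- \<beta>"] assms by (simp add: powr_minus_divide)
  then show ?thesis by (subst summable_Suc_iff)
qed

lemma riemann_zeta_nonneg: "\<beta> > 1 \<Longrightarrow> 0 \<le> riemann_zeta \<beta>"
  unfolding riemann_zeta_def by (intro suminf_nonneg summable_zeta) auto

locale korobov_setting =
  fixes \<alpha> :: real and \<gamma> :: "nat \<Rightarrow> real"
  assumes alpha_nonneg: "\<alpha> \<ge> 0"
    and gamma_pos: "\<And>j. j \<ge> 1 \<Longrightarrow> 0 < \<gamma> j"
    and gamma_le1: "\<gamma> 1 \<le> 1"
    and gamma_mono: "\<And>j. j \<ge> 1 \<Longrightarrow> \<gamma> (Suc j) \<le> \<gamma> j"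
begin

lemma gamma_antimono: "1 \<le> i \<Longrightarrow> i \<le> j \<Longrightarrow> \<gamma> j \<le> \<gamma> i"
  by (rotate_tac 1, induction j rule: dec_induct) (auto intro: order.trans[OF gamma_mono])

lemma gamma_le_1: "1 \<le> j \<Longrightarrow> \<gamma> j \<le> 1"
  using gamma_antimono[of 1 j] gamma_le1 by auto

abbreviation r :: "nat \<Rightarrow> (nat \<Rightarrow> int) \<Rightarrow> real" where "r \<equiv> r_weight \<alpha> \<gamma>"
abbreviation nsq :: "nat \<Rightarrow> ((nat \<Rightarrow> real) \<Rightarrow> complex) \<Rightarrow> real" where "nsq \<equiv> korobov_norm_sq \<alpha> \<gamma>"

lemma r_pos: "0 < r d h"
  unfolding r_weight_def using gamma_pos by (intro prod_pos) (auto simp: less_imp_neq[THEN not_sym])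

lemma nsq_nonneg: "0 \<le> nsq d f"
  unfolding korobov_norm_sq_def by (intro infsum_nonneg mult_nonneg_nonneg less_imp_le[OF r_pos]) auto

lemma nsq_has_sum:
  "f \<in> korobov \<alpha> \<gamma> d \<Longrightarrow> ((\<lambda>h. r d h * (cmod (fourier_coeff d f h))\<^sup>2) has_sum nsq d f) (freqs d)"
  unfolding korobov_norm_sq_def korobov_def by (intro has_sum_infsum) auto

lemma nsq_partial_sum_le:
  assumes "f \<in> korobov \<alpha> \<gamma> d" "finite G" "G \<subseteq> freqs d"
  shows "(\<Sum>h\<in>G. r d h * (cmod (fourier_coeff d f h))\<^sup>2) \<le> nsq d f"
  by (rule has_sum_mono2[OF has_sum_finite[OF assms(2)] nsq_has_sum[OF assms(1)] assms(3)])
     (simp add: less_imp_le[OF r_pos])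

text \<open>Cauchy-Schwarz after inserting \<open>sqrt r\<close> and its inverse. For \<alpha> > 1
  the first factor stays bounded, which is the boundedness of point evaluation.\<close>

lemma sum_norm_fourier_coeff_le:
  assumes f: "f \<in> korobov \<alpha> \<gamma> d" and G: "finite G" "G \<subseteq> freqs d"
  shows "(\<Sum>h\<in>G. cmod (fourier_coeff d f h))\<^sup>2 \<le> (\<Sum>h\<in>G. 1 / r d h) * nsq d f"
proof -
  have "(\<Sum>h\<in>G. cmod (fourier_coeff d f h))\<^sup>2
      = (\<Sum>h\<in>G. sqrt (1 / r d h) * (sqrt (r d h) * cmod (fourier_coeff d f h)))\<^sup>2"
    using r_pos by (simp add: real_sqrt_divide less_imp_neq[THEN not_sym])
  also have "\<dots> \<le> (\<Sum>h\<in>G. (sqrt (1 / r d h))\<^sup>2) * (\<Sum>h\<in>G. (sqrt (r d h) * cmod (fourier_coeff d f h))\<^sup>2)"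
    by (rule Cauchy_Schwarz_ineq_sum)
  also have "\<dots> = (\<Sum>h\<in>G. 1 / r d h) * (\<Sum>h\<in>G. r d h * (cmod (fourier_coeff d f h))\<^sup>2)"
    using r_pos by (simp add: power_mult_distrib less_imp_le)
  also have "\<dots> \<le> (\<Sum>h\<in>G. 1 / r d h) * nsq d f"
    by (intro mult_left_mono nsq_partial_sum_le f G sum_nonneg) (simp add: less_imp_le r_pos)
  finally show ?thesis .
qed

definition wt :: "real \<Rightarrow> nat \<Rightarrow> int \<Rightarrow> real" where
  "wt s j k = (if k = 0 then 1 else \<gamma> (Suc j) powr s * (1 / \<bar>real_of_int k\<bar> powr (\<alpha> * s)))"

lemma inverse_r_powr:
  assumes "\<alpha> > 0"
  shows "(1 / r d h) powr s = (\<Prod>j<d. wt s j (h j))"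
proof -
  have "1 / r d h = (\<Prod>j<d. wt 1 j (h j))"
    unfolding r_weight_def prod_dividef[symmetric] using assms gamma_pos
    by (simp flip: prod_dividef add: inverse_eq_divide[symmetric] prod_inversef[symmetric])
       (auto intro!: prod.cong simp: wt_def powr_minus field_simps)
  moreover have "0 \<le> wt 1 j k" "wt 1 j k powr s = wt s j k" for j k
    using gamma_pos[of "Suc j"] by (simp_all add: wt_def powr_mult powr_powr powr_divide)
  ultimately show ?thesis by (simp add: prod_powr_distrib)
qed

lemma sum_wt_le:
  assumes "\<alpha> * s > 1"
  shows "(\<Sum>k\<in>{-int m..int m}. wt s j k) \<le> 1 + 2 * riemann_zeta (\<alpha> * s) * \<gamma> (Suc j) powr s"
proof -
  have "(\<Sum>k\<in>{-int m..int m}. wt s j k) = 1 + 2 * (\<Sum>i<m. 1 / real (Suc i) powr (\<alpha> * s)) * \<gamma> (Suc j) powr s"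
  proof (induction m)
    case 0
    then show ?case by (simp add: wt_def)
  next
    case (Suc m)
    have "{-int (Suc m)..int (Suc m)} = insert (int (Suc m)) (insert (- int (Suc m)) {-int m..int m})" by auto
    then have "(\<Sum>k\<in>{-int (Suc m)..int (Suc m)}. wt s j k) = wt s j (int (Suc m)) + (wt s j (- int (Suc m)) + (\<Sum>k\<in>{-int m..int m}. wt s j k))"
      by simp
    moreover have "wt s j (int (Suc m)) = \<gamma> (Suc j) powr s * (1 / real (Suc m) powr (\<alpha> * s))"
      "wt s j (- int (Suc m)) = \<gamma> (Suc j) powr s * (1 / real (Suc m) powr (\<alpha> * s))"
      unfolding wt_def by (simp_all add: abs_if add.commute)
    ultimately show ?case using Suc.IH by (simp add: algebra_simps)
  qed
  also have "(\<Sum>i<m. 1 / real (Suc i) powr (\<alpha> * s)) \<le> riemann_zeta (\<alpha> * s)"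
    unfolding riemann_zeta_def
  proof (rule sum_le_suminf)
    show "summable (\<lambda>i. 1 / real (Suc i) powr (\<alpha> * s))" by (rule summable_zeta[OF assms])
  qed auto
  finally show ?thesis by (simp add: mult_right_mono)
qed

text \<open>Every finite set of frequencies lies in a box, over which the sum factors into
  one-dimensional sums. The bound is the same for all \<open>F\<close>, hence it also yields
  summability over all frequencies.\<close>

lemma sum_inverse_r_powr_le:
  assumes alpha: "\<alpha> > 0" and s: "\<alpha> * s > 1" and F: "finite F" "F \<subseteq> freqs d"
  shows "(\<Sum>h\<in>F. (1 / r d h) powr s) \<le> (\<Prod>j<d. 1 + 2 * riemann_zeta (\<alpha> * s) * \<gamma> (Suc j) powr s)"
proof -
  have wt0: "0 \<le> wt s j k" for j k using gamma_pos[of "Suc j"] by (simp add: wt_def)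
  define B where "B = (\<Union>h\<in>F. (\<lambda>j. nat \<bar>h j\<bar>) ` {..<d})"
  have "finite B" using F by (simp add: B_def)
  then obtain m where m: "\<And>b. b \<in> B \<Longrightarrow> b \<le> m" using Max_ge by blast
  have sub: "F \<subseteq> PiE {..<d} (\<lambda>_. {-int m..int m})"
  proof
    fix h assume h: "h \<in> F"
    then have "h \<in> PiE {..<d} (\<lambda>_. UNIV)" using F by (auto simp: freqs_def)
    moreover have "h j \<in> {-int m..int m}" if "j < d" for j
    proof -
      have "nat \<bar>h j\<bar> \<le> m" using h that by (intro m) (auto simp: B_def)
      then show ?thesis by auto
    qed
    ultimately show "h \<in> PiE {..<d} (\<lambda>_. {-int m..int m})" by (auto simp: PiE_def)
  qed
  have "(\<Sum>h\<in>F. (1 / r d h) powr s) \<le> (\<Sum>h\<in>PiE {..<d} (\<lambda>_. {-int m..int m}). \<Prod>j<d. wt s j (h j))"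
    unfolding inverse_r_powr[OF alpha]
    by (rule sum_mono2) (use sub wt0 in \<open>auto intro!: finite_PiE prod_nonneg\<close>)
  also have "\<dots> = (\<Prod>j<d. \<Sum>k\<in>{-int m..int m}. wt s j k)"
    by (subst prod_sum_PiE) auto
  also have "\<dots> \<le> (\<Prod>j<d. 1 + 2 * riemann_zeta (\<alpha> * s) * \<gamma> (Suc j) powr s)"
    by (intro prod_mono conjI sum_wt_le s sum_nonneg wt0)
  finally show ?thesis .
qed

definition wtrace :: "nat \<Rightarrow> real" where
  "wtrace d = (\<Prod>j<d. 1 + 2 * riemann_zeta \<alpha> * \<gamma> (Suc j))"

lemma sum_inverse_r_le:
  assumes "\<alpha> > 1" "finite F" "F \<subseteq> freqs d"
  shows "(\<Sum>h\<in>F. 1 / r d h) \<le> wtrace d"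
  using sum_inverse_r_powr_le[of 1 F d] assms gamma_pos r_pos
  by (simp add: wtrace_def less_imp_le)

lemma summable_inverse_r:
  assumes "\<alpha> > 1"
  shows "(\<lambda>h. 1 / r d h) summable_on freqs d"
  by (rule nonneg_bdd_above_summable_on)
     (use sum_inverse_r_le[OF assms] r_pos in \<open>auto intro!: bdd_aboveI[of _ "wtrace d"] simp: less_imp_le\<close>)

end

section \<open>Pointwise values and Fourier series of continuous representatives\<close>

lemma open_meets_unit_interval_positive:
  assumes "open (X :: real set)" "t \<in> X" "t \<in> {0..1}"
  shows "0 < emeasure (lebesgue_on {0..1}) (X \<inter> {0..1})"
proof -
  obtain e where e: "e > 0" "ball t e \<subseteq> X" using assms openE by blast
  define a where "a = max 0 (t - e)"
  define b where "b = min 1 (t + e)"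
  have ab: "a < b" using assms(3) e by (auto simp: a_def b_def)
  have "{a<..<b} \<subseteq> X \<inter> {0..1}"
    using e(2) by (auto simp: a_def b_def ball_def dist_real_def subset_iff)
  then have "emeasure lebesgue {a<..<b} \<le> emeasure lebesgue (X \<inter> {0..1})"
    using assms(1) by (intro emeasure_mono) auto
  moreover have "emeasure lebesgue {a<..<b} = ennreal (b - a)" using ab by simp
  moreover have "emeasure (lebesgue_on {0..1}) (X \<inter> {0..1}) = emeasure lebesgue (X \<inter> {0..1})"
    by (rule emeasure_restrict_space) auto
  moreover have "0 < ennreal (b - a)" using ab by simp
  ultimately show ?thesis by (metis order.strict_trans2)
qed

text \<open>A nonzero value persists on a basic open box around the point. Each side of the box
  meets the interval in positive measure, so no null set contains the box.\<close>

lemma AE_zero_continuous_imp_zero: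
  fixes u :: "(nat \<Rightarrow> real) \<Rightarrow> complex"
  assumes cont: "continuous_on (cube d) u" and ae: "AE x in cube_measure d. u x = 0" and x: "x \<in> cube d"
  shows "u x = 0"
proof (rule ccontr)
  assume "u x \<noteq> 0"
  then obtain A where A: "open A" "x \<in> A" "\<And>y. y \<in> cube d \<Longrightarrow> y \<in> A \<Longrightarrow> u y \<in> - {0}"
    using cont x unfolding continuous_on_topological by (metis Compl_iff open_Compl closed_singleton singletonD)
  have "openin (product_topology (\<lambda>_. euclidean) UNIV) A" using A(1) by (simp add: open_fun_def)
  from product_topology_open_contains_basis[OF this A(2)]
  obtain X where X: "x \<in> PiE UNIV X" "\<And>i. open (X i)" "PiE UNIV X \<subseteq> A" by auto
  define V where "V = PiE {..<d} (\<lambda>j. X j \<inter> {0..1})"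
  have VA: "y \<in> A \<and> y \<in> cube d" if "y \<in> V" for y
  proof -
    have "y \<in> cube d" using that by (auto simp: V_def cube_def PiE_def Pi_def)
    moreover have "y j \<in> X j" for j
    proof (cases "j < d")
      case True
      then show ?thesis using that by (auto simp: V_def)
    next
      case False
      \<comment> \<open>Beyond the first \<open>d\<close> coordinates every point of the cube has
        the value \<open>undefined\<close>.\<close>
      then have "y j = x j" using \<open>y \<in> cube d\<close> x by (auto simp: cube_def PiE_def extensional_def)
      then show ?thesis using X(1) by auto
    qed
    then have "y \<in> A" using X(3) by auto
    ultimately show ?thesis by simp
  qed
  have sets: "X j \<inter> {0..1} \<in> sets (lebesgue_on {0..1})" for j
    using X(2)[of j] by (subst sets_restrict_space_iff) auto
  have "emeasure (cube_measure d) V = (\<Prod>j<d. emeasure (lebesgue_on {0..1}) (X j \<inter> {0..1}))"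
    unfolding V_def cube_measure_def by (rule unit_interval_product.emeasure_PiM) (auto simp: sets)
  moreover have "0 < emeasure (lebesgue_on {0..1}) (X j \<inter> {0..1})" if "j < d" for j
    by (rule open_meets_unit_interval_positive[OF X(2), of "x j"]) (use X(1) x that in \<open>auto simp: cube_def\<close>)
  ultimately have "emeasure (cube_measure d) V \<noteq> 0"
    by (simp add: prod_zero_iff) (metis less_irrefl lessThan_iff)
  moreover have "emeasure (cube_measure d) V = 0"
  proof -
    obtain N where N: "{y \<in> space (cube_measure d). \<not> u y = 0} \<subseteq> N" "N \<in> sets (cube_measure d)" "emeasure (cube_measure d) N = 0"
      using ae by (rule AE_E)
    have "V \<subseteq> N" using VA A(3) N(1) by (auto simp: space_cube_measure)
    then have "emeasure (cube_measure d) V \<le> emeasure (cube_measure d) N" by (intro emeasure_mono N)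
    then show ?thesis using N by simp
  qed
  ultimately show False by simp
qed

context korobov_setting
begin

lemma fourier_coeff_abs_summable:
  assumes alpha: "\<alpha> > 1" and f: "f \<in> korobov \<alpha> \<gamma> d"
  shows "(\<lambda>h. cmod (fourier_coeff d f h)) summable_on freqs d"
proof (rule nonneg_bdd_above_summable_on)
  show "bdd_above (sum (\<lambda>h. cmod (fourier_coeff d f h)) ` {F. F \<subseteq> freqs d \<and> finite F})"
  proof (rule bdd_aboveI2[where M = "sqrt (wtrace d * nsq d f)"])
    fix F assume "F \<in> {F. F \<subseteq> freqs d \<and> finite F}"
    then have F: "finite F" "F \<subseteq> freqs d" by auto
    have "(\<Sum>h\<in>F. cmod (fourier_coeff d f h))\<^sup>2 \<le> (\<Sum>h\<in>F. 1 / r d h) * nsq d f"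
      by (rule sum_norm_fourier_coeff_le[OF f F])
    also have "\<dots> \<le> wtrace d * nsq d f"
      by (intro mult_right_mono sum_inverse_r_le alpha F nsq_nonneg)
    finally show "(\<Sum>h\<in>F. cmod (fourier_coeff d f h)) \<le> sqrt (wtrace d * nsq d f)"
      by (rule real_le_rsqrt)
  qed
qed simp

text \<open>The absolutely convergent series has a continuous sum \<open>w\<close>, and by Parseval
  its partial sums tend to \<open>f\<close> in mean square; hence \<open>f = w\<close> almost
  everywhere. Continuity of \<open>f\<close>, built into \<open>korobov\<close> for \<alpha> > 1,
  upgrades this to every point of the cube.\<close>

lemma fourier_series_pointwise:
  assumes alpha: "\<alpha> > 1" and f: "f \<in> korobov \<alpha> \<gamma> d" and x: "x \<in> cube d"
  shows "((\<lambda>h. fourier_coeff d f h * mexpi d h x) has_sum f x) (freqs d)"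
proof -
  let ?c = "fourier_coeff d f" and ?M = "cube_measure d"
  define w where "w = (\<lambda>x. \<Sum>\<^sub>\<infinity>h\<in>freqs d. ?c h * mexpi d h x)"
  have abs: "(\<lambda>h. cmod (?c h)) summable_on freqs d" by (rule fourier_coeff_abs_summable[OF alpha f])
  have fL: "f \<in> L2 d" and fcont: "continuous_on (cube d) f" using f alpha by (auto simp: korobov_def)
  have fs: "sq_integrable ?M f" using fL by (simp add: L2_iff)
  have unif: "uniform_limit UNIV (\<lambda>X. mpoly d X ?c) w (finite_subsets_at_top (freqs d))"
    unfolding w_def mpoly_def[abs_def]
    by (rule Weierstrass_m_test_general[OF _ abs]) (simp add: norm_mult)
  have wcont: "continuous_on UNIV w"
    by (rule uniform_limit_theorem[OF _ unif]) (auto simp: mpoly_continuous)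
  have ex: "\<exists>F. finite F \<and> F \<subseteq> freqs d \<and> (\<forall>x. cmod (mpoly d F ?c x - w x) < e) \<and>
      (L2_norm d (\<lambda>x. f x - mpoly d F ?c x))\<^sup>2 < e" if e: "e > 0" for e
  proof -
    have 1: "\<forall>\<^sub>F F in finite_subsets_at_top (freqs d). \<forall>x\<in>UNIV. dist (mpoly d F ?c x) (w x) < e"
      using unif e by (rule uniform_limitD)
    have "((\<lambda>F. \<Sum>h\<in>F. (cmod (?c h))\<^sup>2) \<longlongrightarrow> (LINT x|?M. (cmod (f x))\<^sup>2)) (finite_subsets_at_top (freqs d))"
      using parseval[OF fs] by (simp add: has_sum_def)
    from tendstoD[OF this e] have 2: "\<forall>\<^sub>F F in finite_subsets_at_top (freqs d).
        dist (\<Sum>h\<in>F. (cmod (?c h))\<^sup>2) (LINT x|?M. (cmod (f x))\<^sup>2) < e" .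
    have 3: "\<forall>\<^sub>F F in finite_subsets_at_top (freqs d). finite F \<and> F \<subseteq> freqs d"
      by (rule eventually_finite_subsets_at_top_weakI) auto
    obtain F where F: "finite F" "F \<subseteq> freqs d" "\<forall>x. dist (mpoly d F ?c x) (w x) < e"
      "dist (\<Sum>h\<in>F. (cmod (?c h))\<^sup>2) (LINT x|?M. (cmod (f x))\<^sup>2) < e"
      using eventually_happens'[OF finite_subsets_at_top_neq_bot eventually_conj[OF 1 eventually_conj[OF 2 3]]] by auto
    have "(L2_norm d (\<lambda>x. f x - mpoly d F ?c x))\<^sup>2 = (LINT x|?M. (cmod (f x))\<^sup>2) - (\<Sum>h\<in>F. (cmod (?c h))\<^sup>2)"
      unfolding L2_norm_sq mpoly_def cube.dist_to_span[OF fs F(1,2)] by (simp add: fourier_coeff_eq_coeff)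
    then show ?thesis using F by (intro exI[of _ F]) (auto simp: dist_norm)
  qed
  \<comment> \<open>Convergence is along the net of finite sets, while measurability of limits is
    available for sequences; a sequence with error below \<open>1 / (n + 1)\<close> is
    extracted.\<close>
  have wm: "w \<in> borel_measurable ?M"
  proof -
    have "\<exists>F. \<forall>n. \<forall>x. cmod (mpoly d (F n) ?c x - w x) < 1 / real (Suc n)"
    proof (intro choice allI)
      fix n
      have "0 < 1 / real (Suc n)" by simp
      from ex[OF this] show "\<exists>F. \<forall>x. cmod (mpoly d F ?c x - w x) < 1 / real (Suc n)" by blast
    qed
    then obtain F where F: "\<And>n x. cmod (mpoly d (F n) ?c x - w x) < 1 / real (Suc n)" by blast
    show ?thesis
    proof (rule borel_measurable_LIMSEQ_metric)
      show "mpoly d (F n) ?c \<in> borel_measurable ?M" for n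
        using sq_integrable_mpoly by (simp add: sq_integrable_def)
      fix x
      have "(\<lambda>n. mpoly d (F n) ?c x - w x) \<longlonglongrightarrow> 0"
        by (rule Lim_null_comparison[OF _ LIMSEQ_inverse_real_of_nat])
           (use F in \<open>auto intro!: always_eventually less_imp_le simp: inverse_eq_divide simp del: of_nat_Suc\<close>)
      then show "(\<lambda>n. mpoly d (F n) ?c x) \<longlonglongrightarrow> w x" by (rule LIM_zero_cancel)
    qed
  qed
  obtain B where B: "\<And>x. cmod (w x) \<le> B"
  proof -
    have "cmod (w x) \<le> (\<Sum>\<^sub>\<infinity>h\<in>freqs d. cmod (?c h))" for x
      unfolding w_def using norm_infsum_bound[of "\<lambda>h. ?c h * mexpi d h x" "freqs d"] abs
      by (simp add: norm_mult)
    then show ?thesis using that by blast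
  qed
  have ws: "sq_integrable ?M w" by (rule sq_integrable_bounded[OF finite_measure_cube_measure wm B])
  have "(LINT x|?M. (cmod (f x - w x))\<^sup>2) \<le> 0 + e" if e: "e > 0" for e
  proof -
    \<comment> \<open>The two errors contribute at most \<open>2 \<delta> + 2 \<delta>^2\<close>,
      and \<open>\<delta> <= 1\<close> bounds this by \<open>4 \<delta> <= e\<close>.\<close>
    define \<delta> where "\<delta> = min 1 (e / 4)"
    have d: "\<delta> > 0" "\<delta> \<le> 1" "\<delta> \<le> e / 4" using e by (auto simp: \<delta>_def)
    obtain F where F: "finite F" "F \<subseteq> freqs d" "\<And>x. cmod (mpoly d F ?c x - w x) < \<delta>"
      "(L2_norm d (\<lambda>x. f x - mpoly d F ?c x))\<^sup>2 < \<delta>" using ex[OF d(1)] by blast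
    have pw: "sq_integrable ?M (\<lambda>x. mpoly d F ?c x - w x)" by (rule sq_integrable_diff[OF sq_integrable_mpoly ws])
    have "(LINT x|?M. (cmod (f x - w x))\<^sup>2) = (LINT x|?M. (cmod ((f x - mpoly d F ?c x) + (mpoly d F ?c x - w x)))\<^sup>2)"
      by simp
    also have "\<dots> \<le> 2 * (LINT x|?M. (cmod (f x - mpoly d F ?c x))\<^sup>2) + 2 * (LINT x|?M. (cmod (mpoly d F ?c x - w x))\<^sup>2)"
      by (intro integral_norm_add_le sq_integrable_diff fs sq_integrable_mpoly ws)
    also have "(LINT x|?M. (cmod (mpoly d F ?c x - w x))\<^sup>2) \<le> (LINT x|?M. \<delta>)"
    proof (rule integral_mono)
      show "integrable ?M (\<lambda>x. (cmod (mpoly d F ?c x - w x))\<^sup>2)" by (rule sq_integrableD(2)[OF pw])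
      show "integrable ?M (\<lambda>x. \<delta>)" by (rule finite_measure.integrable_const[OF finite_measure_cube_measure])
      fix x
      have "(cmod (mpoly d F ?c x - w x))\<^sup>2 \<le> \<delta>\<^sup>2"
        using F(3)[of x] by (intro power_mono) auto
      also have "\<dots> \<le> \<delta>" using d by (simp add: power2_eq_square mult_left_le)
      finally show "(cmod (mpoly d F ?c x - w x))\<^sup>2 \<le> \<delta>" .
    qed
    also have "(LINT x|?M. \<delta>) = \<delta>" by (simp add: measure_cube_measure)
    also have "(LINT x|?M. (cmod (f x - mpoly d F ?c x))\<^sup>2) \<le> \<delta>" using F(4) by (simp add: L2_norm_sq)
    finally show ?thesis using d by simp
  qed
  then have "(LINT x|?M. (cmod (f x - w x))\<^sup>2) \<le> 0" by (rule field_le_epsilon)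
  moreover have "0 \<le> (LINT x|?M. (cmod (f x - w x))\<^sup>2)" by simp
  ultimately have "(LINT x|?M. (cmod (f x - w x))\<^sup>2) = 0" by linarith
  then have "AE x in ?M. (cmod (f x - w x))\<^sup>2 = 0"
    using integral_nonneg_eq_0_iff_AE[OF sq_integrableD(2)[OF sq_integrable_diff[OF fs ws]]] by simp
  then have "AE x in ?M. f x - w x = 0" by simp
  moreover have "continuous_on (cube d) (\<lambda>x. f x - w x)"
    by (intro continuous_on_diff fcont continuous_on_subset[OF wcont]) simp
  ultimately have "f x - w x = 0" using AE_zero_continuous_imp_zero x by blast
  moreover have "(\<lambda>h. ?c h * mexpi d h x) summable_on freqs d"
    by (rule abs_summable_summable) (use abs in \<open>simp add: norm_mult\<close>)
  ultimately show ?thesis unfolding w_def using has_sum_infsum by fastforce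
qed

text \<open>Samples see the truncation error pointwise, so a mean-square bound is not enough. The
  tail of \<open>1 / r\<close> controls the error uniformly on the cube.\<close>

lemma truncation_error_pointwise:
  assumes alpha: "\<alpha> > 1" and f: "f \<in> korobov \<alpha> \<gamma> d" and x: "x \<in> cube d"
    and F: "finite F" "F \<subseteq> freqs d"
    and \<tau>: "\<And>G. finite G \<Longrightarrow> G \<subseteq> freqs d - F \<Longrightarrow> (\<Sum>h\<in>G. 1 / r d h) \<le> \<tau>"
  shows "(cmod (f x - mpoly d F (fourier_coeff d f) x))\<^sup>2 \<le> \<tau> * nsq d f"
proof -
  let ?c = "fourier_coeff d f"
  have t0: "0 \<le> \<tau>" using \<tau>[of "{}"] by simp
  have "((\<lambda>h. ?c h * mexpi d h x) has_sum (f x - mpoly d F ?c x)) (freqs d - F)"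
    using has_sum_Diff[OF fourier_series_pointwise[OF alpha f x] has_sum_finite[OF F(1)] F(2)]
    by (simp add: mpoly_def)
  then have lim: "((\<lambda>G. \<Sum>h\<in>G. ?c h * mexpi d h x) \<longlongrightarrow> f x - mpoly d F ?c x) (finite_subsets_at_top (freqs d - F))"
    by (simp add: has_sum_def)
  have "cmod (f x - mpoly d F ?c x) \<le> sqrt (\<tau> * nsq d f)"
  proof (rule Lim_norm_ubound[OF finite_subsets_at_top_neq_bot lim])
    show "\<forall>\<^sub>F G in finite_subsets_at_top (freqs d - F). cmod (\<Sum>h\<in>G. ?c h * mexpi d h x) \<le> sqrt (\<tau> * nsq d f)"
    proof (rule eventually_finite_subsets_at_top_weakI)
      fix G assume G: "finite G" "G \<subseteq> freqs d - F"
      have "cmod (\<Sum>h\<in>G. ?c h * mexpi d h x) \<le> (\<Sum>h\<in>G. cmod (?c h))"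
        by (rule order.trans[OF norm_sum]) (simp add: norm_mult)
      also have "\<dots> \<le> sqrt (\<tau> * nsq d f)"
      proof (rule real_le_rsqrt)
        have "(\<Sum>h\<in>G. cmod (?c h))\<^sup>2 \<le> (\<Sum>h\<in>G. 1 / r d h) * nsq d f"
          using G by (intro sum_norm_fourier_coeff_le f) auto
        also have "\<dots> \<le> \<tau> * nsq d f" by (intro mult_right_mono \<tau> G nsq_nonneg)
        finally show "(\<Sum>h\<in>G. cmod (?c h))\<^sup>2 \<le> \<tau> * nsq d f" .
      qed
      finally show "cmod (\<Sum>h\<in>G. ?c h * mexpi d h x) \<le> sqrt (\<tau> * nsq d f)" .
    qed
  qed
  then have "(cmod (f x - mpoly d F ?c x))\<^sup>2 \<le> (sqrt (\<tau> * nsq d f))\<^sup>2" by (intro power_mono) auto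
  then show ?thesis using t0 nsq_nonneg by simp
qed

end

section \<open>Upper bound for function values\<close>

definition achieves :: "real \<Rightarrow> (nat \<Rightarrow> real) \<Rightarrow> nat \<Rightarrow> functional set \<Rightarrow> real \<Rightarrow> nat \<Rightarrow> bool" where
  "achieves \<alpha> \<gamma> d \<Lambda> \<epsilon> n \<longleftrightarrow> (\<exists>a L. (\<forall>k<n. a k \<in> L2 d \<and> L k \<in> \<Lambda>) \<and> wor_err \<alpha> \<gamma> d n a L \<le> ereal \<epsilon>)"

text \<open>An infimum of naturals in \<open>enat\<close> is attained if some algorithm reaches the
  error and is infinite otherwise. Complexity bounds thus become existence statements about
  algorithms.\<close>

lemma enat_le_real_comp_wor_iff:
  "enat_le_real (comp_wor \<alpha> \<gamma> d \<Lambda> \<epsilon>) y \<longleftrightarrow> (\<exists>n. achieves \<alpha> \<gamma> d \<Lambda> \<epsilon> n \<and> real n \<le> y)"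
proof
  let ?S = "enat ` {n. achieves \<alpha> \<gamma> d \<Lambda> \<epsilon> n}"
  have comp: "comp_wor \<alpha> \<gamma> d \<Lambda> \<epsilon> = Inf ?S"
    by (simp add: comp_wor_def achieves_def)
  {
    assume "enat_le_real (comp_wor \<alpha> \<gamma> d \<Lambda> \<epsilon>) y"
    then obtain n where n: "Inf ?S = enat n" "real n \<le> y" by (auto simp: enat_le_real_def comp)
    then have "?S \<noteq> {}" by (metis Inf_enat_def enat.distinct(1) infinity_enat_def)
    then have "Inf ?S \<in> ?S" unfolding Inf_enat_def by (auto intro: LeastI)
    then show "\<exists>n. achieves \<alpha> \<gamma> d \<Lambda> \<epsilon> n \<and> real n \<le> y" using n by auto
  next
    assume "\<exists>n. achieves \<alpha> \<gamma> d \<Lambda> \<epsilon> n \<and> real n \<le> y"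
    then obtain n where n: "achieves \<alpha> \<gamma> d \<Lambda> \<epsilon> n" "real n \<le> y" by blast
    then have "Inf ?S \<le> enat n" by (intro Inf_lower) auto
    then obtain m where "Inf ?S = enat m" "m \<le> n" using enat_ile by (metis enat_ord_simps(1))
    then show "enat_le_real (comp_wor \<alpha> \<gamma> d \<Lambda> \<epsilon>) y"
      using n(2) unfolding comp enat_le_real_def by (intro exI[of _ m]) auto
  }
qed

lemma achievesI:
  assumes "\<And>k. k < n \<Longrightarrow> a k \<in> L2 d" "\<And>k. k < n \<Longrightarrow> L k \<in> \<Lambda>"
    and "\<And>f. f \<in> korobov \<alpha> \<gamma> d \<Longrightarrow> korobov_norm_sq \<alpha> \<gamma> d f \<le> 1 \<Longrightarrow>
      (L2_norm d (\<lambda>x. f x - alg_apply n a L f x))\<^sup>2 \<le> \<epsilon>\<^sup>2"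
    and "\<epsilon> \<ge> 0"
  shows "achieves \<alpha> \<gamma> d \<Lambda> \<epsilon> n"
proof -
  have "wor_err \<alpha> \<gamma> d n a L \<le> ereal \<epsilon>"
    unfolding wor_err_def
    by (rule SUP_least) (use assms(3,4) in \<open>auto intro: power2_le_imp_le\<close>)
  then show ?thesis using assms(1,2) unfolding achieves_def by blast
qed

lemma achievesD:
  assumes "achieves \<alpha> \<gamma> d \<Lambda> \<epsilon> n"
  obtains a L where "\<And>k. k < n \<Longrightarrow> a k \<in> L2 d" "\<And>k. k < n \<Longrightarrow> L k \<in> \<Lambda>"
    "\<And>f. f \<in> korobov \<alpha> \<gamma> d \<Longrightarrow> korobov_norm_sq \<alpha> \<gamma> d f \<le> 1 \<Longrightarrow>
      L2_norm d (\<lambda>x. f x - alg_apply n a L f x) \<le> \<epsilon>"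
proof -
  obtain a L where al: "\<forall>k<n. a k \<in> L2 d \<and> L k \<in> \<Lambda>" and err: "wor_err \<alpha> \<gamma> d n a L \<le> ereal \<epsilon>"
    using assms by (auto simp: achieves_def)
  have "L2_norm d (\<lambda>x. f x - alg_apply n a L f x) \<le> \<epsilon>"
    if "f \<in> korobov \<alpha> \<gamma> d" "korobov_norm_sq \<alpha> \<gamma> d f \<le> 1" for f
  proof -
    have "ereal (L2_norm d (\<lambda>x. f x - alg_apply n a L f x)) \<le> wor_err \<alpha> \<gamma> d n a L"
      unfolding wor_err_def by (rule SUP_upper) (use that in auto)
    then show ?thesis using err by (metis ereal_less_eq(3) order.trans)
  qed
  then show ?thesis using that al by blast
qed

text \<open>By orthonormality the mean of the quadratic form over the cube is the trace, and a
  function cannot lie strictly below its mean everywhere. The exponentials are conjugated so that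
  pairing with coefficients evaluates a polynomial at \<open>x\<close>.\<close>

lemma exists_point_ge_trace:
  assumes F: "finite F" "F \<subseteq> freqs d"
  shows "\<exists>x\<in>cube d. Re (mat_trace F K) \<le> Re (qform F K (\<lambda>h. cnj (mexpi d h x)))"
proof (rule ccontr)
  let ?M = "cube_measure d"
  let ?q = "\<lambda>x. qform F K (\<lambda>h. cnj (mexpi d h x))"
  assume "\<not> ?thesis"
  then have less: "Re (?q x) < Re (mat_trace F K)" if "x \<in> cube d" for x
    using that by force
  have q: "?q x = (\<Sum>i\<in>F. \<Sum>j\<in>F. K i j * (cnj (mexpi d j x) * mexpi d i x))" for x
    unfolding qform_def by (intro sum.cong refl) (simp add: mult_ac)
  have int: "integrable ?M (\<lambda>x. cnj (mexpi d j x) * mexpi d i x)" for i j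
    by (rule sq_integrable_mult[OF cube.sq_integrable_phi cube.sq_integrable_phi])
  have qi: "integrable ?M ?q"
    unfolding q by (intro Bochner_Integration.integrable_sum integrable_mult_right int)
  have "(LINT x|?M. ?q x) = (\<Sum>i\<in>F. \<Sum>j\<in>F. K i j * (LINT x|?M. cnj (mexpi d j x) * mexpi d i x))"
    unfolding q by (simp add: Bochner_Integration.integral_sum int)
  also have "\<dots> = (\<Sum>i\<in>F. \<Sum>j\<in>F. if j = i then K i j else 0)"
    by (intro sum.cong refl) (use F in \<open>auto simp: cube.phi_orth subset_iff\<close>)
  also have "\<dots> = mat_trace F K" using F by (simp add: mat_trace_def)
  finally have "(LINT x|?M. Re (?q x)) = Re (mat_trace F K)" using integral_Re[OF qi] by simp
  then have "(LINT x|?M. Re (mat_trace F K) - Re (?q x)) = 0"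
    using integrable_Re[OF qi] finite_measure.integrable_const[OF finite_measure_cube_measure]
    by (subst Bochner_Integration.integral_diff) (simp_all add: measure_cube_measure)
  moreover have "integrable ?M (\<lambda>x. Re (mat_trace F K) - Re (?q x))"
    using integrable_Re[OF qi] finite_measure.integrable_const[OF finite_measure_cube_measure]
    by (intro Bochner_Integration.integrable_diff) auto
  ultimately have "AE x in ?M. Re (mat_trace F K) - Re (?q x) = 0"
    by (subst (asm) integral_nonneg_eq_0_iff_AE) (auto simp: space_cube_measure intro!: AE_I2 less_imp_le less)
  then have "AE x in ?M. False"
    using AE_space by eventually_elim (use less in \<open>fastforce simp: space_cube_measure\<close>)
  then obtain N where N: "{x \<in> space ?M. \<not> False} \<subseteq> N" "N \<in> sets ?M" "emeasure ?M N = 0" by (rule AE_E)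
  then have "emeasure ?M (space ?M) \<le> emeasure ?M N" by (intro emeasure_mono) auto
  then show False using N emeasure_cube_measure[of d] by simp
qed

context korobov_setting
begin

lemma wtrace_ge_1: "\<alpha> > 1 \<Longrightarrow> 1 \<le> wtrace d"
  unfolding wtrace_def
proof (rule prod_ge_1)
  fix j assume "\<alpha> > 1"
  then have "0 \<le> 2 * riemann_zeta \<alpha> * \<gamma> (Suc j)"
    by (intro mult_nonneg_nonneg riemann_zeta_nonneg less_imp_le[OF gamma_pos]) auto
  then show "1 \<le> 1 + 2 * riemann_zeta \<alpha> * \<gamma> (Suc j)" by simp
qed

text \<open>The algorithm reconstructs the coefficients in \<open>F\<close> only; the part of
  \<open>f\<close> outside \<open>F\<close> enters as noise in the samples. The condition on
  \<open>n\<close> involves the trace alone, so \<open>F\<close> can be as large as the noise level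
  demands.\<close>

lemma achieves_std_upper:
  assumes alpha: "\<alpha> > 1" and eps: "\<epsilon> > 0" and n: "6 * wtrace d / \<epsilon>\<^sup>2 \<le> real n"
  shows "achieves \<alpha> \<gamma> d (info_std d) \<epsilon> n"
proof -
  define T where "T = wtrace d"
  have T: "1 \<le> T" unfolding T_def by (rule wtrace_ge_1[OF alpha])
  have n0: "real n > 0" using n T eps by (smt (verit) T_def divide_pos_pos zero_less_power)
  \<comment> \<open>Error budget: truncation costs \<open>\<tau>\<close> and noise
    \<open>3 \<tau>\<close>, together \<open>\<epsilon>^2 / 2\<close>. The other half is
    \<open>3 T / n\<close>, which explains the 6 in the condition on \<open>n\<close>.\<close>
  define \<tau> where "\<tau> = \<epsilon>\<^sup>2 / 8"
  have t0: "\<tau> > 0" using eps by (simp add: \<tau>_def)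
  obtain S where S: "((\<lambda>h. 1 / r d h) has_sum S) (freqs d)"
    using summable_inverse_r[OF alpha] by (auto simp: summable_on_def)
  have 1: "\<forall>\<^sub>F F in finite_subsets_at_top (freqs d). dist (\<Sum>h\<in>F. 1 / r d h) S < \<tau>"
    using S t0 by (auto simp: has_sum_def dest: tendstoD)
  have 2: "\<forall>\<^sub>F F in finite_subsets_at_top (freqs d). finite F \<and> F \<subseteq> freqs d"
    by (rule eventually_finite_subsets_at_top_weakI) auto
  obtain F where F: "finite F" "F \<subseteq> freqs d" "dist (\<Sum>h\<in>F. 1 / r d h) S < \<tau>"
    using eventually_happens'[OF finite_subsets_at_top_neq_bot eventually_conj[OF 1 2]] by auto
  have tail: "(\<Sum>h\<in>G. 1 / r d h) \<le> \<tau>" if G: "finite G" "G \<subseteq> freqs d - F" for G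
  proof -
    have "(\<Sum>h\<in>F \<union> G. 1 / r d h) \<le> S"
      by (rule has_sum_mono2[OF has_sum_finite S]) (use F G in \<open>auto simp: less_imp_le r_pos\<close>)
    moreover have "(\<Sum>h\<in>F \<union> G. 1 / r d h) = (\<Sum>h\<in>F. 1 / r d h) + (\<Sum>h\<in>G. 1 / r d h)"
      by (rule sum.union_disjoint) (use F G in auto)
    ultimately show ?thesis using F(3) by (simp add: dist_real_def)
  qed
  have "\<exists>x A. (\<forall>k<n. x k \<in> cube d) \<and> (\<forall>b y. real n / 3 * sq_norm_on F (\<lambda>i. b i - (\<Sum>k<n. A i k * y k))
    \<le> T * (\<Sum>i\<in>F. r d i * (cmod (b i))\<^sup>2) + (\<Sum>k<n. (cmod (y k - (\<Sum>i\<in>F. cnj (cnj (mexpi d i (x k))) * b i)))\<^sup>2))"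
    by (rule exists_stable_reconstruction[OF F(1) r_pos _ _ exists_point_ge_trace[OF F(1,2)]])
       (use T sum_inverse_r_le[OF alpha F(1,2)] in \<open>auto simp: T_def\<close>)
  then obtain x A where x: "\<And>k. k < n \<Longrightarrow> x k \<in> cube d" and rec: "\<And>b y. real n / 3 * sq_norm_on F (\<lambda>i. b i - (\<Sum>k<n. A i k * y k))
    \<le> T * (\<Sum>i\<in>F. r d i * (cmod (b i))\<^sup>2) + (\<Sum>k<n. (cmod (y k - (\<Sum>i\<in>F. mexpi d i (x k) * b i)))\<^sup>2)"
    by auto
  define a where "a k = mpoly d F (\<lambda>h. A h k)" for k
  define L where "L k = (\<lambda>f::(nat \<Rightarrow> real) \<Rightarrow> complex. f (x k))" for k
  show ?thesis
  proof (rule achievesI[where a = a and L = L])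
    show "a k \<in> L2 d" for k by (simp add: a_def L2_iff sq_integrable_mpoly)
    show "L k \<in> info_std d" if "k < n" for k using x[OF that] by (auto simp: info_std_def L_def)
    show "0 \<le> \<epsilon>" using eps by simp
    fix f assume f: "f \<in> korobov \<alpha> \<gamma> d" and f1: "nsq d f \<le> 1"
    let ?c = "fourier_coeff d f"
    define b where "b h = (\<Sum>k<n. A h k * f (x k))" for h
    have fL: "f \<in> L2 d" using f by (simp add: korobov_def)
    have alg: "alg_apply n a L f z = mpoly d F b z" for z
      unfolding alg_apply_def a_def L_def mpoly_def b_def sum_distrib_left sum_distrib_right
      by (subst sum.swap) (simp add: mult_ac)
    have pt: "(cmod (f z - mpoly d F ?c z))\<^sup>2 \<le> \<tau>" if "z \<in> cube d" for z
    proof -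
      have "(cmod (f z - mpoly d F ?c z))\<^sup>2 \<le> \<tau> * nsq d f"
        by (rule truncation_error_pointwise[OF alpha f that F(1,2) tail])
      also have "\<dots> \<le> \<tau>" using f1 t0 by simp
      finally show ?thesis .
    qed
    have "(L2_norm d (\<lambda>z. f z - mpoly d F ?c z))\<^sup>2 \<le> (LINT z|cube_measure d. \<tau>)"
      unfolding L2_norm_sq
    proof (rule integral_mono)
      show "integrable (cube_measure d) (\<lambda>z. (cmod (f z - mpoly d F ?c z))\<^sup>2)"
        using fL by (intro sq_integrableD(2) sq_integrable_diff sq_integrable_mpoly) (simp add: L2_iff)
      show "integrable (cube_measure d) (\<lambda>z. \<tau>)"
        by (rule finite_measure.integrable_const[OF finite_measure_cube_measure])
    qed (use pt in \<open>simp add: space_cube_measure\<close>)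
    also have "\<dots> = \<tau>" by (simp add: measure_cube_measure)
    finally have e1: "(L2_norm d (\<lambda>z. f z - mpoly d F ?c z))\<^sup>2 \<le> \<tau>" .
    have "real n / 3 * (\<Sum>h\<in>F. (cmod (b h - ?c h))\<^sup>2) = real n / 3 * sq_norm_on F (\<lambda>i. ?c i - (\<Sum>k<n. A i k * f (x k)))"
      by (simp add: sq_norm_on_def b_def norm_minus_commute)
    also have "\<dots> \<le> T * (\<Sum>i\<in>F. r d i * (cmod (?c i))\<^sup>2) + (\<Sum>k<n. (cmod (f (x k) - (\<Sum>i\<in>F. mexpi d i (x k) * ?c i)))\<^sup>2)"
      by (rule rec)
    also have "\<dots> \<le> T * 1 + (\<Sum>k<n. \<tau>)"
    proof (intro add_mono mult_left_mono sum_mono)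
      show "(\<Sum>i\<in>F. r d i * (cmod (?c i))\<^sup>2) \<le> 1"
        using nsq_partial_sum_le[OF f F(1,2)] f1 by linarith
      show "(cmod (f (x k) - (\<Sum>i\<in>F. mexpi d i (x k) * ?c i)))\<^sup>2 \<le> \<tau>" if "k \<in> {..<n}" for k
        using pt[OF x, of k] that by (simp add: mpoly_def mult.commute)
    qed (use T in simp)
    finally have "real n / 3 * (\<Sum>h\<in>F. (cmod (b h - ?c h))\<^sup>2) \<le> T + real n * \<tau>" by simp
    then have "(\<Sum>h\<in>F. (cmod (b h - ?c h))\<^sup>2) \<le> 3 * T / real n + 3 * \<tau>"
      using n0 by (simp add: field_simps)
    moreover have "3 * T / real n \<le> \<epsilon>\<^sup>2 / 2"
      using n n0 eps by (simp add: T_def field_simps)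
    ultimately have "(\<Sum>h\<in>F. (cmod (b h - ?c h))\<^sup>2) \<le> \<epsilon>\<^sup>2 / 2 + 3 * \<tau>" by linarith
    moreover have "(L2_norm d (\<lambda>z. f z - alg_apply n a L f z))\<^sup>2
        = (L2_norm d (\<lambda>z. f z - mpoly d F ?c z))\<^sup>2 + (\<Sum>h\<in>F. (cmod (b h - ?c h))\<^sup>2)"
      unfolding alg by (rule L2_norm_diff_mpoly[OF fL F(1,2)])
    ultimately show "(L2_norm d (\<lambda>z. f z - alg_apply n a L f z))\<^sup>2 \<le> \<epsilon>\<^sup>2"
      using e1 by (simp add: \<tau>_def)
  qed
qed

lemma comp_std_upper:
  assumes alpha: "\<alpha> > 1" and eps: "\<epsilon> \<in> {0<..<1}"
  shows "enat_le_real (comp_wor \<alpha> \<gamma> d (info_std d) \<epsilon>) (7 * wtrace d * \<epsilon> powr (- 2))"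
proof -
  have e: "\<epsilon> powr (- 2) = 1 / \<epsilon>\<^sup>2" using eps by (simp add: powr_minus_divide)
  define n where "n = nat \<lceil>6 * wtrace d / \<epsilon>\<^sup>2\<rceil>"
  \<comment> \<open>Rounding up adds at most 1; this inequality absorbs it and turns the 6 into
    7.\<close>
  have 1: "1 \<le> wtrace d / \<epsilon>\<^sup>2"
  proof -
    have "\<epsilon>\<^sup>2 \<le> 1" using eps by (simp add: power_le_one)
    then show ?thesis using wtrace_ge_1[OF alpha, of d] eps by (simp add: pos_le_divide_eq)
  qed
  have "6 * wtrace d / \<epsilon>\<^sup>2 \<le> real n" unfolding n_def by (rule real_nat_ceiling_ge)
  moreover have "real n \<le> 6 * wtrace d / \<epsilon>\<^sup>2 + 1"
    unfolding n_def using 1 by (simp add: of_nat_nat)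
  moreover have "6 * wtrace d / \<epsilon>\<^sup>2 + 1 \<le> 7 * wtrace d / \<epsilon>\<^sup>2" using 1 by linarith
  ultimately show ?thesis
    unfolding enat_le_real_comp_wor_iff using achieves_std_upper[OF alpha, of \<epsilon> d n] eps
    by (intro exI[of _ n]) (simp add: e)
qed

end

section \<open>Bounds for linear information\<close>

text \<open>The one property of information that the frequency-counting lower bound uses. Point
  evaluations and continuous functionals share it, so one bound serves both classes without
  embedding one in the other.\<close>

definition acts_linearly :: "nat \<Rightarrow> functional \<Rightarrow> bool" where
  "acts_linearly d L \<longleftrightarrow> (\<forall>F c. finite F \<longrightarrow> F \<subseteq> freqs d \<longrightarrow> L (mpoly d F c) = (\<Sum>h\<in>F. c h * L (mexpi d h)))"

lemma info_std_acts_linearly: "L \<in> info_std d \<Longrightarrow> acts_linearly d L"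
  by (auto simp: info_std_def acts_linearly_def mpoly_def)

lemma mexpi_eq_mpoly: "mexpi d h = mpoly d {h} (\<lambda>_. 1)"
  by (simp add: mpoly_def fun_eq_iff)

lemma info_all_acts_linearly:
  assumes L: "L \<in> info_all \<alpha> \<gamma> d"
  shows "acts_linearly d L"
  unfolding acts_linearly_def
proof (intro allI impI)
  fix F c assume "finite F" "F \<subseteq> freqs d"
  have add: "\<And>f g. f \<in> korobov \<alpha> \<gamma> d \<Longrightarrow> g \<in> korobov \<alpha> \<gamma> d \<Longrightarrow> L (\<lambda>x. f x + g x) = L f + L g"
    and cm: "\<And>f c. f \<in> korobov \<alpha> \<gamma> d \<Longrightarrow> L (\<lambda>x. c * f x) = c * L f"
    using L by (auto simp: info_all_def)
  show "L (mpoly d F c) = (\<Sum>h\<in>F. c h * L (mexpi d h))"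
    using \<open>finite F\<close> \<open>F \<subseteq> freqs d\<close>
  proof (induction F rule: finite_induct)
    case empty
    have "mpoly d {} c \<in> korobov \<alpha> \<gamma> d" by (rule korobov_norm_sq_mpoly) auto
    from cm[OF this, of 0] show ?case by (simp add: mpoly_def[abs_def])
  next
    case (insert h F)
    have m: "mexpi d h \<in> korobov \<alpha> \<gamma> d"
      unfolding mexpi_eq_mpoly using insert.prems by (intro korobov_norm_sq_mpoly) auto
    have "(\<lambda>x. c h * mexpi d h x) = mpoly d {h} c" by (simp add: mpoly_def fun_eq_iff)
    then have m': "(\<lambda>x. c h * mexpi d h x) \<in> korobov \<alpha> \<gamma> d"
      using insert.prems korobov_norm_sq_mpoly(1)[of "{h}" d c \<alpha> \<gamma>] by simp
    have "mpoly d (insert h F) c = (\<lambda>x. c h * mexpi d h x + mpoly d F c x)"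
      using insert.hyps by (simp add: mpoly_def fun_eq_iff)
    then have "L (mpoly d (insert h F) c) = L (\<lambda>x. c h * mexpi d h x) + L (mpoly d F c)"
      using add[OF m' korobov_norm_sq_mpoly(1)] insert by simp
    then show ?case using insert cm[OF m] by simp
  qed
qed

lemma sum_PiE_pairs:
  fixes f :: "'i \<Rightarrow> 'b \<Rightarrow> 'c \<Rightarrow> real"
  assumes "finite I" "\<And>i. i \<in> I \<Longrightarrow> finite (A i)" "\<And>i. i \<in> I \<Longrightarrow> finite (B i)"
  shows "(\<Sum>g\<in>PiE I A. \<Sum>g'\<in>PiE I B. \<Prod>i\<in>I. f i (g i) (g' i)) = (\<Prod>i\<in>I. \<Sum>a\<in>A i. \<Sum>b\<in>B i. f i a b)"
proof -
  have "(\<Sum>g'\<in>PiE I B. \<Prod>i\<in>I. f i (g i) (g' i)) = (\<Prod>i\<in>I. \<Sum>b\<in>B i. f i (g i) b)" for g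
    by (rule prod_sum_PiE[symmetric]) (use assms in auto)
  then show ?thesis by (simp add: prod_sum_PiE assms)
qed

text \<open>The multiplicity of \<open>h\<close> among the differences of two 0-1 vectors, weighted by \<open>t\<close>.\<close>
definition diff_weight :: "(nat \<Rightarrow> real) \<Rightarrow> nat \<Rightarrow> int \<Rightarrow> real" where
  "diff_weight t j k = (if k = 0 then 1 + (t j)\<^sup>2 else t j)"

text \<open>Writing the constraint \<open>h = g - g'\<close> as a product of coordinate indicators
  lets the double sum factor. In one coordinate 0 arises as \<open>0 - 0\<close> and
  \<open>1 - 1\<close>, giving \<open>1 + t^2\<close>, while 1 and -1 arise once each, giving
  \<open>t\<close>.\<close>

lemma sum_differences:
  fixes Q :: "(nat \<Rightarrow> int) \<Rightarrow> real" and t :: "nat \<Rightarrow> real" and d :: nat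
  defines "G \<equiv> PiE {..<d} (\<lambda>_. {0,1::int})" and "H \<equiv> PiE {..<d} (\<lambda>_. {-1,0,1::int})"
  defines "\<mu> \<equiv> \<lambda>g. \<Prod>j<d. if g j = 0 then 1 else t j"
  shows "(\<Sum>g\<in>G. \<Sum>g'\<in>G. \<mu> g * \<mu> g' * Q (\<lambda>j\<in>{..<d}. g j - g' j)) = (\<Sum>h\<in>H. (\<Prod>j<d. diff_weight t j (h j)) * Q h)"
proof -
  have finH: "finite H" unfolding H_def by (intro finite_PiE) auto
  let ?w = "\<lambda>j a b k. (if a = 0 then 1 else t j) * (if b = 0 then 1 else t j) * (if a - b = k then 1 else 0) :: real"
  have "\<mu> g * \<mu> g' * Q (\<lambda>j\<in>{..<d}. g j - g' j) = (\<Sum>h\<in>H. (\<Prod>j<d. ?w j (g j) (g' j) (h j)) * Q h)"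
    if g: "g \<in> G" "g' \<in> G" for g g'
  proof -
    let ?D = "\<lambda>j\<in>{..<d}. g j - g' j"
    have D: "?D \<in> H" unfolding H_def
    proof (rule PiE_I)
      fix j assume "j \<in> {..<d}"
      then have "g j \<in> {0,1}" "g' j \<in> {0,1}" using g by (auto simp: G_def)
      then show "?D j \<in> {-1,0,1}" using \<open>j \<in> {..<d}\<close> by auto
    qed auto
    have "(\<Prod>j<d. ?w j (g j) (g' j) (h j)) = (if h = ?D then \<mu> g * \<mu> g' else 0)" if h: "h \<in> H" for h
    proof (cases "h = ?D")
      case True
      then show ?thesis by (simp add: \<mu>_def prod.distrib)
    next
      case False
      then obtain j where "j < d" "h j \<noteq> ?D j"
        using PiE_ext[OF h[unfolded H_def] D[unfolded H_def]] by blast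
      then have "(\<Prod>j<d. ?w j (g j) (g' j) (h j)) = 0"
        by (intro prod_zero bexI[of _ j]) auto
      then show ?thesis using False by simp
    qed
    then have "(\<Sum>h\<in>H. (\<Prod>j<d. ?w j (g j) (g' j) (h j)) * Q h) = (\<Sum>h\<in>H. if h = ?D then \<mu> g * \<mu> g' * Q h else 0)"
      by (intro sum.cong refl) auto
    then show ?thesis using D finH by simp
  qed
  then have "(\<Sum>g\<in>G. \<Sum>g'\<in>G. \<mu> g * \<mu> g' * Q (\<lambda>j\<in>{..<d}. g j - g' j))
      = (\<Sum>g\<in>G. \<Sum>g'\<in>G. \<Sum>h\<in>H. (\<Prod>j<d. ?w j (g j) (g' j) (h j)) * Q h)"
    by (intro sum.cong refl)
  also have "\<dots> = (\<Sum>g\<in>G. \<Sum>h\<in>H. \<Sum>g'\<in>G. (\<Prod>j<d. ?w j (g j) (g' j) (h j)) * Q h)"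
    by (intro sum.cong refl sum.swap)
  also have "\<dots> = (\<Sum>h\<in>H. (\<Sum>g\<in>G. \<Sum>g'\<in>G. \<Prod>j<d. ?w j (g j) (g' j) (h j)) * Q h)"
    by (subst sum.swap) (simp add: sum_distrib_right)
  also have "\<dots> = (\<Sum>h\<in>H. (\<Prod>j<d. diff_weight t j (h j)) * Q h)"
  proof (intro sum.cong refl)
    fix h assume h: "h \<in> H"
    have "(\<Sum>g\<in>G. \<Sum>g'\<in>G. \<Prod>j<d. ?w j (g j) (g' j) (h j)) = (\<Prod>j<d. \<Sum>a\<in>{0,1}. \<Sum>b\<in>{0,1}. ?w j a b (h j))"
      unfolding G_def by (rule sum_PiE_pairs[where f = "\<lambda>j a b. ?w j a b (h j)"]) auto
    also have "\<dots> = (\<Prod>j<d. diff_weight t j (h j))"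
    proof (intro prod.cong refl)
      fix j assume "j \<in> {..<d}"
      then have "h j = -1 \<or> h j = 0 \<or> h j = 1" using h by (auto simp: H_def)
      then show "(\<Sum>a\<in>{0,1}. \<Sum>b\<in>{0,1}. ?w j a b (h j)) = diff_weight t j (h j)"
        by (auto simp: diff_weight_def power2_eq_square)
    qed
    finally show "(\<Sum>g\<in>G. \<Sum>g'\<in>G. \<Prod>j<d. ?w j (g j) (g' j) (h j)) * Q h = (\<Prod>j<d. diff_weight t j (h j)) * Q h" by simp
  qed
  finally show ?thesis .
qed

lemma mexpi_mult_cnj: "mexpi d g x * cnj (mexpi d g' x) = mexpi d (\<lambda>j\<in>{..<d}. g j - g' j) x"
proof -
  have "mexpi d g x * cnj (mexpi d g' x) = cnj (mexpi d g' x) * mexpi d g x" by (rule mult.commute)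
  also have "\<dots> = mexpi d (\<lambda>j\<in>{..<d}. g j - g' j) x"
    unfolding cnj_mexpi_mult by (simp add: mexpi_def)
  finally show ?thesis .
qed

context korobov_setting
begin

text \<open>With more frequencies than functionals, some nonzero polynomial over \<open>F\<close>
  has zero information, and the algorithm returns 0 for it. Scaled to Korobov norm 1 it has
  \<open>L2\<close> norm above \<epsilon>, because its weights are all below
  \<open>1 / \<epsilon>^2\<close>.\<close>

lemma achieves_imp_card_le:
  assumes ach: "achieves \<alpha> \<gamma> d \<Lambda> \<epsilon> n" and lin: "\<And>L. L \<in> \<Lambda> \<Longrightarrow> acts_linearly d L"
    and eps: "\<epsilon> > 0" and F: "finite F" "F \<subseteq> freqs d" "\<And>h. h \<in> F \<Longrightarrow> r d h < 1 / \<epsilon>\<^sup>2"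
  shows "card F \<le> n"
proof (rule ccontr)
  assume "\<not> card F \<le> n"
  then have n: "n < card F" by simp
  obtain a L where L: "\<And>k. k < n \<Longrightarrow> L k \<in> \<Lambda>" and
    err: "\<And>f. f \<in> korobov \<alpha> \<gamma> d \<Longrightarrow> nsq d f \<le> 1 \<Longrightarrow> L2_norm d (\<lambda>x. f x - alg_apply n a L f x) \<le> \<epsilon>"
    using achievesD[OF ach] by metis
  obtain c where c: "\<exists>h\<in>F. c h \<noteq> 0" "\<And>k. k < n \<Longrightarrow> (\<Sum>h\<in>F. L k (mexpi d h) * c h) = 0"
    using homogeneous_system_nontrivial[OF F(1) n, of "\<lambda>k h. L k (mexpi d h)"] by auto
  define N where "N = (\<Sum>h\<in>F. r d h * (cmod (c h))\<^sup>2)"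
  have N: "N > 0" unfolding N_def using c(1) r_pos by (auto intro!: sum_pos2[OF F(1)] simp: less_imp_le)
  define e where "e h = c h / of_real (sqrt N)" for h
  have ce: "(cmod (e h))\<^sup>2 = (cmod (c h))\<^sup>2 / N" for h
    using N by (simp add: e_def norm_divide power_divide)
  define f where "f = mpoly d F e"
  have fK: "f \<in> korobov \<alpha> \<gamma> d" unfolding f_def by (rule korobov_norm_sq_mpoly[OF F(1,2)])
  have nf: "(\<Sum>h\<in>F. r d h * (cmod (e h))\<^sup>2) = 1"
    using N by (simp add: ce N_def sum_divide_distrib[symmetric])
  then have f1: "nsq d f = 1" unfolding f_def by (simp add: korobov_norm_sq_mpoly[OF F(1,2)])
  have "L k f = 0" if k: "k < n" for k
  proof -
    have "L k f = (\<Sum>h\<in>F. e h * L k (mexpi d h))"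
      using lin[OF L[OF k]] F by (simp add: acts_linearly_def f_def)
    also have "\<dots> = (\<Sum>h\<in>F. L k (mexpi d h) * c h) / of_real (sqrt N)"
      by (simp add: e_def sum_divide_distrib mult.commute)
    finally show ?thesis using c(2)[OF k] by simp
  qed
  then have "(\<lambda>x. f x - alg_apply n a L f x) = f" by (simp add: alg_apply_def)
  then have "L2_norm d f \<le> \<epsilon>" using err[OF fK] f1 by simp
  then have "(L2_norm d f)\<^sup>2 \<le> \<epsilon>\<^sup>2" using L2_norm_nonneg by (intro power_mono) auto
  then have "(\<Sum>h\<in>F. (cmod (e h))\<^sup>2) \<le> \<epsilon>\<^sup>2" unfolding f_def by (simp add: L2_norm_mpoly[OF F(1,2)])
  moreover have "(\<Sum>h\<in>F. \<epsilon>\<^sup>2 * (r d h * (cmod (e h))\<^sup>2)) < (\<Sum>h\<in>F. (cmod (e h))\<^sup>2)"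
  proof (rule sum_strict_mono_ex1[OF F(1)])
    have 1: "\<epsilon>\<^sup>2 * r d h < 1" if "h \<in> F" for h
      using F(3)[OF that] eps by (simp add: field_simps)
    show "\<forall>h\<in>F. \<epsilon>\<^sup>2 * (r d h * (cmod (e h))\<^sup>2) \<le> (cmod (e h))\<^sup>2"
      using mult_right_mono[OF less_imp_le[OF 1], of _ "(cmod (e _))\<^sup>2"] by (simp add: mult.assoc)
    obtain h where h: "h \<in> F" "c h \<noteq> 0" using c(1) by blast
    then have "0 < (cmod (e h))\<^sup>2" using N by (simp add: e_def)
    from mult_strict_right_mono[OF 1[OF h(1)] this]
    show "\<exists>h\<in>F. \<epsilon>\<^sup>2 * (r d h * (cmod (e h))\<^sup>2) < (cmod (e h))\<^sup>2"
      using h by (intro bexI[of _ h]) (simp_all add: mult.assoc)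
  qed
  moreover have "(\<Sum>h\<in>F. \<epsilon>\<^sup>2 * (r d h * (cmod (e h))\<^sup>2)) = \<epsilon>\<^sup>2"
    using nf by (simp add: sum_distrib_left[symmetric])
  ultimately show False by simp
qed

lemma fourier_coeff_in_info_all:
  assumes h: "h \<in> freqs d"
  shows "(\<lambda>f. fourier_coeff d f h) \<in> info_all \<alpha> \<gamma> d"
  unfolding info_all_def
proof (intro CollectI conjI ballI allI)
  fix f g assume "f \<in> korobov \<alpha> \<gamma> d" "g \<in> korobov \<alpha> \<gamma> d"
  then show "fourier_coeff d (\<lambda>x. f x + g x) h = fourier_coeff d f h + fourier_coeff d g h"
    unfolding fourier_coeff_eq_coeff by (intro cube.coeff_add) (auto simp: korobov_def L2_iff)
next
  fix f and c :: complex assume "f \<in> korobov \<alpha> \<gamma> d"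
  show "fourier_coeff d (\<lambda>x. c * f x) h = c * fourier_coeff d f h"
    unfolding fourier_coeff_eq_coeff by (rule cube.coeff_cmult)
next
  have "cmod (fourier_coeff d f h) \<le> sqrt (1 / r d h) * sqrt (nsq d f)" if "f \<in> korobov \<alpha> \<gamma> d" for f
  proof -
    have "r d h * (cmod (fourier_coeff d f h))\<^sup>2 \<le> nsq d f"
      using nsq_partial_sum_le[OF that, of "{h}"] h by simp
    then have "(cmod (fourier_coeff d f h))\<^sup>2 \<le> 1 / r d h * nsq d f"
      using r_pos[of d h] by (simp add: pos_le_divide_eq mult.commute)
    then show ?thesis unfolding real_sqrt_mult[symmetric] by (rule real_le_rsqrt)
  qed
  then show "\<exists>C. \<forall>f\<in>korobov \<alpha> \<gamma> d. cmod (fourier_coeff d f h) \<le> C * sqrt (nsq d f)" by blast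
qed

lemma achieves_all_upper:
  assumes eps: "\<epsilon> > 0" and fin: "finite {h \<in> freqs d. r d h < 1 / \<epsilon>\<^sup>2}" (is "finite ?S")
  shows "achieves \<alpha> \<gamma> d (info_all \<alpha> \<gamma> d) \<epsilon> (card {h \<in> freqs d. r d h < 1 / \<epsilon>\<^sup>2})"
proof -
  obtain \<phi> where phi: "bij_betw \<phi> {..<card ?S} ?S"
    using ex_bij_betw_nat_finite[OF fin] by (auto simp: lessThan_atLeast0)
  have S: "?S \<subseteq> freqs d" by auto
  define a where "a k = mexpi d (\<phi> k)" for k
  define L where "L k = (\<lambda>f. fourier_coeff d f (\<phi> k))" for k
  show ?thesis
  proof (rule achievesI[where a = a and L = L])
    show "a k \<in> L2 d" for k by (simp add: a_def L2_iff cube.sq_integrable_phi)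
    show "L k \<in> info_all \<alpha> \<gamma> d" if "k < card ?S" for k
      unfolding L_def by (rule fourier_coeff_in_info_all) (use bij_betwE[OF phi] that in auto)
    show "0 \<le> \<epsilon>" using eps by simp
    fix f assume f: "f \<in> korobov \<alpha> \<gamma> d" and f1: "nsq d f \<le> 1"
    have fL: "f \<in> L2 d" using f by (simp add: korobov_def)
    have alg: "alg_apply (card ?S) a L f z = mpoly d ?S (fourier_coeff d f) z" for z
      unfolding alg_apply_def a_def L_def mpoly_def by (rule sum.reindex_bij_betw[OF phi])
    show "(L2_norm d (\<lambda>z. f z - alg_apply (card ?S) a L f z))\<^sup>2 \<le> \<epsilon>\<^sup>2"
      unfolding alg
    proof (rule has_sum_le_finite_sums[OF L2_norm_truncation[OF fL fin S]])
      fix G assume G: "finite G" "G \<subseteq> freqs d - ?S"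
      have "(\<Sum>h\<in>G. (cmod (fourier_coeff d f h))\<^sup>2) \<le> (\<Sum>h\<in>G. \<epsilon>\<^sup>2 * (r d h * (cmod (fourier_coeff d f h))\<^sup>2))"
      proof (rule sum_mono)
        fix h assume "h \<in> G"
        then have "1 / \<epsilon>\<^sup>2 \<le> r d h" using G by auto
        then have "1 \<le> \<epsilon>\<^sup>2 * r d h" using eps by (simp add: pos_divide_le_eq mult.commute)
        from mult_right_mono[OF this, of "(cmod (fourier_coeff d f h))\<^sup>2"]
        show "(cmod (fourier_coeff d f h))\<^sup>2 \<le> \<epsilon>\<^sup>2 * (r d h * (cmod (fourier_coeff d f h))\<^sup>2)"
          by (simp add: mult.assoc)
      qed
      also have "\<dots> = \<epsilon>\<^sup>2 * (\<Sum>h\<in>G. r d h * (cmod (fourier_coeff d f h))\<^sup>2)" by (rule sum_distrib_left[symmetric])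
      also have "\<dots> \<le> \<epsilon>\<^sup>2 * 1"
      proof (rule mult_left_mono)
        have "(\<Sum>h\<in>G. r d h * (cmod (fourier_coeff d f h))\<^sup>2) \<le> nsq d f"
          using G by (intro nsq_partial_sum_le f) auto
        then show "(\<Sum>h\<in>G. r d h * (cmod (fourier_coeff d f h))\<^sup>2) \<le> 1" using f1 by simp
      qed simp
      finally show "(\<Sum>h\<in>G. (cmod (fourier_coeff d f h))\<^sup>2) \<le> \<epsilon>\<^sup>2" by simp
    qed
  qed
qed

lemma comp_all_upper:
  assumes alpha: "\<alpha> > 0" and s: "\<alpha> * s > 1" and eps: "\<epsilon> \<in> {0<..<1}"
  shows "enat_le_real (comp_wor \<alpha> \<gamma> d (info_all \<alpha> \<gamma> d) \<epsilon>)
    ((\<Prod>j<d. 1 + 2 * riemann_zeta (\<alpha> * s) * \<gamma> (Suc j) powr s) * \<epsilon> powr (- (2 * s)))"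
    (is "enat_le_real _ (?P * _)")
proof -
  let ?S = "{h \<in> freqs d. r d h < 1 / \<epsilon>\<^sup>2}"
  have s0: "s > 0" using alpha s by (smt (verit) mult_nonneg_nonpos)
  have card: "real (card F) \<le> ?P * \<epsilon> powr (- (2 * s))" if F: "F \<subseteq> ?S" "finite F" for F
  proof -
    have "real (card F) * \<epsilon> powr (2 * s) = (\<Sum>h\<in>F. \<epsilon> powr (2 * s))" by simp
    also have "\<dots> \<le> (\<Sum>h\<in>F. (1 / r d h) powr s)"
    proof (rule sum_mono)
      fix h assume "h \<in> F"
      then have "\<epsilon>\<^sup>2 \<le> 1 / r d h" using F eps r_pos[of d h] by (auto simp: field_simps)
      then have "(\<epsilon>\<^sup>2) powr s \<le> (1 / r d h) powr s" using s0 by (intro powr_mono2) auto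
      moreover have "(\<epsilon>\<^sup>2) powr s = \<epsilon> powr (2 * s)"
        using eps by (simp add: powr_powr flip: powr_numeral)
      ultimately show "\<epsilon> powr (2 * s) \<le> (1 / r d h) powr s" by simp
    qed
    also have "\<dots> \<le> ?P" by (rule sum_inverse_r_powr_le[OF alpha s]) (use F in auto)
    finally show ?thesis using eps by (simp add: powr_minus field_simps)
  qed
  \<comment> \<open>Finiteness of the set comes from the same estimate: its finite subsets have
    uniformly bounded size.\<close>
  have "finite ?S \<and> card ?S \<le> nat \<lfloor>?P * \<epsilon> powr (- (2 * s))\<rfloor>"
  proof (rule finite_if_finite_subsets_card_bdd)
    fix F assume "F \<subseteq> ?S" "finite F"
    from card[OF this] show "card F \<le> nat \<lfloor>?P * \<epsilon> powr (- (2 * s))\<rfloor>" by (rule le_nat_floor)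
  qed
  then have fin: "finite ?S" by simp
  show ?thesis unfolding enat_le_real_comp_wor_iff
    using achieves_all_upper[OF _ fin] card[OF subset_refl fin] eps by auto
qed

end

section \<open>Lower bound for function values\<close>

text \<open>At frequency zero the coefficient is the integral, so an approximation algorithm yields
  a quadrature rule with no larger error. This passes the lower bound from integration to
  approximation.\<close>

lemma norm_fourier_coeff_le_L2_norm:
  assumes "u \<in> L2 d" "h \<in> freqs d"
  shows "cmod (fourier_coeff d u h) \<le> L2_norm d u"
proof (rule power2_le_imp_le)
  show "(cmod (fourier_coeff d u h))\<^sup>2 \<le> (L2_norm d u)\<^sup>2"
    using cube.bessel[of d u "{h}"] assms by (simp add: L2_iff L2_norm_sq fourier_coeff_eq_coeff)
qed (rule L2_norm_nonneg)

context korobov_setting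
begin

text \<open>The kernel \<open>\<Sum>h. \<lambda>\<^sub>h mexpi d h (x - y)\<close> below is the squared modulus of
  \<open>\<Prod>j<d. 1 + \<gamma>\<^sub>j\<^sub>+\<^sub>1 expi 1 (x j - y j)\<close>, divided by its mean.  It is dominated by the reproducing kernel,
  and being a square it obeys a rank bound with \<open>n\<close> nodes (Vybiral's argument).\<close>
lemma achieves_std_lower:
  assumes alpha: "\<alpha> > 0" and eps: "0 < \<epsilon>" "\<epsilon> < 1" and ach: "achieves \<alpha> \<gamma> d (info_std d) \<epsilon> n"
  shows "(1 - \<epsilon>\<^sup>2) * (\<Prod>j<d. 1 + \<gamma> (Suc j)) \<le> real n"
proof -
  obtain a L where aL: "\<And>k. k < n \<Longrightarrow> a k \<in> L2 d" and Ls: "\<And>k. k < n \<Longrightarrow> L k \<in> info_std d" and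
    err: "\<And>f. f \<in> korobov \<alpha> \<gamma> d \<Longrightarrow> nsq d f \<le> 1 \<Longrightarrow> L2_norm d (\<lambda>x. f x - alg_apply n a L f x) \<le> \<epsilon>"
    using achievesD[OF ach] by metis
  have "\<exists>y. \<forall>k<n. L k = (\<lambda>f. f (y k))" using Ls by (intro choice) (auto simp: info_std_def)
  then obtain y where y: "\<And>k. k < n \<Longrightarrow> L k = (\<lambda>f. f (y k))" by blast
  define z where "z = (\<lambda>j\<in>{..<d}. 0 :: int)"
  have z: "z \<in> freqs d" by (simp add: z_def freqs_def)
  \<comment> \<open>Integrating the algorithm gives a quadrature rule with weights
    \<open>b k\<close> at the nodes \<open>y k\<close>; \<open>B h\<close> is its value at the
    exponential of frequency \<open>h\<close>.\<close>
  define b where "b k = fourier_coeff d (a k) z" for k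
  define B where "B h = (\<Sum>k<n. b k * mexpi d h (y k))" for h
  define t where "t j = \<gamma> (Suc j)" for j
  have t: "0 < t j" "t j \<le> 1" for j using gamma_pos gamma_le_1 by (auto simp: t_def)
  define G where "G = PiE {..<d} (\<lambda>_. {0,1::int})"
  define H where "H = PiE {..<d} (\<lambda>_. {-1,0,1::int})"
  have finG: "finite G" and finH: "finite H" unfolding G_def H_def by (auto intro!: finite_PiE)
  have Hf: "H \<subseteq> freqs d" by (auto simp: H_def freqs_def PiE_def)
  have zH: "z \<in> H" by (auto simp: z_def H_def)
  define \<mu> where "\<mu> = (\<lambda>g::nat \<Rightarrow> int. \<Prod>j<d. if g j = 0 then 1 else t j)"
  have mu0: "0 \<le> \<mu> g" for g unfolding \<mu>_def using t by (intro prod_nonneg) (auto simp: less_imp_le)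
  \<comment> \<open>\<open>Z\<close> is the kernel coefficient at frequency zero before
    normalization, and \<open>S\<close> will be the common squared norm of the vectors
    \<open>v k\<close>.\<close>
  define Z where "Z = (\<Prod>j<d. 1 + (t j)\<^sup>2)"
  define S where "S = (\<Prod>j<d. 1 + t j)"
  have Z0: "Z > 0" unfolding Z_def by (intro prod_pos) (simp add: add_pos_nonneg)
  have S0: "S > 0" unfolding S_def by (intro prod_pos) (simp add: add_pos_pos t)
  define l where "l h = (\<Prod>j<d. diff_weight t j (h j)) / Z" for h
  have lalt: "l h = (\<Prod>j<d. diff_weight t j (h j) / (1 + (t j)\<^sup>2))" for h
    by (simp add: l_def Z_def prod_dividef)
  have l0: "0 \<le> l h" for h
    unfolding lalt using t by (intro prod_nonneg) (auto simp: diff_weight_def less_imp_le)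
  have lz: "l z = 1"
  proof -
    have "1 + (t j)\<^sup>2 \<noteq> 0" for j using zero_le_power2[of "t j"] by linarith
    then show ?thesis unfolding lalt by (intro prod.neutral) (simp add: diff_weight_def z_def)
  qed
  \<comment> \<open>Domination by the reproducing kernel, coordinate by coordinate: at the
    frequencies -1 and 1 the factor of \<open>r\<close> is \<open>1 / t\<close>, and
    \<open>t / (1 + t^2) <= t\<close>.\<close>
  have lr: "r d h * l h \<le> 1" if "h \<in> H" for h
  proof -
    have "r d h * l h = (\<Prod>j<d. (if h j = 0 then 1 else \<gamma> (Suc j) powr (- 1) * \<bar>real_of_int (h j)\<bar> powr \<alpha>) *
        (diff_weight t j (h j) / (1 + (t j)\<^sup>2)))"
      unfolding lalt r_weight_def prod.distrib using alpha by simp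
    also have "\<dots> \<le> 1"
    proof (intro prod_le_1 conjI)
      fix j assume "j \<in> {..<d}"
      then have "h j \<in> {-1,0,1}" using that by (auto simp: H_def)
      then have abs: "h j \<noteq> 0 \<Longrightarrow> \<bar>real_of_int (h j)\<bar> = 1" by auto
      have p: "0 < 1 + (t j)\<^sup>2" by (simp add: add_pos_nonneg)
      show "0 \<le> (if h j = 0 then 1 else \<gamma> (Suc j) powr (- 1) * \<bar>real_of_int (h j)\<bar> powr \<alpha>) *
        (diff_weight t j (h j) / (1 + (t j)\<^sup>2))"
        using t[of j] p by (auto simp: diff_weight_def less_imp_le)
      show "(if h j = 0 then 1 else \<gamma> (Suc j) powr (- 1) * \<bar>real_of_int (h j)\<bar> powr \<alpha>) *
        (diff_weight t j (h j) / (1 + (t j)\<^sup>2)) \<le> 1"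
        using t[of j] p abs by (auto simp: diff_weight_def powr_minus t_def[symmetric] divide_simps)
    qed
    finally show ?thesis .
  qed
  \<comment> \<open>\<open>E h\<close> is the integration error at the exponential of frequency
    \<open>h\<close>, and \<open>q\<close> the squared worst-case error in the space with kernel
    coefficients \<open>l\<close>.\<close>
  define E where "E h = (if h = z then 1 else 0) - B h" for h
  define q where "q = (\<Sum>h\<in>H. l h * (cmod (E h))\<^sup>2)"
  have q0: "0 \<le> q" unfolding q_def by (intro sum_nonneg mult_nonneg_nonneg l0) auto
  have q_le: "q \<le> \<epsilon>\<^sup>2"
  proof (cases "q = 0")
    case False
    then have qp: "q > 0" using q0 by simp
    \<comment> \<open>The extremal function of that space: the representer of the error functional,
      scaled to norm 1. Its integration error is \<open>sqrt q\<close>.\<close>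
    define c where "c h = of_real (l h / sqrt q) * cnj (E h)" for h
    define f where "f = mpoly d H c"
    have fK: "f \<in> korobov \<alpha> \<gamma> d" unfolding f_def by (rule korobov_norm_sq_mpoly[OF finH Hf])
    have "nsq d f = (\<Sum>h\<in>H. r d h * (cmod (c h))\<^sup>2)" unfolding f_def by (rule korobov_norm_sq_mpoly[OF finH Hf])
    also have "\<dots> = (\<Sum>h\<in>H. (r d h * l h) * (l h * (cmod (E h))\<^sup>2) / q)"
      using qp by (intro sum.cong refl) (simp add: c_def norm_mult power_mult_distrib power_divide power2_eq_square[of "l _"] norm_divide l0)
    also have "\<dots> \<le> (\<Sum>h\<in>H. 1 * (l h * (cmod (E h))\<^sup>2) / q)"
      using qp by (intro sum_mono divide_right_mono mult_right_mono lr) (auto intro!: mult_nonneg_nonneg l0)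
    also have "\<dots> = 1" using qp by (simp add: sum_divide_distrib[symmetric] q_def[symmetric])
    finally have "nsq d f \<le> 1" .
    note e = err[OF fK this]
    have alg: "alg_apply n a L f x = (\<Sum>k<n. f (y k) * a k x)" for x
      unfolding alg_apply_def by (intro sum.cong refl) (simp add: y)
    have aS: "sq_integrable (cube_measure d) (\<lambda>x. \<Sum>k<n. f (y k) * a k x)"
      using aL by (intro sq_integrable_sum sq_integrable_cmult) (auto simp: L2_iff)
    have fS: "sq_integrable (cube_measure d) f" unfolding f_def by (rule sq_integrable_mpoly)
    have csum: "fourier_coeff d (\<lambda>x. \<Sum>k<m. f (y k) * a k x) z = (\<Sum>k<m. f (y k) * b k)" if "m \<le> n" for m
      using that
    proof (induction m)
      case 0
      then show ?case by (simp add: fourier_coeff_eq_coeff cube.coeff_def)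
    next
      case (Suc m)
      have "sq_integrable (cube_measure d) (\<lambda>x. \<Sum>k<m. f (y k) * a k x)"
        using Suc.prems by (intro sq_integrable_sum sq_integrable_cmult) (simp add: aL L2_iff[symmetric])
      moreover have "sq_integrable (cube_measure d) (\<lambda>x. f (y m) * a m x)"
        using Suc.prems by (intro sq_integrable_cmult) (simp add: aL L2_iff[symmetric])
      ultimately show ?case
        using Suc by (simp add: fourier_coeff_eq_coeff cube.coeff_add cube.coeff_cmult b_def)
    qed
    have "fourier_coeff d (\<lambda>x. f x - alg_apply n a L f x) z = fourier_coeff d f z - (\<Sum>k<n. f (y k) * b k)"
      using csum[of n] unfolding alg fourier_coeff_eq_coeff by (simp add: cube.coeff_diff[OF fS aS])
    also have "fourier_coeff d f z = c z" unfolding f_def using fourier_coeff_mpoly[OF finH Hf z] zH by simp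
    also have "(\<Sum>k<n. f (y k) * b k) = (\<Sum>h\<in>H. c h * B h)"
      unfolding f_def mpoly_def B_def sum_distrib_left sum_distrib_right
      by (subst sum.swap) (simp add: mult_ac)
    also have "c z = (\<Sum>h\<in>H. c h * (if h = z then 1 else 0))" using finH zH by (simp add: mult_delta_right)
    also have "(\<Sum>h\<in>H. c h * (if h = z then 1 else 0)) - (\<Sum>h\<in>H. c h * B h) = (\<Sum>h\<in>H. c h * E h)"
      unfolding E_def by (simp add: right_diff_distrib sum_subtractf)
    also have "\<dots> = (\<Sum>h\<in>H. of_real (l h * (cmod (E h))\<^sup>2 / sqrt q))"
      by (intro sum.cong refl) (simp add: c_def complex_norm_square[symmetric] mult.commute mult.left_commute del: of_real_power)
    also have "\<dots> = of_real (q / sqrt q)" by (simp add: q_def sum_divide_distrib)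
    also have "q / sqrt q = sqrt q" using qp by (simp add: real_div_sqrt)
    finally have "cmod (of_real (sqrt q)) \<le> L2_norm d (\<lambda>x. f x - alg_apply n a L f x)"
      using norm_fourier_coeff_le_L2_norm[OF _ z, of "\<lambda>x. f x - alg_apply n a L f x"]
        sq_integrable_diff[OF fS aS] by (simp add: L2_iff alg del: norm_of_real)
    then have "sqrt q \<le> \<epsilon>" using e q0 by simp
    then have "(sqrt q)\<^sup>2 \<le> \<epsilon>\<^sup>2" using q0 by (intro power_mono) auto
    then show ?thesis using q0 by simp
  qed (use eps in simp)
  have "q = (\<Sum>h\<in>H. l h * (cmod (B h))\<^sup>2 + (if h = z then 1 - 2 * Re (B z) else 0))"
    unfolding q_def
  proof (intro sum.cong refl)
    fix h
    show "l h * (cmod (E h))\<^sup>2 = l h * (cmod (B h))\<^sup>2 + (if h = z then 1 - 2 * Re (B z) else 0)"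
      unfolding E_def cmod_power2 using lz by (auto simp: power2_eq_square algebra_simps)
  qed
  also have "\<dots> = (\<Sum>h\<in>H. l h * (cmod (B h))\<^sup>2) + (1 - 2 * Re (B z))"
    using finH zH by (simp add: sum.distrib)
  finally have q: "q = (\<Sum>h\<in>H. l h * (cmod (B h))\<^sup>2) + (1 - 2 * Re (B z))" .
  \<comment> \<open>Up to \<open>sqrt (\<mu> g * \<mu> g')\<close>, the matrix built from the
    \<open>b k\<close> and \<open>v k\<close> has the entries \<open>B (g - g')\<close>. Its trace
    is \<open>S * B z\<close>, and its squared Frobenius norm is \<open>Z\<close> times the
    \<open>l\<close>-weighted sum of \<open>|B h|^2\<close>.\<close>
  define v where "v k g = of_real (sqrt (\<mu> g)) * mexpi d g (y k)" for k g
  have vn: "(\<Sum>g\<in>G. (cmod (v k g))\<^sup>2) = S" for k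
  proof -
    have "(\<Sum>g\<in>G. (cmod (v k g))\<^sup>2) = (\<Sum>g\<in>G. \<mu> g)" by (simp add: v_def norm_mult mu0)
    also have "\<dots> = (\<Prod>j<d. \<Sum>i\<in>{0,1::int}. if i = 0 then 1 else t j)"
      unfolding G_def \<mu>_def by (rule prod_sum_PiE[symmetric]) auto
    finally show ?thesis by (simp add: S_def)
  qed
  have vv: "(cmod (\<Sum>k<n. b k * (v k g * cnj (v k g'))))\<^sup>2 = \<mu> g * \<mu> g' * (cmod (B (\<lambda>j\<in>{..<d}. g j - g' j)))\<^sup>2" for g g'
  proof -
    have "(\<Sum>k<n. b k * (v k g * cnj (v k g'))) = of_real (sqrt (\<mu> g) * sqrt (\<mu> g')) * B (\<lambda>j\<in>{..<d}. g j - g' j)"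
      unfolding B_def sum_distrib_left mexpi_mult_cnj[symmetric]
      by (intro sum.cong refl) (simp add: v_def mult_ac)
    then show ?thesis by (simp add: norm_mult power_mult_distrib mu0)
  qed
  have Bo: "B z = (\<Sum>k<n. b k)" unfolding B_def by (intro sum.cong refl) (simp add: mexpi_def z_def)
  have "(cmod (\<Sum>k<n. b k * of_real (\<Sum>g\<in>G. (cmod (v k g))\<^sup>2)))\<^sup>2
      \<le> real n * (\<Sum>g\<in>G. \<Sum>g'\<in>G. (cmod (\<Sum>k<n. b k * (v k g * cnj (v k g'))))\<^sup>2)"
    by (rule rank_trace_bound[OF finG])
  also have "(\<Sum>g\<in>G. \<Sum>g'\<in>G. (cmod (\<Sum>k<n. b k * (v k g * cnj (v k g'))))\<^sup>2)
      = (\<Sum>h\<in>H. (\<Prod>j<d. diff_weight t j (h j)) * (cmod (B h))\<^sup>2)"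
    unfolding vv G_def H_def \<mu>_def by (rule sum_differences)
  also have "\<dots> = Z * (\<Sum>h\<in>H. l h * (cmod (B h))\<^sup>2)"
    using Z0 by (simp add: l_def sum_distrib_left)
  also have "(\<Sum>k<n. b k * of_real (\<Sum>g\<in>G. (cmod (v k g))\<^sup>2)) = B z * of_real S"
    unfolding vn Bo sum_distrib_right ..
  finally have rank: "(cmod (B z))\<^sup>2 * S\<^sup>2 \<le> real n * (Z * (\<Sum>h\<in>H. l h * (cmod (B h))\<^sup>2))"
    using S0 by (simp add: norm_mult power_mult_distrib)
  \<comment> \<open>Two relations remain: \<open>\<beta>^2 S^2 <= n Z W\<close> and
    \<open>W <= \<epsilon>^2 - 1 + 2 \<beta>\<close>. The unknown \<open>\<beta>\<close> is
    eliminated through \<open>(\<beta> S^2 - p)^2 >= 0\<close> with \<open>p = n Z\<close>.\<close>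
  define \<beta> where "\<beta> = cmod (B z)"
  define W where "W = (\<Sum>h\<in>H. l h * (cmod (B h))\<^sup>2)"
  have "Re (B z) \<le> \<beta>" unfolding \<beta>_def by (rule complex_Re_le_cmod)
  then have W: "W \<le> \<epsilon>\<^sup>2 - 1 + 2 * \<beta>" using q q_le by (simp add: W_def)
  have "S\<^sup>2 * (1 - \<epsilon>\<^sup>2) \<le> real n * Z"
  proof -
    have rk: "\<beta>\<^sup>2 * S\<^sup>2 \<le> real n * Z * W" using rank by (simp add: \<beta>_def W_def mult.assoc)
    define p where "p = real n * Z"
    have p0: "0 \<le> p" using Z0 by (simp add: p_def)
    have "p * W \<le> p * (\<epsilon>\<^sup>2 - 1 + 2 * \<beta>)" using W p0 by (rule mult_left_mono)
    then have *: "\<beta>\<^sup>2 * S\<^sup>2 \<le> p * (\<epsilon>\<^sup>2 - 1 + 2 * \<beta>)" using rk by (simp add: p_def)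
    have "0 \<le> (\<beta> * S\<^sup>2 - p)\<^sup>2" by simp
    also have "\<dots> = S\<^sup>2 * (\<beta>\<^sup>2 * S\<^sup>2) - 2 * \<beta> * S\<^sup>2 * p + p\<^sup>2" by (simp add: power2_eq_square algebra_simps)
    also have "\<dots> \<le> S\<^sup>2 * (p * (\<epsilon>\<^sup>2 - 1 + 2 * \<beta>)) - 2 * \<beta> * S\<^sup>2 * p + p\<^sup>2"
      using mult_left_mono[OF *, of "S\<^sup>2"] by simp
    also have "\<dots> = p * (p - S\<^sup>2 * (1 - \<epsilon>\<^sup>2))" by (simp add: power2_eq_square algebra_simps)
    finally have 2: "0 \<le> p * (p - S\<^sup>2 * (1 - \<epsilon>\<^sup>2))" .
    \<comment> \<open>If \<open>p\<close> vanished, so would \<open>\<beta>\<close>, leaving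
      \<open>W <= \<epsilon>^2 - 1 < 0\<close>.\<close>
    have "p \<noteq> 0"
    proof
      assume "p = 0"
      then have "\<beta>\<^sup>2 * S\<^sup>2 \<le> 0" using * by simp
      moreover have "0 \<le> \<beta>\<^sup>2 * S\<^sup>2" by simp
      ultimately have "\<beta>\<^sup>2 * S\<^sup>2 = 0" by linarith
      then have "\<beta> = 0" using S0 by simp
      moreover have "0 \<le> W" unfolding W_def by (intro sum_nonneg mult_nonneg_nonneg l0) auto
      moreover have "\<epsilon>\<^sup>2 < 1" using eps by (simp add: power_less_one_iff)
      ultimately show False using W by simp
    qed
    then have "p > 0" using p0 by simp
    then show ?thesis using 2 by (simp add: zero_le_mult_iff p_def)
  qed
  moreover have "S * Z \<le> S\<^sup>2"
  proof -
    have "Z \<le> S" unfolding Z_def S_def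
      using t by (intro prod_mono) (auto simp: power2_eq_square mult_left_le less_imp_le)
    then show ?thesis using S0 by (simp add: power2_eq_square)
  qed
  moreover have "0 \<le> 1 - \<epsilon>\<^sup>2" using eps by (simp add: power_le_one)
  ultimately have "S * Z * (1 - \<epsilon>\<^sup>2) \<le> real n * Z" by (meson mult_right_mono order.trans)
  then have "Z * (S * (1 - \<epsilon>\<^sup>2)) \<le> Z * real n" by (simp add: mult_ac)
  then have "S * (1 - \<epsilon>\<^sup>2) \<le> real n" using Z0 by simp
  then show ?thesis by (simp add: S_def t_def mult.commute)
qed

end

section \<open>Tractability\<close>

lemma restrict_in_freqs: "(\<lambda>j\<in>{..<d}. f j) \<in> freqs d"
  by (simp add: freqs_def)

lemma sum_le_prod_one_plus:
  fixes f :: "nat \<Rightarrow> real"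
  assumes "\<And>j. 0 \<le> f j"
  shows "(\<Sum>j<d. f j) + 1 \<le> (\<Prod>j<d. 1 + f j)"
proof (induction d)
  case (Suc d)
  have "0 \<le> (\<Sum>j<d. f j)" by (intro sum_nonneg assms)
  then have "(\<Sum>j<Suc d. f j) + 1 \<le> ((\<Sum>j<d. f j) + 1) * (1 + f d)"
    using assms[of d] by (simp add: algebra_simps)
  also have "\<dots> \<le> (\<Prod>j<d. 1 + f j) * (1 + f d)" using Suc assms[of d] by (intro mult_right_mono) auto
  finally show ?case by simp
qed simp

lemma prod_one_plus_le_exp_sum:
  fixes f :: "nat \<Rightarrow> real"
  assumes "\<And>j. 0 \<le> f j"
  shows "(\<Prod>j<d. 1 + f j) \<le> exp (\<Sum>j<d. f j)"
  unfolding exp_sum[OF finite_lessThan] using assms by (intro prod_mono) (auto simp: add_nonneg_nonneg)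

context korobov_setting
begin

text \<open>Uses the \<open>k\<close>-element subsets of the first \<open>d\<close> coordinates as frequencies.\<close>
lemma binomial_le_of_bound:
  assumes alpha: "\<alpha> > 0" and d: "1 \<le> d" and k: "1 \<le> k"
    and lin: "\<And>L. L \<in> Lam d \<Longrightarrow> acts_linearly d L"
    and bound: "\<And>\<epsilon>. \<epsilon> \<in> {0<..<1} \<Longrightarrow> enat_le_real (comp_wor \<alpha> \<gamma> d (Lam d) \<epsilon>) (C * \<epsilon> powr (- p))"
  shows "real (d choose k) \<le> C * (\<gamma> d ^ k / 2) powr (- p / 2)"
proof -
  have g: "0 < \<gamma> d" "\<gamma> d \<le> 1" using gamma_pos gamma_le_1 d by auto
  \<comment> \<open>The chosen frequencies have \<open>r <= 1 / \<gamma> d ^ k\<close>. Halving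
    yields the strict inequality \<open>r < 1 / \<epsilon>^2\<close> that the counting bound asks
    for, and keeps \<epsilon> below 1.\<close>
  define \<epsilon> where "\<epsilon> = sqrt (\<gamma> d ^ k / 2)"
  have gk: "0 < \<gamma> d ^ k" "\<gamma> d ^ k \<le> 1" using g by (auto simp: power_le_one)
  have eps: "\<epsilon> \<in> {0<..<1}" using gk by (simp add: \<epsilon>_def)
  have e2: "\<epsilon>\<^sup>2 = \<gamma> d ^ k / 2" using gk by (simp add: \<epsilon>_def)
  have ep: "\<epsilon> powr (- p) = (\<gamma> d ^ k / 2) powr (- p / 2)"
    using gk by (simp add: \<epsilon>_def powr_half_sqrt[symmetric] powr_powr)
  define ind where "ind A = (\<lambda>j\<in>{..<d}. if j \<in> A then 1 else 0 :: int)" for A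
  define F where "F = ind ` {A. A \<subseteq> {..<d} \<and> card A = k}"
  have "finite {A. A \<subseteq> {..<d} \<and> card A = k}" by (rule finite_subset[of _ "Pow {..<d}"]) auto
  then have finF: "finite F" unfolding F_def by (rule finite_imageI)
  have Ff: "F \<subseteq> freqs d" unfolding F_def ind_def using restrict_in_freqs by blast
  have "inj_on ind {A. A \<subseteq> {..<d} \<and> card A = k}"
  proof (rule inj_onI)
    fix A B assume A: "A \<in> {A. A \<subseteq> {..<d} \<and> card A = k}" and B: "B \<in> {A. A \<subseteq> {..<d} \<and> card A = k}"
      and eq: "ind A = ind B"
    have "j \<in> A \<longleftrightarrow> j \<in> B" if "j < d" for j
      using fun_cong[OF eq, of j] that by (auto simp: ind_def split: if_splits)
    then show "A = B" using A B by auto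
  qed
  then have "card F = d choose k"
    unfolding F_def by (subst card_image) (simp_all add: n_subsets)
  moreover have "r d h < 1 / \<epsilon>\<^sup>2" if hF: "h \<in> F" for h
  proof -
    obtain A where A: "A \<subseteq> {..<d}" "card A = k" "h = ind A" using hF by (auto simp: F_def)
    have finA: "finite A" using A finite_subset by blast
    have "r d h = (\<Prod>j<d. if j \<in> A then 1 / \<gamma> (Suc j) else 1)"
      unfolding r_weight_def A(3) using alpha gamma_pos
      by (intro prod.cong refl) (auto simp: ind_def powr_minus_divide less_imp_le)
    also have "\<dots> = (\<Prod>j\<in>A. 1 / \<gamma> (Suc j))"
      using A(1) by (subst prod.inter_restrict[symmetric]) (auto simp: Int_absorb1)
    also have "\<dots> \<le> (\<Prod>j\<in>A. 1 / \<gamma> d)"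
    proof (intro prod_mono conjI)
      fix j assume "j \<in> A"
      then have "\<gamma> d \<le> \<gamma> (Suc j)" using A(1) by (intro gamma_antimono) auto
      then show "1 / \<gamma> (Suc j) \<le> 1 / \<gamma> d" using g gamma_pos[of "Suc j"] by (intro divide_left_mono) auto
      show "0 \<le> 1 / \<gamma> (Suc j)" using gamma_pos[of "Suc j"] by simp
    qed
    also have "\<dots> = 1 / \<gamma> d ^ k" using A by (simp add: power_one_over)
    also have "\<dots> < 1 / \<epsilon>\<^sup>2" unfolding e2 using gk by (simp add: field_simps)
    finally show ?thesis .
  qed
  moreover obtain n where "achieves \<alpha> \<gamma> d (Lam d) \<epsilon> n" "real n \<le> C * \<epsilon> powr (- p)"
    using bound[OF eps] unfolding enat_le_real_comp_wor_iff by blast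
  ultimately have "real (d choose k) \<le> C * \<epsilon> powr (- p)"
    using achieves_imp_card_le[OF _ lin _ finF Ff, of "Lam d" \<epsilon> n] eps by auto
  then show ?thesis by (simp only: ep)
qed

text \<open>At least \<open>(d / k)^k\<close> frequencies have \<open>k\<close> ones, which outgrows
  the allowed \<open>d^q\<close> once \<open>k > q\<close>; hence \<open>\<gamma> d\<close> to the
  power \<open>u = k p / 2\<close> is at most a constant times \<open>d^(q - k)\<close>. For
  \<open>k = 1\<close> and \<open>q = 0\<close> the threshold for \<open>s\<close> is
  \<open>p / 2\<close>, the sharp value for strong tractability.\<close>

lemma summable_gamma_of_bound:
  assumes alpha: "\<alpha> > 0" and C: "C \<ge> 0" and p: "p > 0" and q: "q \<ge> 0" "q < real k"
    and lin: "\<And>d L. L \<in> Lam d \<Longrightarrow> acts_linearly d L"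
    and bound: "\<And>\<epsilon> d. \<epsilon> \<in> {0<..<1} \<Longrightarrow> 1 \<le> d \<Longrightarrow>
      enat_le_real (comp_wor \<alpha> \<gamma> d (Lam d) \<epsilon>) (C * \<epsilon> powr (- p) * real d powr q)"
    and s: "s > (real k * p / 2) / (real k - q)"
  shows "summable (\<lambda>j. \<gamma> (Suc j) powr s)"
proof -
  have k: "1 \<le> k" using q by (cases k) auto
  define u where "u = real k * p / 2"
  have u: "u > 0" using p k by (simp add: u_def)
  \<comment> \<open>Raising that decay to the power \<open>s / u\<close> gives decay exponent
    \<open>e\<close>; the assumption on \<open>s\<close> says exactly that
    \<open>e > 1\<close>.\<close>
  define e where "e = (real k - q) * s / u"
  have su: "u / (real k - q) < s" using s by (simp only: u_def)
  then have "u < s * (real k - q)" using q by (subst (asm) pos_divide_less_eq) auto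
  then have e: "e > 1" unfolding e_def by (subst pos_less_divide_eq[OF u]) (simp only: mult_1 mult.commute)
  have s0: "s > 0" using su q u by (meson diff_gt_0_iff_gt divide_pos_pos order.strict_trans)
  define D where "D = C * real k ^ k * 2 powr (p / 2)"
  have D: "D \<ge> 0" using C by (simp add: D_def)
  have main: "\<gamma> d powr s \<le> D powr (s / u) * real d powr (- e)" if d: "k \<le> d" for d
  proof -
    have d1: "1 \<le> d" using d k by simp
    have g: "0 < \<gamma> d" using gamma_pos d1 by simp
    have b: "enat_le_real (comp_wor \<alpha> \<gamma> d (Lam d) \<epsilon>) (C * real d powr q * \<epsilon> powr (- p))"
      if eps: "\<epsilon> \<in> {0<..<1}" for \<epsilon>
    proof -
      have eq: "C * real d powr q * \<epsilon> powr (- p) = C * \<epsilon> powr (- p) * real d powr q" by simp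
      show ?thesis unfolding eq by (rule bound[OF eps d1])
    qed
    have "(real d / real k) ^ k \<le> real (d choose k)" using binomial_ge_n_over_k_pow_k[of k d] d by simp
    also have "\<dots> \<le> C * real d powr q * (\<gamma> d ^ k / 2) powr (- p / 2)"
      by (rule binomial_le_of_bound[where Lam = Lam, OF alpha d1 k lin b])
    also have "(\<gamma> d ^ k / 2) powr (- p / 2) = \<gamma> d powr (- u) * 2 powr (p / 2)"
      using g by (simp add: powr_divide powr_minus powr_powr u_def flip: powr_realpow)
         (simp add: field_simps)
    finally have "(real d / real k) ^ k * \<gamma> d powr u \<le> C * real d powr q * (\<gamma> d powr (- u) * 2 powr (p / 2)) * \<gamma> d powr u"
      by (intro mult_right_mono) auto
    also have "\<dots> = C * real d powr q * 2 powr (p / 2)" using g by (simp add: powr_minus)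
    finally have "real d ^ k * \<gamma> d powr u \<le> D * real d powr q"
      using k by (simp add: D_def power_divide divide_simps mult_ac)
    moreover have "real d ^ k = real d powr (real k)" using d1 by (simp add: powr_realpow)
    ultimately have "\<gamma> d powr u \<le> D * (real d powr q / real d powr (real k))"
      using d1 by (simp add: field_simps)
    also have "real d powr q / real d powr (real k) = real d powr (q - real k)" by (simp add: powr_diff)
    finally have "(\<gamma> d powr u) powr (s / u) \<le> (D * real d powr (q - real k)) powr (s / u)"
      using s0 u by (intro powr_mono2) auto
    moreover have "(\<gamma> d powr u) powr (s / u) = \<gamma> d powr s" using u by (simp add: powr_powr)
    moreover have "(D * real d powr (q - real k)) powr (s / u) = D powr (s / u) * real d powr (- e)"
    proof -
      have "(q - real k) * (s / u) = - e" by (simp add: e_def algebra_simps diff_divide_distrib)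
      then show ?thesis using D by (simp add: powr_mult powr_powr)
    qed
    ultimately show ?thesis by simp
  qed
  have "summable (\<lambda>d. \<gamma> d powr s)"
  proof (rule summable_comparison_test_ev)
    show "\<forall>\<^sub>F d in sequentially. norm (\<gamma> d powr s) \<le> D powr (s / u) * real d powr (- e)"
      using main by (auto simp: eventually_sequentially)
    show "summable (\<lambda>d. D powr (s / u) * real d powr (- e))"
      using e by (intro summable_mult) (simp add: summable_real_powr_iff)
  qed
  then show ?thesis by (subst summable_Suc_iff)
qed

text \<open>Already in dimension 1 the frequencies \<open>1, ..., m\<close> have weights at most
  \<open>m^\<alpha> / \<gamma> 1\<close>, so the bound gives
  \<open>m <= D m^(\<alpha> p / 2)\<close> for all \<open>m\<close>. This fails for large
  \<open>m\<close> when \<open>\<alpha> p < 2\<close>.\<close>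

lemma strong_bound_exponent_ge_inverse_alpha:
  assumes alpha: "\<alpha> > 0" and p: "p \<ge> 0" and sb: "strong_bound \<alpha> \<gamma> Lam p"
    and lin: "\<And>d L. L \<in> Lam d \<Longrightarrow> acts_linearly d L"
  shows "2 / \<alpha> \<le> p"
proof (rule ccontr)
  assume "\<not> 2 / \<alpha> \<le> p"
  then have lt: "\<alpha> * p / 2 < 1" using alpha by (simp add: field_simps)
  obtain C where C: "C \<ge> 0" and bound: "\<And>\<epsilon> d. \<epsilon> \<in> {0<..<1} \<Longrightarrow> 1 \<le> d \<Longrightarrow>
      enat_le_real (comp_wor \<alpha> \<gamma> d (Lam d) \<epsilon>) (C * \<epsilon> powr (- p))"
    using sb by (auto simp: strong_bound_def)
  define g where "g = \<gamma> 1"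
  have g: "0 < g" "g \<le> 1" using gamma_pos gamma_le1 by (auto simp: g_def)
  define D where "D = C * (g / 2) powr (- p / 2)"
  have main: "real m \<le> D * real m powr (\<alpha> * p / 2)" if m: "1 \<le> m" for m :: nat
  proof -
    \<comment> \<open>The factor 1/2 makes \<open>r < 1 / \<epsilon>^2\<close> strict at frequency
      \<open>m\<close> and keeps \<epsilon> below 1.\<close>
    define \<epsilon> where "\<epsilon> = sqrt (g / 2 * real m powr (- \<alpha>))"
    have mp: "0 < real m powr (- \<alpha>)" "real m powr (- \<alpha>) \<le> 1"
      using m alpha by (auto simp: powr_minus inverse_le_1_iff intro: ge_one_powr_ge_zero)
    have "g / 2 * real m powr (- \<alpha>) \<le> 1 / 2 * 1" using g mp by (intro mult_mono) auto
    then have eps: "\<epsilon> \<in> {0<..<1}" using g m by (simp add: \<epsilon>_def)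
    have e2: "\<epsilon>\<^sup>2 = g / 2 * real m powr (- \<alpha>)" using g by (simp add: \<epsilon>_def)
    have ep: "\<epsilon> powr (- p) = (g / 2) powr (- p / 2) * real m powr (\<alpha> * p / 2)"
    proof -
      have "\<epsilon> powr (- p) = (g / 2 * real m powr (- \<alpha>)) powr (- p / 2)"
        using g by (simp add: \<epsilon>_def powr_half_sqrt[symmetric] powr_powr)
      also have "\<dots> = (g / 2) powr (- p / 2) * (real m powr (- \<alpha>)) powr (- p / 2)"
        by (rule powr_mult)
      finally show ?thesis by (simp add: powr_powr)
    qed
    define h where "h i = (\<lambda>j\<in>{..<1::nat}. int (Suc i))" for i
    define F where "F = h ` {..<m}"
    have "inj_on h {..<m}" by (auto simp: inj_on_def h_def fun_eq_iff)
    then have cF: "card F = m" by (simp add: F_def card_image)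
    have Ff: "finite F" "F \<subseteq> freqs 1" unfolding F_def h_def using restrict_in_freqs by (simp, blast)
    have "r 1 x < 1 / \<epsilon>\<^sup>2" if xF: "x \<in> F" for x
    proof -
      obtain i where i: "i < m" "x = h i" using xF by (auto simp: F_def)
      have "r 1 x = g powr (- 1) * real (Suc i) powr \<alpha>"
        unfolding r_weight_def i(2) using alpha by (simp add: h_def g_def)
      also have "\<dots> \<le> g powr (- 1) * real m powr \<alpha>"
        using i(1) alpha by (intro mult_left_mono powr_mono2) auto
      also have "\<dots> = real m powr \<alpha> / g" using g by (simp add: powr_minus_divide)
      also have "\<dots> < 2 * real m powr \<alpha> / g" using g m by (simp add: divide_strict_right_mono)
      also have "\<dots> = 1 / \<epsilon>\<^sup>2" unfolding e2 using g m by (simp add: powr_minus field_simps)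
      finally show ?thesis .
    qed
    moreover obtain n where "achieves \<alpha> \<gamma> 1 (Lam 1) \<epsilon> n" "real n \<le> C * \<epsilon> powr (- p)"
      using bound[OF eps, of 1] unfolding enat_le_real_comp_wor_iff by auto
    ultimately have "real m \<le> C * \<epsilon> powr (- p)"
      using achieves_imp_card_le[OF _ lin _ Ff, of "Lam 1" \<epsilon> n] eps cF by auto
    then show ?thesis unfolding ep D_def by (simp add: mult.assoc)
  qed
  define e where "e = 1 - \<alpha> * p / 2"
  have e: "e > 0" using lt by (simp add: e_def)
  \<comment> \<open>Chosen with \<open>x^e = |D| + 1\<close>, so that any \<open>m >= x\<close>
    violates \<open>m^e <= D\<close>.\<close>
  define x where "x = (\<bar>D\<bar> + 1) powr (1 / e)"
  obtain m :: nat where mx: "x \<le> real m" using real_arch_simple by blast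
  have "1 \<le> x" using e by (simp add: x_def ge_one_powr_ge_zero)
  then have m: "1 \<le> m" using mx by (metis of_nat_1 of_nat_le_iff order.trans)
  have "\<bar>D\<bar> + 1 = x powr e" using e by (simp add: x_def powr_powr)
  also have "\<dots> \<le> real m powr e" using mx \<open>1 \<le> x\<close> e by (intro powr_mono2) auto
  also have "\<dots> = real m / real m powr (\<alpha> * p / 2)" using m by (simp add: e_def powr_diff)
  also have "\<dots> \<le> D" using main[OF m] m by (simp add: pos_divide_le_eq)
  finally show False by simp
qed

lemma sum_exponent_le: "s > 0 \<Longrightarrow> summable (\<lambda>j. \<gamma> (Suc j) powr s) \<Longrightarrow> sum_exponent \<gamma> \<le> ereal s"
  unfolding sum_exponent_def by (intro Inf_lower) auto

lemma sum_exponent_nonneg: "0 \<le> sum_exponent \<gamma>"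
  unfolding sum_exponent_def by (intro Inf_greatest) (auto simp: zero_ereal_def[symmetric])

lemma summable_above_sum_exponent:
  assumes "sum_exponent \<gamma> < ereal s"
  shows "summable (\<lambda>j. \<gamma> (Suc j) powr s)"
proof -
  obtain t where t: "t > 0" "summable (\<lambda>j. \<gamma> (Suc j) powr t)" "t < s"
    using assms unfolding sum_exponent_def by (auto simp: Inf_less_iff)
  show ?thesis
  proof (rule summable_comparison_test[OF _ t(2)])
    have "\<gamma> (Suc j) powr s \<le> \<gamma> (Suc j) powr t" for j
      using t gamma_pos[of "Suc j"] gamma_le_1[of "Suc j"] by (intro powr_mono') auto
    then show "\<exists>N. \<forall>j\<ge>N. norm (\<gamma> (Suc j) powr s) \<le> \<gamma> (Suc j) powr t" by simp
  qed
qed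

text \<open>Combines dimension 1 with the frequencies having a single 1. It is stated for every
  linearly acting class because it gives both the exact exponent for linear information and the
  comparison with function values.\<close>

lemma strong_bound_exponent_ge:
  assumes alpha: "\<alpha> > 0" and p: "p \<ge> 0" and sb: "strong_bound \<alpha> \<gamma> Lam p"
    and lin: "\<And>d L. L \<in> Lam d \<Longrightarrow> acts_linearly d L"
  shows "2 * max (sum_exponent \<gamma>) (ereal (1 / \<alpha>)) \<le> ereal p"
proof -
  have p1: "2 / \<alpha> \<le> p" by (rule strong_bound_exponent_ge_inverse_alpha[OF assms])
  then have p0: "p > 0" using alpha by (meson divide_pos_pos less_le_trans zero_less_numeral)
  obtain C where C: "C \<ge> 0" and bound: "\<And>\<epsilon> d. \<epsilon> \<in> {0<..<1} \<Longrightarrow> 1 \<le> d \<Longrightarrow>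
      enat_le_real (comp_wor \<alpha> \<gamma> d (Lam d) \<epsilon>) (C * \<epsilon> powr (- p))"
    using sb by (auto simp: strong_bound_def)
  have "sum_exponent \<gamma> \<le> ereal (p / 2)"
  proof (rule ccontr)
    assume "\<not> ?thesis"
    then have "ereal (p / 2) < sum_exponent \<gamma>" by simp
    from ereal_dense2[OF this] obtain s where s: "ereal (p / 2) < ereal s" "ereal s < sum_exponent \<gamma>" by blast
    have "summable (\<lambda>j. \<gamma> (Suc j) powr s)"
      by (rule summable_gamma_of_bound[where k = 1 and q = 0 and Lam = Lam, OF alpha C p0 _ _ lin])
         (use bound s in auto)
    then have "sum_exponent \<gamma> \<le> ereal s" using s p0 by (intro sum_exponent_le) auto
    then show False using s by simp
  qed
  moreover have "ereal (1 / \<alpha>) \<le> ereal (p / 2)" using p1 by simp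
  ultimately have "max (sum_exponent \<gamma>) (ereal (1 / \<alpha>)) \<le> ereal (p / 2)" by simp
  then have "2 * max (sum_exponent \<gamma>) (ereal (1 / \<alpha>)) \<le> 2 * ereal (p / 2)"
    by (intro ereal_mult_left_mono) auto
  then show ?thesis by simp
qed

lemma strong_bound_all:
  assumes alpha: "\<alpha> > 0" and s: "\<alpha> * s > 1" and sum: "summable (\<lambda>j. \<gamma> (Suc j) powr s)"
  shows "strong_bound \<alpha> \<gamma> (info_all \<alpha> \<gamma>) (2 * s)"
proof -
  define z where "z = 2 * riemann_zeta (\<alpha> * s)"
  have z: "0 \<le> z" using riemann_zeta_nonneg[OF s] by (simp add: z_def)
  define S where "S = (\<Sum>j. \<gamma> (Suc j) powr s)"
  have P: "(\<Prod>j<d. 1 + z * \<gamma> (Suc j) powr s) \<le> exp (z * S)" for d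
  proof -
    have "(\<Prod>j<d. 1 + z * \<gamma> (Suc j) powr s) \<le> exp (\<Sum>j<d. z * \<gamma> (Suc j) powr s)"
      by (rule prod_one_plus_le_exp_sum) (simp add: z)
    also have "(\<Sum>j<d. z * \<gamma> (Suc j) powr s) = z * (\<Sum>j<d. \<gamma> (Suc j) powr s)" by (simp add: sum_distrib_left)
    also have "exp \<dots> \<le> exp (z * S)"
      unfolding S_def using z sum by (simp add: mult_left_mono sum_le_suminf)
    finally show ?thesis by simp
  qed
  show ?thesis
    unfolding strong_bound_def
  proof (intro exI[of _ "exp (z * S)"] conjI ballI allI impI)
    fix \<epsilon> :: real and d :: nat assume eps: "\<epsilon> \<in> {0<..<1}"
    obtain n where n: "achieves \<alpha> \<gamma> d (info_all \<alpha> \<gamma> d) \<epsilon> n"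
      "real n \<le> (\<Prod>j<d. 1 + z * \<gamma> (Suc j) powr s) * \<epsilon> powr (- (2 * s))"
      using comp_all_upper[OF alpha s eps, of d] unfolding enat_le_real_comp_wor_iff z_def by auto
    moreover have "(\<Prod>j<d. 1 + z * \<gamma> (Suc j) powr s) * \<epsilon> powr (- (2 * s)) \<le> exp (z * S) * \<epsilon> powr (- (2 * s))"
      by (intro mult_right_mono P) auto
    ultimately show "enat_le_real (comp_wor \<alpha> \<gamma> d (info_all \<alpha> \<gamma> d) \<epsilon>) (exp (z * S) * \<epsilon> powr - (2 * s))"
      unfolding enat_le_real_comp_wor_iff by (meson order.trans)
  qed simp
qed

lemma strongly_imp_tractable: "strongly_tractable \<alpha> \<gamma> Lam \<Longrightarrow> tractable \<alpha> \<gamma> Lam"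
  unfolding strongly_tractable_def strong_bound_def tractable_def
  by (elim exE conjE, rename_tac p C, rule_tac x = C in exI, rule_tac x = p in exI, rule_tac x = 0 in exI) auto

text \<open>For \<alpha> = 0 all weights are 1, so already in dimension 1 the unit ball contains
  infinitely many orthonormal exponentials and no finite amount of information gives error
  1/2.\<close>

lemma tractable_all_alpha_pos:
  assumes "tractable \<alpha> \<gamma> (info_all \<alpha> \<gamma>)"
  shows "\<alpha> > 0"
proof (rule ccontr)
  assume "\<not> \<alpha> > 0"
  then have a0: "\<alpha> = 0" using alpha_nonneg by simp
  obtain C p q where "\<And>\<epsilon> d. \<epsilon> \<in> {0<..<1} \<Longrightarrow> 1 \<le> d \<Longrightarrow>
      enat_le_real (comp_wor \<alpha> \<gamma> d (info_all \<alpha> \<gamma> d) \<epsilon>) (C * \<epsilon> powr (- p) * real d powr q)"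
    using assms unfolding tractable_def by blast
  from this[of "1/2" 1] obtain n where n: "achieves \<alpha> \<gamma> 1 (info_all \<alpha> \<gamma> 1) (1/2) n"
    unfolding enat_le_real_comp_wor_iff by auto
  define h where "h i = (\<lambda>j\<in>{..<1::nat}. int i)" for i
  define F where "F = h ` {..n}"
  have "inj_on h {..n}" by (auto simp: inj_on_def h_def fun_eq_iff)
  then have cF: "card F = Suc n" by (simp add: F_def card_image)
  have Ff: "finite F" "F \<subseteq> freqs 1" unfolding F_def h_def using restrict_in_freqs by (simp, blast)
  have "\<gamma> (Suc j) \<noteq> 0" for j using gamma_pos[of "Suc j"] by simp
  then have r1: "r 1 x = 1" for x
    unfolding r_weight_def a0 by (intro prod.neutral) auto
  have "card F \<le> n"
    by (rule achieves_imp_card_le[OF n info_all_acts_linearly _ Ff]) (simp_all add: r1[simplified] power2_eq_square)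
  then show False using cF by simp
qed

lemma tractable_all_sum_exponent:
  assumes tr: "tractable \<alpha> \<gamma> (info_all \<alpha> \<gamma>)"
  shows "sum_exponent \<gamma> < \<infinity>"
proof -
  have alpha: "\<alpha> > 0" by (rule tractable_all_alpha_pos[OF tr])
  obtain C p q where C: "C \<ge> 0" and p: "p \<ge> 0" and q: "q \<ge> 0" and bound: "\<And>\<epsilon> d. \<epsilon> \<in> {0<..<1} \<Longrightarrow> 1 \<le> d \<Longrightarrow>
      enat_le_real (comp_wor \<alpha> \<gamma> d (info_all \<alpha> \<gamma> d) \<epsilon>) (C * \<epsilon> powr (- p) * real d powr q)"
    using tr unfolding tractable_def by blast
  \<comment> \<open>\<open>k\<close> is strictly above \<open>q\<close>, as the subset count
    requires. Below, \<open>p + 1\<close> replaces \<open>p\<close> to make the exponent positive,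
    and the final \<open>+ 1\<close> puts \<open>s\<close> strictly above the threshold.\<close>
  define k where "k = nat \<lceil>q\<rceil> + 1"
  have k: "q < real k" unfolding k_def using real_nat_ceiling_ge[of q] by linarith
  define s where "s = (real k * (p + 1) / 2) / (real k - q) + 1"
  have s: "s > (real k * (p + 1) / 2) / (real k - q)" by (simp add: s_def)
  have "summable (\<lambda>j. \<gamma> (Suc j) powr s)"
  proof (rule summable_gamma_of_bound[where Lam = "info_all \<alpha> \<gamma>", OF alpha C _ q k info_all_acts_linearly _ s])
    fix \<epsilon> :: real and d :: nat assume eps: "\<epsilon> \<in> {0<..<1}" and d: "1 \<le> d"
    have "\<epsilon> powr (- p) \<le> \<epsilon> powr (- (p + 1))" using eps by (intro powr_mono') auto
    then have "C * \<epsilon> powr (- p) * real d powr q \<le> C * \<epsilon> powr (- (p + 1)) * real d powr q"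
      using C by (intro mult_right_mono mult_left_mono) auto
    then show "enat_le_real (comp_wor \<alpha> \<gamma> d (info_all \<alpha> \<gamma> d) \<epsilon>) (C * \<epsilon> powr (- (p + 1)) * real d powr q)"
      using bound[OF eps d] unfolding enat_le_real_comp_wor_iff by (meson order.trans)
  qed (use p in auto)
  moreover have "s > 0" using p k q by (simp add: s_def add_nonneg_pos)
  ultimately have "sum_exponent \<gamma> \<le> ereal s" by (intro sum_exponent_le)
  then show ?thesis by (rule le_less_trans) simp
qed

end

lemma ln_one_plus_ge_half:
  assumes "0 \<le> x" "x \<le> (1::real)"
  shows "x / 2 \<le> ln (1 + x)"
proof -
  have "ln (1 / (1 + x)) \<le> 1 / (1 + x) - 1" using assms by (intro ln_le_minus_one) auto
  then have "1 - 1 / (1 + x) \<le> ln (1 + x)" using assms by (simp add: ln_div)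
  moreover have "x / 2 \<le> 1 - 1 / (1 + x)"
  proof -
    have "1 - 1 / (1 + x) = x / (1 + x)" using assms by (simp add: field_simps)
    moreover have "x / 2 \<le> x / (1 + x)" using assms by (intro divide_left_mono) auto
    ultimately show ?thesis by simp
  qed
  ultimately show ?thesis by linarith
qed

context korobov_setting
begin

text \<open>The infimum is approached from above: every \<open>2 s\<close> with \<open>s > m\<close>
  is admissible, and \<open>strong_bound_exponent_ge\<close> excludes whatever lies below
  \<open>2 m\<close>.\<close>

lemma strong_exponent_all:
  assumes alpha: "\<alpha> > 0" and fin: "sum_exponent \<gamma> < \<infinity>"
  shows "ereal (strong_exponent \<alpha> \<gamma> (info_all \<alpha> \<gamma>)) = 2 * max (sum_exponent \<gamma>) (ereal (1 / \<alpha>))"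
proof -
  obtain s0 where s0: "sum_exponent \<gamma> = ereal s0"
    using fin sum_exponent_nonneg by (cases "sum_exponent \<gamma>") auto
  define m where "m = max s0 (1 / \<alpha>)"
  have mm: "2 * max (sum_exponent \<gamma>) (ereal (1 / \<alpha>)) = ereal (2 * m)"
    by (simp add: s0 m_def max_def)
  let ?P = "{p. p \<ge> 0 \<and> strong_bound \<alpha> \<gamma> (info_all \<alpha> \<gamma>) p}"
  have m0: "m > 0" using alpha by (simp add: m_def less_max_iff_disj)
  have mem: "2 * s \<in> ?P" if s: "m < s" for s
  proof -
    have "1 / \<alpha> < s" "s0 < s" using s by (auto simp: m_def)
    then have "\<alpha> * s > 1" "summable (\<lambda>j. \<gamma> (Suc j) powr s)"
      using alpha summable_above_sum_exponent[of s] by (auto simp: s0 field_simps)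
    then show ?thesis using strong_bound_all[OF alpha] s m0 by auto
  qed
  have low: "2 * m \<le> p" if "p \<in> ?P" for p
    using strong_bound_exponent_ge[OF alpha _ _ info_all_acts_linearly, of p "info_all \<alpha> \<gamma>"] that mm by auto
  have "Inf ?P = 2 * m"
  proof (rule antisym)
    show "2 * m \<le> Inf ?P" by (rule cInf_greatest) (use mem[of "m + 1"] low in auto)
    show "Inf ?P \<le> 2 * m"
    proof (rule field_le_epsilon)
      fix e :: real assume "e > 0"
      then have "2 * (m + e / 2) \<in> ?P" by (intro mem) simp
      then have "Inf ?P \<le> 2 * (m + e / 2)" by (rule cInf_lower) (auto intro!: bdd_belowI[of _ 0])
      then show "Inf ?P \<le> 2 * m + e" by simp
    qed
  qed
  then show ?thesis unfolding mm by (simp add: strong_exponent_def)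
qed

lemma strongly_tractable_all:
  assumes alpha: "\<alpha> > 0" and fin: "sum_exponent \<gamma> < \<infinity>"
  shows "strongly_tractable \<alpha> \<gamma> (info_all \<alpha> \<gamma>)"
proof -
  obtain s0 where s0: "sum_exponent \<gamma> = ereal s0"
    using fin sum_exponent_nonneg by (cases "sum_exponent \<gamma>") auto
  define s where "s = max s0 (1 / \<alpha>) + 1"
  have "1 / \<alpha> < s" "s0 < s" by (auto simp: s_def)
  moreover from this alpha have "0 < s" by (meson divide_pos_pos less_trans zero_less_one)
  ultimately have "\<alpha> * s > 1" "summable (\<lambda>j. \<gamma> (Suc j) powr s)" "s > 0"
    using alpha summable_above_sum_exponent[of s] by (auto simp: s0 field_simps)
  then show ?thesis unfolding strongly_tractable_def
    using strong_bound_all[OF alpha] by (intro exI[of _ "2 * s"]) auto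
qed

lemma wtrace_le_exp:
  assumes alpha: "\<alpha> > 1"
  shows "wtrace d \<le> exp (2 * riemann_zeta \<alpha> * (\<Sum>j<d. \<gamma> (Suc j)))"
  unfolding wtrace_def sum_distrib_left
  using riemann_zeta_nonneg[OF alpha] gamma_pos by (intro prod_one_plus_le_exp_sum) (simp add: less_imp_le)

lemma strong_bound_std:
  assumes alpha: "\<alpha> > 1" and sum: "summable (\<lambda>j. \<gamma> (Suc j))"
  shows "strong_bound \<alpha> \<gamma> info_std 2"
proof -
  define z where "z = 2 * riemann_zeta \<alpha>"
  have z: "0 \<le> z" using riemann_zeta_nonneg[OF alpha] by (simp add: z_def)
  define S where "S = (\<Sum>j. \<gamma> (Suc j))"
  have P: "wtrace d \<le> exp (z * S)" for d
  proof -
    have "(\<Sum>j<d. \<gamma> (Suc j)) \<le> S" unfolding S_def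
      by (rule sum_le_suminf[OF sum]) (simp_all add: less_imp_le gamma_pos)
    then have "exp (z * (\<Sum>j<d. \<gamma> (Suc j))) \<le> exp (z * S)" using z by (simp add: mult_left_mono)
    then show ?thesis by (rule order.trans[OF wtrace_le_exp[OF alpha, of d, folded z_def]])
  qed
  show ?thesis
    unfolding strong_bound_def
  proof (intro exI[of _ "7 * exp (z * S)"] conjI ballI allI impI)
    fix \<epsilon> :: real and d :: nat assume eps: "\<epsilon> \<in> {0<..<1}"
    have "7 * wtrace d * \<epsilon> powr (- 2) \<le> 7 * exp (z * S) * \<epsilon> powr (- 2)"
      by (intro mult_right_mono mult_left_mono P) auto
    then show "enat_le_real (comp_wor \<alpha> \<gamma> d (info_std d) \<epsilon>) (7 * exp (z * S) * \<epsilon> powr - 2)"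
      using comp_std_upper[OF alpha eps, of d] unfolding enat_le_real_comp_wor_iff by (meson order.trans)
  qed simp
qed

text \<open>The fixed accuracy 1/2 suffices for both necessary conditions, with
  \<open>4/3 = 1 / (1 - 1/4)\<close>. Strong tractability makes \<open>y\<close> independent of
  \<open>d\<close>, tractability makes it a constant times a power of \<open>d\<close>.\<close>

lemma prod_le_of_comp_std:
  assumes alpha: "\<alpha> > 1" and bound: "enat_le_real (comp_wor \<alpha> \<gamma> d (info_std d) (1/2)) y"
  shows "(\<Prod>j<d. 1 + \<gamma> (Suc j)) \<le> 4 / 3 * y"
proof -
  obtain n where "achieves \<alpha> \<gamma> d (info_std d) (1/2) n" "real n \<le> y"
    using bound unfolding enat_le_real_comp_wor_iff by blast
  from achieves_std_lower[OF _ _ _ this(1)] this(2) alpha show ?thesis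
    by (simp add: power2_eq_square)
qed

lemma strongly_tractable_std_imp_summable:
  assumes alpha: "\<alpha> > 1" and st: "strongly_tractable \<alpha> \<gamma> info_std"
  shows "summable (\<lambda>j. \<gamma> (Suc j))"
proof -
  obtain p C where bound: "\<And>\<epsilon> d. \<epsilon> \<in> {0<..<1} \<Longrightarrow> 1 \<le> d \<Longrightarrow>
      enat_le_real (comp_wor \<alpha> \<gamma> d (info_std d) \<epsilon>) (C * \<epsilon> powr (- p))"
    using st unfolding strongly_tractable_def strong_bound_def by blast
  define y where "y = 4 / 3 * (C * (1/2) powr (- p))"
  have g0: "0 \<le> \<gamma> (Suc j)" for j using gamma_pos[of "Suc j"] by simp
  have le: "(\<Sum>j<d. \<gamma> (Suc j)) \<le> y" if d: "1 \<le> d" for d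
  proof -
    have "(\<Sum>j<d. \<gamma> (Suc j)) + 1 \<le> (\<Prod>j<d. 1 + \<gamma> (Suc j))" by (rule sum_le_prod_one_plus) (rule g0)
    also have "\<dots> \<le> y" unfolding y_def by (rule prod_le_of_comp_std[OF alpha bound]) (use d in auto)
    finally show ?thesis by simp
  qed
  have "(\<Sum>j<d. \<gamma> (Suc j)) \<le> y" for d
  proof (cases "d = 0")
    case True
    then show ?thesis using le[of 1] g0[of 0] by simp
  qed (use le in auto)
  then show ?thesis by (intro summableI_nonneg_bounded g0)
qed

abbreviation sum_ratio :: "nat \<Rightarrow> ereal" where
  "sum_ratio \<equiv> \<lambda>d. ereal ((\<Sum>j=1..d. \<gamma> j) / ln (real d))"

lemma sum_shift: "(\<Sum>j=1..d. \<gamma> j) = (\<Sum>j<d. \<gamma> (Suc j))"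
  by (simp add: sum.atLeast1_atMost_eq)

lemma tractable_std_imp_limsup:
  assumes alpha: "\<alpha> > 1" and tr: "tractable \<alpha> \<gamma> info_std"
  shows "limsup sum_ratio < \<infinity>"
proof -
  obtain C p q where C: "C \<ge> 0" and q: "q \<ge> 0" and bound: "\<And>\<epsilon> d. \<epsilon> \<in> {0<..<1} \<Longrightarrow> 1 \<le> d \<Longrightarrow>
      enat_le_real (comp_wor \<alpha> \<gamma> d (info_std d) \<epsilon>) (C * \<epsilon> powr (- p) * real d powr q)"
    using tr unfolding tractable_def by blast
  \<comment> \<open>The added 1 ensures \<open>ln D >= 0\<close>.\<close>
  define D where "D = 4 / 3 * (C * (1/2) powr (- p)) + 1"
  have D: "D \<ge> 1" using C by (simp add: D_def)
  \<comment> \<open>From \<open>d >= 3\<close> on, \<open>ln d >= 1\<close>, so the constant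
    \<open>ln D\<close> can be absorbed into a multiple of \<open>ln d\<close>.\<close>
  have le: "sum_ratio d \<le> ereal (2 * (ln D + q))" if d: "3 \<le> d" for d
  proof -
    have d1: "1 \<le> d" using d by simp
    have ln1: "1 \<le> ln (real d)"
    proof -
      have "exp 1 \<le> (3::real)" by (rule exp_le)
      then show ?thesis using d by (subst ln_ge_iff) auto
    qed
    have pos: "0 < 1 + \<gamma> (Suc j)" for j using gamma_pos[of "Suc j"] by simp
    then have nz: "1 + \<gamma> (Suc j) \<noteq> 0" for j by (metis less_irrefl)
    have "(\<Sum>j<d. \<gamma> (Suc j)) / 2 \<le> (\<Sum>j<d. ln (1 + \<gamma> (Suc j)))"
      unfolding sum_divide_distrib
      by (intro sum_mono ln_one_plus_ge_half gamma_le_1) (simp_all add: less_imp_le gamma_pos)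
    also have "\<dots> = ln (\<Prod>j<d. 1 + \<gamma> (Suc j))" using nz by (subst ln_prod) auto
    also have "\<dots> \<le> ln (D * real d powr q)"
    proof -
      have "(\<Prod>j<d. 1 + \<gamma> (Suc j)) \<le> 4 / 3 * (C * (1/2) powr (- p) * real d powr q)"
        by (rule prod_le_of_comp_std[OF alpha bound]) (use d1 in auto)
      also have "\<dots> \<le> D * real d powr q" by (simp add: D_def algebra_simps)
      finally show ?thesis using pos D d1 by (subst ln_le_cancel_iff) (auto intro!: prod_pos)
    qed
    also have "\<dots> = ln D + q * ln (real d)" using D d1 by (simp add: ln_mult ln_powr)
    also have "\<dots> \<le> (ln D + q) * ln (real d)"
      using mult_left_mono[OF ln1, of "ln D"] D by (simp add: distrib_right)
    finally have "(\<Sum>j<d. \<gamma> (Suc j)) \<le> 2 * (ln D + q) * ln (real d)" by (simp add: algebra_simps)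
    then show ?thesis unfolding sum_shift using ln1 by (simp add: pos_divide_le_eq)
  qed
  have "limsup sum_ratio \<le> ereal (2 * (ln D + q))"
    by (rule Limsup_bounded) (use le in \<open>auto simp: eventually_sequentially intro!: exI[of _ 3]\<close>)
  then show ?thesis by (rule le_less_trans) simp
qed

text \<open>The trace is at most \<open>exp (z * sum)\<close>, so a sum of order
  \<open>(a + \<eta>) ln d\<close> makes it a power of \<open>d\<close>. The second conclusion keeps
  the resulting power of \<open>d\<close> nonnegative, as \<open>tractable\<close> demands.\<close>

lemma limsup_imp_std_bound:
  assumes alpha: "\<alpha> > 1" and fin: "limsup sum_ratio < \<infinity>" and delta: "\<delta> > 0"
  shows "\<exists>C>0. \<forall>d\<ge>1. \<forall>\<epsilon>\<in>{0<..<1}. enat_le_real (comp_wor \<alpha> \<gamma> d (info_std d) \<epsilon>)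
    (C * \<epsilon> powr (- (2 + \<delta>)) * real d powr (4 * riemann_zeta \<alpha> * real_of_ereal (limsup sum_ratio) + \<delta>))"
    and "0 \<le> real_of_ereal (limsup sum_ratio)"
proof -
  have g0: "0 \<le> \<gamma> (Suc j)" for j using gamma_pos[of "Suc j"] by simp
  \<comment> \<open>This includes \<open>d = 1\<close>, where division by \<open>ln 1 = 0\<close>
    yields 0. A nonnegative finite limsup is a real number, so \<open>real_of_ereal\<close> returns
    its true value.\<close>
  have "0 \<le> sum_ratio d" if "1 \<le> d" for d
    unfolding sum_shift using that g0 by (simp add: sum_nonneg)
  then have "0 \<le> limsup sum_ratio"
    by (intro le_Limsup) (auto simp: eventually_sequentially)
  then obtain a where a: "limsup sum_ratio = ereal a" "a \<ge> 0"
    using fin by (cases "limsup sum_ratio") auto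
  then show a0: "0 \<le> real_of_ereal (limsup sum_ratio)" by simp
  define z where "z = 2 * riemann_zeta \<alpha>"
  have z: "0 \<le> z" using riemann_zeta_nonneg[OF alpha] by (simp add: z_def)
  \<comment> \<open>For large \<open>d\<close> the ratio exceeds the limsup by less than
    \<open>\<eta>\<close>, which costs at most \<open>z * \<eta> <= \<delta>\<close> in the power of
    \<open>d\<close>.\<close>
  define \<eta> where "\<eta> = \<delta> / (z + 1)"
  have eta: "\<eta> > 0" "z * \<eta> \<le> \<delta>" using delta z by (auto simp: \<eta>_def field_simps)
  have "limsup sum_ratio < ereal (a + \<eta>)" using a eta by simp
  then have "\<forall>\<^sub>F d in sequentially. sum_ratio d < ereal (a + \<eta>)" by (rule Limsup_lessD)
  then obtain N where N: "\<And>d. N \<le> d \<Longrightarrow> sum_ratio d < ereal (a + \<eta>)" by (auto simp: eventually_sequentially)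
  define e where "e = 4 * riemann_zeta \<alpha> * a + \<delta>"
  have e: "e \<ge> 0" "z * (a + \<eta>) \<le> e"
  proof -
    show "e \<ge> 0" using z a(2) delta by (simp add: e_def z_def)
    have "z * a \<le> 4 * riemann_zeta \<alpha> * a" using z a(2) by (intro mult_right_mono) (auto simp: z_def)
    then show "z * (a + \<eta>) \<le> e" using eta by (simp add: e_def distrib_left)
  qed
  \<comment> \<open>Dimensions below \<open>N + 2\<close> are absorbed into the constant
    \<open>W\<close>; from \<open>N + 2\<close> on the ratio bound applies and \<open>ln d\<close>
    is positive.\<close>
  define W where "W = exp (z * (\<Sum>j<N + 2. \<gamma> (Suc j)))"
  have W: "W \<ge> 1" unfolding W_def using z g0 by (simp add: sum_nonneg)
  have main: "wtrace d \<le> W * real d powr e" if d: "1 \<le> d" for d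
  proof (cases "N + 2 \<le> d")
    case True
    then have ln0: "ln (real d) > 0" by simp
    have "sum_ratio d < ereal (a + \<eta>)" using True by (intro N) simp
    then have "(\<Sum>j<d. \<gamma> (Suc j)) \<le> (a + \<eta>) * ln (real d)"
      unfolding sum_shift using ln0 by (simp add: pos_divide_less_eq)
    then have "z * (\<Sum>j<d. \<gamma> (Suc j)) \<le> z * (a + \<eta>) * ln (real d)" using z by (simp add: mult_left_mono mult.assoc)
    also have "\<dots> \<le> e * ln (real d)" using e ln0 by (intro mult_right_mono) auto
    finally have "exp (z * (\<Sum>j<d. \<gamma> (Suc j))) \<le> real d powr e" using d by (simp add: powr_def)
    then have "wtrace d \<le> real d powr e" using wtrace_le_exp[OF alpha, of d] by (simp add: z_def)
    also have "\<dots> \<le> W * real d powr e" using W by (simp add: mult_right_mono[of 1 W, simplified])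
    finally show ?thesis .
  next
    case False
    have "(\<Sum>j<d. \<gamma> (Suc j)) \<le> (\<Sum>j<N + 2. \<gamma> (Suc j))"
      using False g0 by (intro sum_mono2) auto
    then have "exp (z * (\<Sum>j<d. \<gamma> (Suc j))) \<le> W" using z by (simp add: W_def mult_left_mono)
    then have "wtrace d \<le> W" using wtrace_le_exp[OF alpha, of d] by (simp add: z_def)
    also have "\<dots> \<le> W * real d powr e" using W ge_one_powr_ge_zero[of "real d" e] e d by (simp add: mult_le_cancel_left1)
    finally show ?thesis .
  qed
  show "\<exists>C>0. \<forall>d\<ge>1. \<forall>\<epsilon>\<in>{0<..<1}. enat_le_real (comp_wor \<alpha> \<gamma> d (info_std d) \<epsilon>)
    (C * \<epsilon> powr (- (2 + \<delta>)) * real d powr (4 * riemann_zeta \<alpha> * real_of_ereal (limsup sum_ratio) + \<delta>))"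
  proof (intro exI[of _ "7 * W"] conjI allI impI ballI)
    show "0 < 7 * W" using W by simp
    fix d :: nat and \<epsilon> :: real assume d: "1 \<le> d" and eps: "\<epsilon> \<in> {0<..<1}"
    have "7 * wtrace d * \<epsilon> powr (- 2) \<le> 7 * (W * real d powr e) * \<epsilon> powr (- (2 + \<delta>))"
    proof (intro mult_mono)
      show "wtrace d \<le> W * real d powr e" by (rule main[OF d])
      show "\<epsilon> powr (- 2) \<le> \<epsilon> powr (- (2 + \<delta>))" using eps delta by (intro powr_mono') auto
    qed (use W wtrace_ge_1[OF alpha, of d] in auto)
    also have "\<dots> = 7 * W * \<epsilon> powr (- (2 + \<delta>)) * real d powr e" by simp
    finally show "enat_le_real (comp_wor \<alpha> \<gamma> d (info_std d) \<epsilon>)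
      (7 * W * \<epsilon> powr (- (2 + \<delta>)) * real d powr (4 * riemann_zeta \<alpha> * real_of_ereal (limsup sum_ratio) + \<delta>))"
      using comp_std_upper[OF alpha eps, of d] unfolding enat_le_real_comp_wor_iff a(1) real_of_ereal.simps e_def[symmetric]
      by (meson order.trans)
  qed
qed

lemma limsup_imp_tractable_std:
  assumes alpha: "\<alpha> > 1" and fin: "limsup sum_ratio < \<infinity>"
  shows "tractable \<alpha> \<gamma> info_std"
proof -
  let ?q = "4 * riemann_zeta \<alpha> * real_of_ereal (limsup sum_ratio) + 1"
  obtain C where C: "C > 0" "\<forall>d\<ge>1. \<forall>\<epsilon>\<in>{0<..<1}. enat_le_real (comp_wor \<alpha> \<gamma> d (info_std d) \<epsilon>)
    (C * \<epsilon> powr (- (2 + 1)) * real d powr ?q)"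
    using limsup_imp_std_bound(1)[OF alpha fin zero_less_one] by blast
  have "?q \<ge> 0"
    using limsup_imp_std_bound(2)[OF alpha fin zero_less_one] riemann_zeta_nonneg[OF alpha] by simp
  moreover have "enat_le_real (comp_wor \<alpha> \<gamma> d (info_std d) \<epsilon>) (C * \<epsilon> powr (- (2 + 1)) * real d powr ?q)"
    if "\<epsilon> \<in> {0<..<1}" "1 \<le> d" for \<epsilon> d
    using C(2) that by blast
  ultimately show ?thesis
    unfolding tractable_def using less_imp_le[OF C(1)]
    by (intro exI[of _ C] exI[of _ "2 + 1"] exI[of _ ?q] conjI ballI allI impI) simp_all
qed

text \<open>The trace bound makes 2 an admissible exponent for function values, so the claimed upper
  bound follows from nonnegativity of the exponent for linear information. The lower bound holds
  since every admissible exponent for function values obeys the counting bound, which equals the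
  exponent for linear information.\<close>

lemma strong_exponents_std:
  assumes alpha: "\<alpha> > 1" and sum: "summable (\<lambda>j. \<gamma> (Suc j))"
  shows "strong_exponent \<alpha> \<gamma> (info_all \<alpha> \<gamma>) \<le> 2"
    and "strong_exponent \<alpha> \<gamma> (info_all \<alpha> \<gamma>) \<le> strong_exponent \<alpha> \<gamma> info_std"
    and "strong_exponent \<alpha> \<gamma> info_std \<le> strong_exponent \<alpha> \<gamma> (info_all \<alpha> \<gamma>) + 2"
proof -
  have alpha0: "\<alpha> > 0" using alpha by simp
  have "summable (\<lambda>j. \<gamma> (Suc j) powr 1)" using sum gamma_pos by (simp add: less_imp_le)
  then have s1: "sum_exponent \<gamma> \<le> ereal 1" by (intro sum_exponent_le) auto
  then have fin: "sum_exponent \<gamma> < \<infinity>" by (rule le_less_trans) simp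
  note ex = strong_exponent_all[OF alpha0 fin]
  have "max (sum_exponent \<gamma>) (ereal (1 / \<alpha>)) \<le> ereal 1" using s1 alpha by simp
  then have "2 * max (sum_exponent \<gamma>) (ereal (1 / \<alpha>)) \<le> 2 * ereal 1" by (intro ereal_mult_left_mono) auto
  then show "strong_exponent \<alpha> \<gamma> (info_all \<alpha> \<gamma>) \<le> 2" unfolding ex[symmetric] by simp
  have "0 \<le> 2 * max (sum_exponent \<gamma>) (ereal (1 / \<alpha>))"
    using sum_exponent_nonneg by (simp add: le_max_iff_disj)
  then have nonneg: "0 \<le> strong_exponent \<alpha> \<gamma> (info_all \<alpha> \<gamma>)" unfolding ex[symmetric] by simp
  let ?P = "{p. p \<ge> 0 \<and> strong_bound \<alpha> \<gamma> info_std p}"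
  have 2: "2 \<in> ?P" using strong_bound_std[OF alpha sum] by simp
  show "strong_exponent \<alpha> \<gamma> (info_all \<alpha> \<gamma>) \<le> strong_exponent \<alpha> \<gamma> info_std"
    unfolding strong_exponent_def[of _ _ info_std]
  proof (rule cInf_greatest)
    show "?P \<noteq> {}" using 2 by blast
    fix p assume "p \<in> ?P"
    then have "2 * max (sum_exponent \<gamma>) (ereal (1 / \<alpha>)) \<le> ereal p"
      using strong_bound_exponent_ge[OF alpha0 _ _ info_std_acts_linearly, of p info_std] by auto
    then show "strong_exponent \<alpha> \<gamma> (info_all \<alpha> \<gamma>) \<le> p" unfolding ex[symmetric] by simp
  qed
  have "strong_exponent \<alpha> \<gamma> info_std \<le> 2"
    unfolding strong_exponent_def using 2 by (rule cInf_lower) (auto intro!: bdd_belowI[of _ 0])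
  then show "strong_exponent \<alpha> \<gamma> info_std \<le> strong_exponent \<alpha> \<gamma> (info_all \<alpha> \<gamma>) + 2" using nonneg by simp
qed

end

theorem theorem1:
  fixes \<alpha> :: real and \<gamma> :: "nat \<Rightarrow> real"
  assumes alpha_nonneg: "\<alpha> \<ge> 0"
    and gamma_pos: "\<And>j. j \<ge> 1 \<Longrightarrow> 0 < \<gamma> j"
    and gamma_le1: "\<gamma> 1 \<le> 1"
    and gamma_mono: "\<And>j. j \<ge> 1 \<Longrightarrow> \<gamma> (Suc j) \<le> \<gamma> j"
  shows
    "((strongly_tractable \<alpha> \<gamma> (info_all \<alpha> \<gamma>) \<longleftrightarrow> tractable \<alpha> \<gamma> (info_all \<alpha> \<gamma>))
      \<and> (tractable \<alpha> \<gamma> (info_all \<alpha> \<gamma>) \<longleftrightarrow> sum_exponent \<gamma> < \<infinity> \<and> \<alpha> > 0)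
      \<and> (tractable \<alpha> \<gamma> (info_all \<alpha> \<gamma>) \<longrightarrow>
           ereal (strong_exponent \<alpha> \<gamma> (info_all \<alpha> \<gamma>))
             = 2 * max (sum_exponent \<gamma>) (ereal (1 / \<alpha>))))
   \<and> (\<alpha> > 1 \<longrightarrow>
       (strongly_tractable \<alpha> \<gamma> info_std \<longleftrightarrow> summable (\<lambda>j. \<gamma> (Suc j)))
       \<and> (summable (\<lambda>j. \<gamma> (Suc j)) \<longrightarrow>
            strong_exponent \<alpha> \<gamma> (info_all \<alpha> \<gamma>) \<le> 2
          \<and> strong_exponent \<alpha> \<gamma> (info_all \<alpha> \<gamma>) \<le> strong_exponent \<alpha> \<gamma> info_std
          \<and> strong_exponent \<alpha> \<gamma> info_std \<le> strong_exponent \<alpha> \<gamma> (info_all \<alpha> \<gamma>) + 2))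
   \<and> (\<alpha> > 1 \<longrightarrow>
       (tractable \<alpha> \<gamma> info_std \<longleftrightarrow>
          limsup (\<lambda>d. ereal ((\<Sum>j=1..d. \<gamma> j) / ln (real d))) < \<infinity>)
       \<and> (limsup (\<lambda>d. ereal ((\<Sum>j=1..d. \<gamma> j) / ln (real d))) < \<infinity> \<longrightarrow>
            (\<forall>\<delta>>0. \<exists>C>0. \<forall>d\<ge>1. \<forall>\<epsilon>\<in>{0<..<1}.
               enat_le_real (comp_wor \<alpha> \<gamma> d (info_std d) \<epsilon>)
                 (C * \<epsilon> powr (-(2 + \<delta>)) * real d powr
                    (4 * riemann_zeta \<alpha> *
                       real_of_ereal (limsup (\<lambda>d. ereal ((\<Sum>j=1..d. \<gamma> j) / ln (real d))))
                     + \<delta>)))))"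
proof -
  interpret korobov_setting \<alpha> \<gamma> by unfold_locales (fact assms)+
  have all: "strongly_tractable \<alpha> \<gamma> (info_all \<alpha> \<gamma>) \<longleftrightarrow> tractable \<alpha> \<gamma> (info_all \<alpha> \<gamma>)"
    "tractable \<alpha> \<gamma> (info_all \<alpha> \<gamma>) \<longleftrightarrow> sum_exponent \<gamma> < \<infinity> \<and> \<alpha> > 0"
    using strongly_imp_tractable[of "info_all \<alpha> \<gamma>"] strongly_tractable_all
      tractable_all_alpha_pos tractable_all_sum_exponent by blast+
  have std: "strongly_tractable \<alpha> \<gamma> info_std \<longleftrightarrow> summable (\<lambda>j. \<gamma> (Suc j))" if "\<alpha> > 1"
    using strongly_tractable_std_imp_summable[OF that] strong_bound_std[OF that]
    unfolding strongly_tractable_def by (meson zero_le_numeral)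
  show ?thesis
  proof (intro conjI impI)
    show "strongly_tractable \<alpha> \<gamma> (info_all \<alpha> \<gamma>) \<longleftrightarrow> tractable \<alpha> \<gamma> (info_all \<alpha> \<gamma>)"
      "tractable \<alpha> \<gamma> (info_all \<alpha> \<gamma>) \<longleftrightarrow> sum_exponent \<gamma> < \<infinity> \<and> \<alpha> > 0" by (fact all)+
  next
    assume "tractable \<alpha> \<gamma> (info_all \<alpha> \<gamma>)"
    then have "\<alpha> > 0" "sum_exponent \<gamma> < \<infinity>" by (simp_all add: all)
    then show "ereal (strong_exponent \<alpha> \<gamma> (info_all \<alpha> \<gamma>)) = 2 * max (sum_exponent \<gamma>) (ereal (1 / \<alpha>))"
      by (rule strong_exponent_all)
  next
    assume "\<alpha> > 1"
    then show "strongly_tractable \<alpha> \<gamma> info_std \<longleftrightarrow> summable (\<lambda>j. \<gamma> (Suc j))" by (rule std)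
  next
    assume "\<alpha> > 1" "summable (\<lambda>j. \<gamma> (Suc j))"
    then show "strong_exponent \<alpha> \<gamma> (info_all \<alpha> \<gamma>) \<le> 2"
      "strong_exponent \<alpha> \<gamma> (info_all \<alpha> \<gamma>) \<le> strong_exponent \<alpha> \<gamma> info_std"
      "strong_exponent \<alpha> \<gamma> info_std \<le> strong_exponent \<alpha> \<gamma> (info_all \<alpha> \<gamma>) + 2"
      by (rule strong_exponents_std)+
  next
    assume "\<alpha> > 1"
    then show "tractable \<alpha> \<gamma> info_std \<longleftrightarrow> limsup sum_ratio < \<infinity>"
      using tractable_std_imp_limsup limsup_imp_tractable_std by (intro iffI)
  next
    assume "\<alpha> > 1" "limsup sum_ratio < \<infinity>"
    then show "\<forall>\<delta>>0. \<exists>C>0. \<forall>d\<ge>1. \<forall>\<epsilon>\<in>{0<..<1}. enat_le_real (comp_wor \<alpha> \<gamma> d (info_std d) \<epsilon>)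
        (C * \<epsilon> powr (- (2 + \<delta>)) * real d powr (4 * riemann_zeta \<alpha> * real_of_ereal (limsup sum_ratio) + \<delta>))"
      by (intro allI impI limsup_imp_std_bound(1))
  qed
qed

end
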